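(* Let $\nu\in(0,1)$, $\alpha>0$, let $\ell$ be the smallest integer such that $\nu\ell+\alpha>1$, and let $x=(x^1,\dots,x^\ell)$ be an $(L_4,\nu,\ell)$-rough path. Let $y=(y^{(0)},\dots,y^{(\ell-1)})$ be a discrete $\mathcal V$-valued process on $[0,1]$ controlled by $(x,\alpha)$ in $L_2$ or almost surely. Let $(h^n)_{n\ge1}$ be $\mathcal V'$-valued $1$-increments for which there is a constant $K$ independent of $n$ with $$|\mathcal J_s^t(x^i;h^n)|_{L_2}\le K(t-s)^{\alpha+\nu i},\qquad i=0,1,\dots,\ell-1,\ (s,t)\in\mathcal S_2'.$$ Suppose that: (i) there are $\tau\in\{0,1,\dots,\ell-1\}$ and a constant $\varrho\in(\mathbb R^d)^{\otimes\tau}\otimes\mathcal V'$ such that $\mathcal J_s^t(x^\tau;h^n)\to(t-s)\varrho$ in probability as $n\to\infty$ for all $(s,t)\in\mathcal S_2$, and $\mathcal J_s^t(x^i;h^n)\to0$ in probability for all $i<\tau$ and $(s,t)\in\mathcal S_2$; (ii) for every $i=\tau+1,\dots,\ell-1$ and for any partition $0\le s_0<s_1<\cdots<s_m\le1$ such that $m\ll n$ and $|s_{j+1}-s_j|\le\frac1m$, one has, in probability, $$\lim_{m\to\infty}\limsup_{n\to\infty}\Big|\sum_{j=0}^{m-1}\mathcal J_{s_j}^{s_{j+1}}(x^i;h^n)\Big|=0 .$$ Then, in probability, $$\lim_{n\to\infty}\mathcal J_s^t(y;h^n)=\Big(\int_s^t y^{(\tau)}_u\,du\Big)\otimes\varrho\qquad\text{for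 } (s,t)\in\mathcal S_2.$$
   Context: Grid. For $n\in\mathbb N$ let $t_k=k/n$ and $\mathcal D_n=\{t_0,\dots,t_n\}$. $\mathcal S_2=\{(s,t):0\le s\le t\le 1\}$, $\mathcal S_2'=\{(s,t)\in\mathcal D_n^2:s<t\}$. Put $\varepsilon(s)=t_k$ if $s\in(t_{k-1},t_k]$, and $\varepsilon(0)=0$. All random variables live on one probability space; $|\cdot|_{L_p}$ is the $L_p$-norm. $\delta f_{st}=f_t-f_s$ for a path $f$, and $\delta g_{sut}=g_{st}-g_{su}-g_{ut}$ for a two-parameter function $g$. $\mathcal V,\mathcal V'$ are finite-dimensional vector spaces. Rough path. For $p>1$ and an integer $\ell\le\lfloor1/\nu\rfloor$, an $(L_p,\nu,\ell)$-rough path is a continuous process $x=(x^1,\dots,x^\ell)$ on $\mathcal S_2$ with $x^k_{st}\in(\mathbb R^d)^{\otimes k}$, such that $\sup_{s<t}|x^k_{st}|_{L_p}^{1/k}/|t-s|^{\nu}<\infty$ for each $k$, $\delta x^1=0$, and $\delta x^k_{sut}=\sum_{j=1}^{k-1}x^{k-j}_{su}\otimes x^j_{ut}$ for $k\ge2$. By convention $x^0\equiv1$. Controlled process. Given $\alpha>0$, let $\ell$ be the smallest integer with $\nu\ell+\alpha>1$. Continuous processes $y=y^{(0)},y^{(1)},\dots,y^{(\ell-1)}$ on $[0,1]$, with $y_0=0$, $y^{(0)}$ valued in $\mathcal V$ and $y^{(k)}$ valued in $\mathcal L((\mathbb R^d)^{\otimes k},\mathcal V)$, have remainders $r^{(k)}_{st}=\delta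 y^{(k)}_{st}-\sum_{j=1}^{\ell-1-k}y^{(k+j)}_s x^j_{st}$ for $0\le k\le\ell-2$ and $r^{(\ell-1)}_{st}=\delta y^{(\ell-1)}_{st}$. They are controlled by $(x,\alpha)$ in $L_p$ if $|r^{(k)}_{st}|_{L_p}\le K(t-s)^{(\ell-k)\nu}$ for all $(s,t)\in\mathcal S_2$ and $k=0,\dots,\ell-1$, and almost surely if $|r^{(k)}_{st}|\le G_y(t-s)^{(\ell-k)\nu}$ for these $k$ and an a.s. finite random variable $G_y$. $1$-increments and discrete integrals. A $1$-increment $h^n$ is a two-parameter process on the grid $\mathcal D_n$, with $h^n_{st}=\sum_{s\le t_k<t}h^n_{t_kt_{k+1}}$. For the two-parameter processes $x^i$, $\mathcal J_s^t(x^i;h^n)=\sum_{s\le t_k<t}x^i_{\varepsilon(s)t_k}\otimes h^n_{t_kt_{k+1}}$ (in particular $\mathcal J(x^0;h^n)=h^n$); for the weight $y$, $\mathcal J_s^t(y;h^n)=\sum_{s\le t_k<t}y_{t_k}\otimes h^n_{t_kt_{k+1}}$. Conventions. For $A\in\mathcal L((\mathbb R^d)^{\otimes\tau},\mathcal V)$ and $\varrho\in(\mathbb R^d)^{\otimes\tau}\otimes\mathcal V'$, $A\otimes\varrho\in\mathcal V\otimes\mathcal V'$ is obtained by applying $A$ to the $(\mathbb R^d)^{\otimes\tau}$-factor of $\varrho$. "$\lim_m\limsup_n|A_{m,n}|=0$ in probability" means $\lim_m\limsup_n P(|A_{m,n}|>\eta)=0$ for all $\eta>0$. "$m\ll n$"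 indicates that $n\to\infty$ is taken before $m\to\infty$. *)

theory Defs
  imports "HOL-Probability.Probability"
begin

text \<open>
  Tensors are handled in coordinates with respect to the canonical basis
  \<open>(e_w)\<close> of \<open>(R^d)^{\<otimes>k}\<close>, indexed by the words \<open>w\<close> of length \<open>k\<close> over the
  index set \<open>'d\<close> (so \<open>d = CARD('d)\<close>). An array \<open>A :: 'd list \<Rightarrow> 'a\<close>, of which only the entries
  at words of length \<open>k\<close> matter, stands for

    \<^item> an element \<open>\<Sum>_w A_w e_w\<close> of \<open>(R^d)^{\<otimes>k}\<close>, if \<open>'a = real\<close>;
    \<^item> an element \<open>\<Sum>_w e_w \<otimes> A_w\<close> of \<open>(R^d)^{\<otimes>k} \<otimes> 'a\<close>;
    \<^item> the linear map in \<open>L((R^d)^{\<otimes>k}, 'a)\<close> that sends \<open>e_w\<close> to \<open>A_w\<close>.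

  The finite-dimensional spaces \<open>V\<close> and \<open>V'\<close> are types of class \<open>euclidean_space\<close>.
\<close>

definition words :: "nat \<Rightarrow> 'd list set" where
  "words k = {w. length w = k}"

text \<open>All norms on the finite-dimensional spaces above are equivalent; this is the
  Hilbert--Schmidt one.\<close>

definition tensor_norm :: "nat \<Rightarrow> ('d list \<Rightarrow> 'a::real_normed_vector) \<Rightarrow> real" where
  "tensor_norm k A = L2_set (\<lambda>w. norm (A w)) (words k)"

text \<open>\<open>A \<otimes> B\<close> for \<open>A\<close> of degree \<open>i\<close>.\<close>

definition tensor_mult :: "nat \<Rightarrow> ('d list \<Rightarrow> real) \<Rightarrow> ('d list \<Rightarrow> real) \<Rightarrow> 'd list \<Rightarrow> real" where
  "tensor_mult i A B = (\<lambda>w. A (take i w) * B (drop i w))"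

text \<open>For \<open>A \<in> L((R^d)^{\<otimes>(k+j)}, V)\<close> and \<open>a \<in> (R^d)^{\<otimes>j}\<close>, the map
  \<open>A a \<in> L((R^d)^{\<otimes>k}, V)\<close> is \<open>b \<mapsto> A (a \<otimes> b)\<close>. This order of the factors is the one
  compatible with Chen's relation.\<close>

definition partial_apply ::
    "nat \<Rightarrow> ('d list \<Rightarrow> 'v::real_vector) \<Rightarrow> ('d list \<Rightarrow> real) \<Rightarrow> 'd list \<Rightarrow> 'v" where
  "partial_apply j A a = (\<lambda>w. \<Sum>u\<in>words j. a u *\<^sub>R A (u @ w))"

text \<open>\<open>V \<otimes> V'\<close> is realised as the space of linear maps from \<open>V\<close> to \<open>V'\<close>, the inner product
  identifying \<open>V\<close> with its dual; \<open>v \<otimes> v'\<close> is the rank-one map \<open>a \<mapsto> \<langle>v, a\<rangle> v'\<close>.\<close>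

definition vtensor :: "'v::euclidean_space \<Rightarrow> 'w::euclidean_space \<Rightarrow> 'v \<Rightarrow>\<^sub>L 'w" where
  "vtensor v v' = Blinfun (\<lambda>a. (v \<bullet> a) *\<^sub>R v')"

lemma blinfun_apply_vtensor: "blinfun_apply (vtensor v v') a = (v \<bullet> a) *\<^sub>R v'"
proof -
  have "bounded_linear (\<lambda>a. (v \<bullet> a) *\<^sub>R v')"
    by (intro bounded_linear_intros)
  then show ?thesis
    by (simp add: vtensor_def bounded_linear_Blinfun_apply)
qed

text \<open>\<open>A \<otimes> \<rho> \<in> V \<otimes> V'\<close> for \<open>A \<in> L((R^d)^{\<otimes>k}, V)\<close> and \<open>\<rho> \<in> (R^d)^{\<otimes>k} \<otimes> V'\<close>.\<close>

definition contract ::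
    "nat \<Rightarrow> ('d list \<Rightarrow> 'v::euclidean_space) \<Rightarrow> ('d list \<Rightarrow> 'w::euclidean_space) \<Rightarrow> 'v \<Rightarrow>\<^sub>L 'w" where
  "contract k A \<rho> = (\<Sum>w\<in>words k. vtensor (A w) (\<rho> w))"

definition delta1 :: "(real \<Rightarrow> 'a::minus) \<Rightarrow> real \<Rightarrow> real \<Rightarrow> 'a" where
  "delta1 f s t = f t - f s"

definition delta2 :: "(real \<Rightarrow> real \<Rightarrow> 'a::minus) \<Rightarrow> real \<Rightarrow> real \<Rightarrow> real \<Rightarrow> 'a" where
  "delta2 g s u t = g s t - g s u - g u t"

definition simplex2 :: "(real \<times> real) set" where
  "simplex2 = {(s, t). 0 \<le> s \<and> s \<le> t \<and> t \<le> 1}"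

definition gpt :: "nat \<Rightarrow> nat \<Rightarrow> real" where
  "gpt n k = real k / real n"

definition grid :: "nat \<Rightarrow> real set" where
  "grid n = gpt n ` {..n}"

text \<open>\<open>\<lceil>n s\<rceil> = k\<close> holds iff \<open>s \<in> (t_{k-1}, t_k]\<close>.\<close>

definition grid_eps :: "nat \<Rightarrow> real \<Rightarrow> real" where
  "grid_eps n s = of_int \<lceil>real n * s\<rceil> / real n"

definition Lp_norm :: "'o measure \<Rightarrow> real \<Rightarrow> ('o \<Rightarrow> real) \<Rightarrow> real" where
  "Lp_norm M p X = (\<integral>\<omega>. \<bar>X \<omega>\<bar> powr p \<partial>M) powr (1 / p)"

definition in_Lp :: "'o measure \<Rightarrow> real \<Rightarrow> ('o \<Rightarrow> real) \<Rightarrow> bool" where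
  "in_Lp M p X \<longleftrightarrow> X \<in> borel_measurable M \<and> integrable M (\<lambda>\<omega>. \<bar>X \<omega>\<bar> powr p)"

definition tendsto_zero_in_prob :: "'o measure \<Rightarrow> (nat \<Rightarrow> 'o \<Rightarrow> real) \<Rightarrow> bool" where
  "tendsto_zero_in_prob M Z \<longleftrightarrow>
     (\<forall>n. Z n \<in> borel_measurable M) \<and>
     (\<forall>\<eta>>0. (\<lambda>n. measure M {\<omega> \<in> space M. \<bar>Z n \<omega>\<bar> > \<eta>}) \<longlonglongrightarrow> 0)"

definition lim_limsup_zero_in_prob :: "'o measure \<Rightarrow> (nat \<Rightarrow> nat \<Rightarrow> 'o \<Rightarrow> real) \<Rightarrow> bool" where
  "lim_limsup_zero_in_prob M A \<longleftrightarrow>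
     (\<forall>\<eta>>0. (\<lambda>m. limsup (\<lambda>n. ereal (measure M {\<omega> \<in> space M. \<bar>A m n \<omega>\<bar> > \<eta>}))) \<longlonglongrightarrow> 0)"

text \<open>A path \<open>x\<close> takes the arguments level, \<open>s\<close>, \<open>t\<close>, \<open>\<omega>\<close> and word. All sample paths are
  continuous; Chen's relation is only required almost surely for each \<open>s \<le> u \<le> t\<close>. For
  \<open>k = 1\<close> its right-hand side is the empty sum, so that it reads \<open>\<delta>x\<^sup>1 = 0\<close>.\<close>

definition rough_path ::
    "'o measure \<Rightarrow> real \<Rightarrow> real \<Rightarrow> nat
      \<Rightarrow> (nat \<Rightarrow> real \<Rightarrow> real \<Rightarrow> 'o \<Rightarrow> 'd::finite list \<Rightarrow> real) \<Rightarrow> bool" where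
  "rough_path M p \<nu> l x \<longleftrightarrow>
     1 < p \<and> int l \<le> \<lfloor>1 / \<nu>\<rfloor> \<and>
     (\<forall>s t. \<forall>\<omega>\<in>space M. x 0 s t \<omega> [] = 1) \<and>
     (\<forall>k\<in>{1..l}.
        (\<forall>w\<in>words k. \<forall>(s, t)\<in>simplex2. (\<lambda>\<omega>. x k s t \<omega> w) \<in> borel_measurable M) \<and>
        (\<forall>w\<in>words k. \<forall>\<omega>\<in>space M. continuous_on simplex2 (\<lambda>(s, t). x k s t \<omega> w)) \<and>
        (\<forall>(s, t)\<in>simplex2. s < t \<longrightarrow> in_Lp M p (\<lambda>\<omega>. tensor_norm k (x k s t \<omega>))) \<and>
        bdd_above ((\<lambda>(s, t). Lp_norm M p (\<lambda>\<omega>. tensor_norm k (x k s t \<omega>)) powr (1 / real k)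
                      / \<bar>t - s\<bar> powr \<nu>) ` {(s, t) \<in> simplex2. s < t}) \<and>
        (\<forall>s u t. 0 \<le> s \<and> s \<le> u \<and> u \<le> t \<and> t \<le> 1 \<longrightarrow>
          (AE \<omega> in M. \<forall>w\<in>words k.
             delta2 (\<lambda>a b. x k a b \<omega> w) s u t =
             (\<Sum>j=1..k-1. tensor_mult (k - j) (x (k - j) s u \<omega>) (x j u t \<omega>) w))))"

text \<open>For \<open>k = l - 1\<close> the sum is empty.\<close>

definition remainder ::
    "nat \<Rightarrow> (nat \<Rightarrow> real \<Rightarrow> real \<Rightarrow> 'o \<Rightarrow> 'd list \<Rightarrow> real)
      \<Rightarrow> (nat \<Rightarrow> real \<Rightarrow> 'o \<Rightarrow> 'd list \<Rightarrow> 'v::real_vector)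
      \<Rightarrow> nat \<Rightarrow> real \<Rightarrow> real \<Rightarrow> 'o \<Rightarrow> 'd list \<Rightarrow> 'v" where
  "remainder l x y k s t \<omega> = (\<lambda>w.
     delta1 (\<lambda>a. y k a \<omega> w) s t
     - (\<Sum>j=1..l-1-k. partial_apply j (y (k + j) s \<omega>) (x j s t \<omega>) w))"

definition continuous_processes ::
    "'o measure \<Rightarrow> nat \<Rightarrow> (nat \<Rightarrow> real \<Rightarrow> 'o \<Rightarrow> 'd list \<Rightarrow> 'v::euclidean_space) \<Rightarrow> bool" where
  "continuous_processes M l y \<longleftrightarrow>
     (\<forall>k<l. \<forall>w\<in>words k.
        (\<forall>t\<in>{0..1}. (\<lambda>\<omega>. y k t \<omega> w) \<in> borel_measurable M) \<and>
        (\<forall>\<omega>\<in>space M. continuous_on {0..1} (\<lambda>t. y k t \<omega> w)))"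

definition controlled_Lp ::
    "'o measure \<Rightarrow> real \<Rightarrow> real \<Rightarrow> nat
      \<Rightarrow> (nat \<Rightarrow> real \<Rightarrow> real \<Rightarrow> 'o \<Rightarrow> 'd::finite list \<Rightarrow> real)
      \<Rightarrow> (nat \<Rightarrow> real \<Rightarrow> 'o \<Rightarrow> 'd list \<Rightarrow> 'v::euclidean_space) \<Rightarrow> bool" where
  "controlled_Lp M p \<nu> l x y \<longleftrightarrow>
     continuous_processes M l y \<and> (AE \<omega> in M. y 0 0 \<omega> [] = 0) \<and>
     (\<exists>K. \<forall>(s, t)\<in>simplex2. \<forall>k<l.
        in_Lp M p (\<lambda>\<omega>. tensor_norm k (remainder l x y k s t \<omega>)) \<and>
        Lp_norm M p (\<lambda>\<omega>. tensor_norm k (remainder l x y k s t \<omega>))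
          \<le> K * (t - s) powr (real (l - k) * \<nu>))"

definition controlled_AE ::
    "'o measure \<Rightarrow> real \<Rightarrow> nat
      \<Rightarrow> (nat \<Rightarrow> real \<Rightarrow> real \<Rightarrow> 'o \<Rightarrow> 'd::finite list \<Rightarrow> real)
      \<Rightarrow> (nat \<Rightarrow> real \<Rightarrow> 'o \<Rightarrow> 'd list \<Rightarrow> 'v::euclidean_space) \<Rightarrow> bool" where
  "controlled_AE M \<nu> l x y \<longleftrightarrow>
     continuous_processes M l y \<and> (AE \<omega> in M. y 0 0 \<omega> [] = 0) \<and>
     (\<exists>G :: 'o \<Rightarrow> real. G \<in> borel_measurable M \<and>
        (AE \<omega> in M. \<forall>(s, t)\<in>simplex2. \<forall>k<l.
           tensor_norm k (remainder l x y k s t \<omega>) \<le> G \<omega> * (t - s) powr (real (l - k) * \<nu>)))"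

definition cells :: "nat \<Rightarrow> real \<Rightarrow> real \<Rightarrow> nat set" where
  "cells n s t = {k. k < n \<and> s \<le> gpt n k \<and> gpt n k < t}"

definition one_increment ::
    "'o measure \<Rightarrow> nat \<Rightarrow> (real \<Rightarrow> real \<Rightarrow> 'o \<Rightarrow> 'w::euclidean_space) \<Rightarrow> bool" where
  "one_increment M n h \<longleftrightarrow>
     (\<forall>s\<in>grid n. \<forall>t\<in>grid n. s \<le> t \<longrightarrow>
        h s t \<in> borel_measurable M \<and>
        (\<forall>\<omega>\<in>space M. h s t \<omega> = (\<Sum>k\<in>cells n s t. h (gpt n k) (gpt n (Suc k)) \<omega>)))"

text \<open>\<open>J_s^t(x^i; h)\<close>, an element of \<open>(R^d)^{\<otimes>i} \<otimes> V'\<close>.\<close>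

definition J_rough ::
    "nat \<Rightarrow> (real \<Rightarrow> real \<Rightarrow> 'o \<Rightarrow> 'd list \<Rightarrow> real)
      \<Rightarrow> (real \<Rightarrow> real \<Rightarrow> 'o \<Rightarrow> 'w::real_vector) \<Rightarrow> real \<Rightarrow> real \<Rightarrow> 'o \<Rightarrow> 'd list \<Rightarrow> 'w" where
  "J_rough n xi h s t \<omega> = (\<lambda>w. \<Sum>k\<in>cells n s t.
     xi (grid_eps n s) (gpt n k) \<omega> w *\<^sub>R h (gpt n k) (gpt n (Suc k)) \<omega>)"

text \<open>\<open>J_s^t(y; h)\<close>, an element of \<open>V \<otimes> V'\<close>.\<close>

definition J_weight ::
    "nat \<Rightarrow> (real \<Rightarrow> 'o \<Rightarrow> 'v::euclidean_space)
      \<Rightarrow> (real \<Rightarrow> real \<Rightarrow> 'o \<Rightarrow> 'w::euclidean_space) \<Rightarrow> real \<Rightarrow> real \<Rightarrow> 'o \<Rightarrow> 'v \<Rightarrow>\<^sub>L 'w" where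
  "J_weight n y h s t \<omega> = (\<Sum>k\<in>cells n s t.
     vtensor (y (gpt n k) \<omega>) (h (gpt n k) (gpt n (Suc k)) \<omega>))"

definition fine_partition :: "nat \<Rightarrow> (nat \<Rightarrow> real) \<Rightarrow> bool" where
  "fine_partition m S \<longleftrightarrow>
     0 \<le> S 0 \<and> S m \<le> 1 \<and>
     (\<forall>j<m. S j < S (Suc j) \<and> \<bar>S (Suc j) - S j\<bar> \<le> 1 / real m)"

end

theory Submission
  imports Defs
begin

text \<open>
  Cut \<open>[s, t]\<close> into \<open>m\<close> equal blocks and let \<open>n\<close> tend to infinity before \<open>m\<close>. On the block that
  starts at \<open>s_j\<close>, the controlled structure expands the weight as
  \<open>y_{t_k} = \<Sum>_i y^{(i)}_{s_j} x^i_{s_j t_k} + r^{(0)}_{s_j t_k}\<close>, so that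

    \<open>J_s^t(y; h^n) = \<Sum>_j \<Sum>_i y^{(i)}_{s_j} \<otimes> J_{s_j}^{s_{j+1}}(x^i; h^n) + \<Sum>_j J_{s_j}^{s_{j+1}}(r^{(0)}; h^n)\<close>.

  The last sum is negligible by a discrete sewing argument: the defect of additivity of the
  remainder integral is \<open>\<Sum>_i r^{(i)}_{su} \<otimes> J_u^t(x^i; h^n)\<close>, whose mean, on events
  of probability close to one, is of order \<open>(t - s)^{\<nu>l + \<alpha>}\<close> with an exponent larger than one
  (\<open>R_defect\<close>, \<open>midpoint_sewing\<close>, \<open>R_bound\<close>).

  For the main sum one needs the limit of each \<open>J_s^t(x^i; h^n)\<close> with \<open>i > \<tau>\<close>, and not only the
  smallness of its sums over partitions. Chen's relation re-bases \<open>x^i\<close> at the starting points of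
  the blocks and gives

    \<open>J_s^t(x^i; h^n) = \<Sum>_j \<Sum>_{q<i} x^{i-q}_{s s_j} \<otimes> J_{s_j}^{s_{j+1}}(x^q; h^n) + \<Sum>_j J_{s_j}^{s_{j+1}}(x^i; h^n)\<close>,

  where the last sum vanishes by hypothesis and the other integrals have a lower level. By induction
  on \<open>i\<close>, \<open>J_s^t(x^i; h^n)\<close> converges to \<open>(\<integral>_s^t x^{i-\<tau>}_{su} du) \<otimes> \<rho>\<close> (\<open>J_rough_limit\<close>).

  Both decompositions have the same shape: weights, times increments that converge to integrals
  of a kernel over the block, plus an error that is negligible when \<open>m \<ll> n\<close>. The lemma
  \<open>weighted_increments_limit\<close> says that such a sum converges to the integral of the weights
  against the kernels on the diagonal. There the kernels of level \<open>i > \<tau>\<close> are zero, because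
  \<open>x^{i-\<tau>}_{uu} = 0\<close>, and only the level \<open>\<tau>\<close> survives; for the weight \<open>y\<close> this is
  \<open>\<integral>_s^t y^{(\<tau>)}_u du \<otimes> \<rho>\<close>.

  Everything is done for scalar components of \<open>y\<close> and \<open>h^n\<close>, indexed by words.
\<close>

section \<open>Convergence in probability\<close>

context prob_space
begin

abbreviation vanishes :: "(nat \<Rightarrow> 'a \<Rightarrow> real) \<Rightarrow> bool" where
  "vanishes \<equiv> tendsto_zero_in_prob M"

lemma vanishes_measurable [measurable_dest]: "vanishes Z \<Longrightarrow> Z n \<in> borel_measurable M"
  by (simp add: tendsto_zero_in_prob_def)

lemma vanishesD: "vanishes Z \<Longrightarrow> 0 < \<eta> \<Longrightarrow> (\<lambda>n. prob {\<omega> \<in> space M. \<bar>Z n \<omega>\<bar> > \<eta>}) \<longlonglongrightarrow> 0"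
  by (simp add: tendsto_zero_in_prob_def)

lemma vanishesI_le:
  assumes [measurable]: "\<And>n. Z n \<in> borel_measurable M"
    and "\<And>\<eta>. 0 < \<eta> \<Longrightarrow> \<exists>b. b \<longlonglongrightarrow> 0 \<and> (\<forall>\<^sub>F n in sequentially. prob {\<omega> \<in> space M. \<bar>Z n \<omega>\<bar> > \<eta>} \<le> b n)"
  shows "vanishes Z"
  unfolding tendsto_zero_in_prob_def
proof (intro conjI allI impI)
  fix \<eta> :: real assume "0 < \<eta>"
  then obtain b where b: "b \<longlonglongrightarrow> 0"
    "\<forall>\<^sub>F n in sequentially. prob {\<omega> \<in> space M. \<bar>Z n \<omega>\<bar> > \<eta>} \<le> b n"
    using assms(2) by blast
  show "(\<lambda>n. prob {\<omega> \<in> space M. \<bar>Z n \<omega>\<bar> > \<eta>}) \<longlonglongrightarrow> 0"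
    by (rule tendsto_sandwich[OF _ b(2) tendsto_const b(1)]) simp
qed (use assms in auto)

lemma vanishes_dominated:
  assumes "vanishes Y" and [measurable]: "\<And>n. Z n \<in> borel_measurable M"
    and le: "\<forall>\<^sub>F n in sequentially. AE \<omega> in M. \<bar>Z n \<omega>\<bar> \<le> \<bar>Y n \<omega>\<bar>"
  shows "vanishes Z"
proof (rule vanishesI_le)
  fix \<eta> :: real assume "0 < \<eta>"
  note vanishes_measurable[OF assms(1), measurable]
  have "\<forall>\<^sub>F n in sequentially. prob {\<omega> \<in> space M. \<bar>Z n \<omega>\<bar> > \<eta>} \<le> prob {\<omega> \<in> space M. \<bar>Y n \<omega>\<bar> > \<eta>}"
    using le by eventually_elim (intro finite_measure_mono_AE, auto)
  then show "\<exists>b. b \<longlonglongrightarrow> 0 \<and> (\<forall>\<^sub>F n in sequentially. prob {\<omega> \<in> space M. \<bar>Z n \<omega>\<bar> > \<eta>} \<le> b n)"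
    using vanishesD[OF assms(1) \<open>0 < \<eta>\<close>] by blast
qed fact

lemma vanishes_cong:
  assumes "vanishes Y" "\<And>n. Z n \<in> borel_measurable M"
    "\<forall>\<^sub>F n in sequentially. AE \<omega> in M. Z n \<omega> = Y n \<omega>"
  shows "vanishes Z"
  using assms(3) by (intro vanishes_dominated[OF assms(1,2)]) (auto elim!: eventually_mono)

lemma prob_abs_add_gt:
  fixes X Y :: "'a \<Rightarrow> real"
  assumes [measurable]: "X \<in> borel_measurable M" "Y \<in> borel_measurable M"
  shows "prob {\<omega> \<in> space M. \<bar>X \<omega> + Y \<omega>\<bar> > \<eta>}
    \<le> prob {\<omega> \<in> space M. \<bar>X \<omega>\<bar> > \<eta> / 2} + prob {\<omega> \<in> space M. \<bar>Y \<omega>\<bar> > \<eta> / 2}"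
proof -
  have "prob {\<omega> \<in> space M. \<bar>X \<omega> + Y \<omega>\<bar> > \<eta>}
    \<le> prob ({\<omega> \<in> space M. \<bar>X \<omega>\<bar> > \<eta> / 2} \<union> {\<omega> \<in> space M. \<bar>Y \<omega>\<bar> > \<eta> / 2})"
  proof (rule finite_measure_mono)
    show "{\<omega> \<in> space M. \<bar>X \<omega> + Y \<omega>\<bar> > \<eta>} \<subseteq> {\<omega> \<in> space M. \<bar>X \<omega>\<bar> > \<eta> / 2} \<union> {\<omega> \<in> space M. \<bar>Y \<omega>\<bar> > \<eta> / 2}"
      by (auto simp: not_less)
  qed measurable
  also have "\<dots> \<le> prob {\<omega> \<in> space M. \<bar>X \<omega>\<bar> > \<eta> / 2} + prob {\<omega> \<in> space M. \<bar>Y \<omega>\<bar> > \<eta> / 2}"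
    by (rule measure_Un_le) auto
  finally show ?thesis .
qed

lemma vanishes_add:
  assumes "vanishes Y" "vanishes Z"
  shows "vanishes (\<lambda>n \<omega>. Y n \<omega> + Z n \<omega>)"
proof (rule vanishesI_le)
  note [measurable] = assms[THEN vanishes_measurable]
  show "(\<lambda>\<omega>. Y n \<omega> + Z n \<omega>) \<in> borel_measurable M" for n by measurable
  fix \<eta> :: real assume "0 < \<eta>"
  then have "0 < \<eta> / 2" by simp
  from tendsto_add[OF assms[THEN vanishesD, OF this]]
  have "(\<lambda>n. prob {\<omega> \<in> space M. \<bar>Y n \<omega>\<bar> > \<eta> / 2} + prob {\<omega> \<in> space M. \<bar>Z n \<omega>\<bar> > \<eta> / 2}) \<longlonglongrightarrow> 0"
    by simp
  moreover have "prob {\<omega> \<in> space M. \<bar>Y n \<omega> + Z n \<omega>\<bar> > \<eta>}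
      \<le> prob {\<omega> \<in> space M. \<bar>Y n \<omega>\<bar> > \<eta> / 2} + prob {\<omega> \<in> space M. \<bar>Z n \<omega>\<bar> > \<eta> / 2}" for n
    by (intro prob_abs_add_gt) measurable
  ultimately show "\<exists>b. b \<longlonglongrightarrow> 0 \<and>
      (\<forall>\<^sub>F n in sequentially. prob {\<omega> \<in> space M. \<bar>Y n \<omega> + Z n \<omega>\<bar> > \<eta>} \<le> b n)"
    by (intro exI conjI always_eventually allI)
qed

lemma vanishes_zero: "vanishes (\<lambda>n \<omega>. 0)"
  by (simp add: tendsto_zero_in_prob_def)

lemma vanishes_sum:
  assumes "\<And>i. i \<in> I \<Longrightarrow> vanishes (Z i)"
  shows "vanishes (\<lambda>n \<omega>. \<Sum>i\<in>I. Z i n \<omega>)"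
  using assms by (induction I rule: infinite_finite_induct) (auto simp: vanishes_zero vanishes_add)

lemma vanishes_mult:
  assumes "vanishes Y" "vanishes Z"
  shows "vanishes (\<lambda>n \<omega>. Y n \<omega> * Z n \<omega>)"
proof (rule vanishesI_le)
  note [measurable] = assms[THEN vanishes_measurable]
  show "(\<lambda>\<omega>. Y n \<omega> * Z n \<omega>) \<in> borel_measurable M" for n by measurable
  fix \<eta> :: real assume "0 < \<eta>"
  from tendsto_add[OF vanishesD[OF assms(1) this] vanishesD[OF assms(2) zero_less_one]]
  have "(\<lambda>n. prob {\<omega> \<in> space M. \<bar>Y n \<omega>\<bar> > \<eta>} + prob {\<omega> \<in> space M. \<bar>Z n \<omega>\<bar> > 1}) \<longlonglongrightarrow> 0"
    by simp
  moreover have "prob {\<omega> \<in> space M. \<bar>Y n \<omega> * Z n \<omega>\<bar> > \<eta>}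
      \<le> prob {\<omega> \<in> space M. \<bar>Y n \<omega>\<bar> > \<eta>} + prob {\<omega> \<in> space M. \<bar>Z n \<omega>\<bar> > 1}" for n
  proof -
    have *: "\<eta> < \<bar>a * b\<bar> \<Longrightarrow> \<eta> < \<bar>a\<bar> \<or> 1 < \<bar>b\<bar>" for a b :: real
      using mult_mono[of "\<bar>a\<bar>" \<eta> "\<bar>b\<bar>" 1] \<open>0 < \<eta>\<close> by (force simp: abs_mult not_less)
    have "prob {\<omega> \<in> space M. \<bar>Y n \<omega> * Z n \<omega>\<bar> > \<eta>}
      \<le> prob ({\<omega> \<in> space M. \<bar>Y n \<omega>\<bar> > \<eta>} \<union> {\<omega> \<in> space M. \<bar>Z n \<omega>\<bar> > 1})"
      using * by (intro finite_measure_mono) auto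
    also have "\<dots> \<le> prob {\<omega> \<in> space M. \<bar>Y n \<omega>\<bar> > \<eta>} + prob {\<omega> \<in> space M. \<bar>Z n \<omega>\<bar> > 1}"
      by (rule measure_Un_le) auto
    finally show ?thesis .
  qed
  ultimately show "\<exists>b. b \<longlonglongrightarrow> 0 \<and>
      (\<forall>\<^sub>F n in sequentially. prob {\<omega> \<in> space M. \<bar>Y n \<omega> * Z n \<omega>\<bar> > \<eta>} \<le> b n)"
    by (intro exI conjI always_eventually allI)
qed

lemma vanishes_AE_lim:
  assumes [measurable]: "\<And>n. Z n \<in> borel_measurable M"
    and lim: "AE \<omega> in M. (\<lambda>n. Z n \<omega>) \<longlonglongrightarrow> 0"
  shows "vanishes Z"
proof (rule vanishesI_le)
  fix \<eta> :: real assume "0 < \<eta>"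
  let ?A = "\<lambda>n. {\<omega> \<in> space M. \<bar>Z n \<omega>\<bar> > \<eta>}"
  have "(\<lambda>n. \<integral>\<omega>. indicator (?A n) \<omega> \<partial>M) \<longlonglongrightarrow> (\<integral>\<omega>. 0 \<partial>M :: real)"
  proof (rule integral_dominated_convergence[where w = "\<lambda>_. 1"])
    show "AE \<omega> in M. (\<lambda>n. indicator (?A n) \<omega> :: real) \<longlonglongrightarrow> 0"
      using lim
    proof eventually_elim
      fix \<omega> assume "(\<lambda>n. Z n \<omega>) \<longlonglongrightarrow> 0"
      then have "\<forall>\<^sub>F n in sequentially. \<bar>Z n \<omega>\<bar> < \<eta>"
        using \<open>0 < \<eta>\<close> by (simp add: tendsto_iff dist_norm)
      then have "\<forall>\<^sub>F n in sequentially. indicator (?A n) \<omega> = (0 :: real)"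
        by eventually_elim (auto simp: indicator_def)
      then show "(\<lambda>n. indicator (?A n) \<omega> :: real) \<longlonglongrightarrow> 0"
        by (rule tendsto_eventually)
    qed
  qed (auto simp: indicator_def)
  then show "\<exists>b. b \<longlonglongrightarrow> 0 \<and> (\<forall>\<^sub>F n in sequentially. prob (?A n) \<le> b n)"
    by (intro exI[of _ "\<lambda>n. prob (?A n)"]) (simp add: Int_absorb2 subset_eq)
qed fact

text \<open>Random weights and the constant of almost sure control may fail to have moments; tightness of a
  single random variable is what bounds them.\<close>

lemma random_variable_tight:
  fixes Y :: "'a \<Rightarrow> real"
  assumes [measurable]: "Y \<in> borel_measurable M" and "0 < e"
  obtains B where "0 < B" "prob {\<omega> \<in> space M. \<bar>Y \<omega>\<bar> > B} < e"
proof -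
  have "vanishes (\<lambda>N \<omega>. Y \<omega> / real (Suc N))"
  proof (rule vanishes_AE_lim)
    show "AE \<omega> in M. (\<lambda>N. Y \<omega> / real (Suc N)) \<longlonglongrightarrow> 0"
      using LIMSEQ_Suc[OF lim_const_over_n] by auto
  qed measurable
  from vanishesD[OF this zero_less_one]
  have "(\<lambda>N. prob {\<omega> \<in> space M. \<bar>Y \<omega> / real (Suc N)\<bar> > 1}) \<longlonglongrightarrow> 0" .
  from LIMSEQ_D[OF this \<open>0 < e\<close>] obtain N where
    "prob {\<omega> \<in> space M. \<bar>Y \<omega> / real (Suc N)\<bar> > 1} < e" by force
  then show thesis
    by (intro that[of "real (Suc N)"]) (simp_all add: less_divide_eq)
qed

lemma vanishes_mult_left:
  assumes [measurable]: "Y \<in> borel_measurable M" and "vanishes Z"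
  shows "vanishes (\<lambda>n \<omega>. Y \<omega> * Z n \<omega>)"
proof (rule vanishesI_le)
  note [measurable] = assms(2)[THEN vanishes_measurable]
  show "(\<lambda>\<omega>. Y \<omega> * Z n \<omega>) \<in> borel_measurable M" for n by measurable
  fix \<eta> :: real assume "0 < \<eta>"
  let ?P = "\<lambda>n. prob {\<omega> \<in> space M. \<bar>Y \<omega> * Z n \<omega>\<bar> > \<eta>}"
  have "?P \<longlonglongrightarrow> 0"
  proof (rule LIMSEQ_I)
    fix e :: real assume "0 < e"
    from random_variable_tight[OF assms(1) half_gt_zero[OF this]] obtain B where
      B: "0 < B" "prob {\<omega> \<in> space M. \<bar>Y \<omega>\<bar> > B} < e / 2" .
    have "0 < \<eta> / B" using \<open>0 < \<eta>\<close> B by simp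
    from LIMSEQ_D[OF vanishesD[OF assms(2) this] half_gt_zero[OF \<open>0 < e\<close>]] obtain n0 where
      n0: "\<And>n. n \<ge> n0 \<Longrightarrow> prob {\<omega> \<in> space M. \<bar>Z n \<omega>\<bar> > \<eta> / B} < e / 2" by force
    have "norm (?P n - 0) < e" if "n \<ge> n0" for n
    proof -
      have *: "B < \<bar>a\<bar> \<or> \<eta> / B < \<bar>b\<bar>" if "\<eta> < \<bar>a * b\<bar>" for a b
      proof (rule ccontr)
        assume "\<not> ?thesis"
        then have "\<bar>a\<bar> * \<bar>b\<bar> \<le> B * (\<eta> / B)"
          using B by (intro mult_mono) auto
        then show False using that B by (simp add: abs_mult)
      qed
      have "?P n \<le> prob ({\<omega> \<in> space M. \<bar>Y \<omega>\<bar> > B} \<union> {\<omega> \<in> space M. \<bar>Z n \<omega>\<bar> > \<eta> / B})"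
        using * by (intro finite_measure_mono) auto
      also have "\<dots> \<le> prob {\<omega> \<in> space M. \<bar>Y \<omega>\<bar> > B} + prob {\<omega> \<in> space M. \<bar>Z n \<omega>\<bar> > \<eta> / B}"
        by (rule measure_Un_le) auto
      also have "\<dots> < e" using B n0[OF that] by linarith
      finally show ?thesis by simp
    qed
    then show "\<exists>n0. \<forall>n\<ge>n0. norm (?P n - 0) < e" by blast
  qed
  then show "\<exists>b. b \<longlonglongrightarrow> 0 \<and> (\<forall>\<^sub>F n in sequentially. ?P n \<le> b n)"
    by (intro exI[of _ ?P]) simp
qed

lemma vanishes_product:
  assumes [measurable]: "Y \<in> borel_measurable M" "Z \<in> borel_measurable M"
    and Y: "vanishes (\<lambda>n \<omega>. Yn n \<omega> - Y \<omega>)" and Z: "vanishes (\<lambda>n \<omega>. Zn n \<omega> - Z \<omega>)"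
  shows "vanishes (\<lambda>n \<omega>. Yn n \<omega> * Zn n \<omega> - Y \<omega> * Z \<omega>)"
proof -
  have "vanishes (\<lambda>n \<omega>. (Yn n \<omega> - Y \<omega>) * (Zn n \<omega> - Z \<omega>)
      + (Y \<omega> * (Zn n \<omega> - Z \<omega>) + Z \<omega> * (Yn n \<omega> - Y \<omega>)))"
    by (intro vanishes_add vanishes_mult vanishes_mult_left Y Z) fact+
  moreover have "(Yn n \<omega> - Y \<omega>) * (Zn n \<omega> - Z \<omega>)
      + (Y \<omega> * (Zn n \<omega> - Z \<omega>) + Z \<omega> * (Yn n \<omega> - Y \<omega>)) = Yn n \<omega> * Zn n \<omega> - Y \<omega> * Z \<omega>" for n \<omega>
    by (simp add: algebra_simps)
  ultimately show ?thesis by simp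
qed

lemma vanishes_abs: "vanishes Z \<Longrightarrow> vanishes (\<lambda>n \<omega>. \<bar>Z n \<omega>\<bar>)"
  by (rule vanishes_dominated) (auto intro: borel_measurable_abs vanishes_measurable)

text \<open>The order of limits \<open>m \<ll> n\<close>: the threshold for \<open>n\<close> may depend on \<open>m\<close>.\<close>

definition vanishes_iterated :: "(nat \<Rightarrow> nat \<Rightarrow> 'a \<Rightarrow> real) \<Rightarrow> bool" where
  "vanishes_iterated E \<longleftrightarrow> (\<forall>\<eta>>0. \<forall>e>0. \<forall>\<^sub>F m in sequentially. \<forall>\<^sub>F n in sequentially.
     prob {\<omega> \<in> space M. \<bar>E m n \<omega>\<bar> > \<eta>} < e)"

lemma vanishes_iterated_lim_limsup:
  assumes "lim_limsup_zero_in_prob M E"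
  shows "vanishes_iterated E"
  unfolding vanishes_iterated_def
proof (intro allI impI)
  fix \<eta> e :: real assume "0 < \<eta>" "0 < e"
  then have "\<forall>\<^sub>F m in sequentially.
      limsup (\<lambda>n. ereal (prob {\<omega> \<in> space M. \<bar>E m n \<omega>\<bar> > \<eta>})) < ereal e"
    using assms order_tendstoD(2)[of _ "0::ereal" sequentially "ereal e"]
    unfolding lim_limsup_zero_in_prob_def by fastforce
  then show "\<forall>\<^sub>F m in sequentially. \<forall>\<^sub>F n in sequentially. prob {\<omega> \<in> space M. \<bar>E m n \<omega>\<bar> > \<eta>} < e"
  proof eventually_elim
    case (elim m)
    from Limsup_lessD[OF this] show ?case by simp
  qed
qed

lemma vanishes_iterated_dominated:
  assumes F: "vanishes_iterated F"
    and meas: "\<forall>\<^sub>F m in sequentially. \<forall>\<^sub>F n in sequentially. F m n \<in> borel_measurable M"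
    and le: "\<And>m n \<omega>. \<bar>E m n \<omega>\<bar> \<le> \<bar>F m n \<omega>\<bar>"
  shows "vanishes_iterated E"
  unfolding vanishes_iterated_def
proof (intro allI impI)
  fix \<eta> e :: real assume "0 < \<eta>" "0 < e"
  with F have "\<forall>\<^sub>F m in sequentially. \<forall>\<^sub>F n in sequentially.
      prob {\<omega> \<in> space M. \<bar>F m n \<omega>\<bar> > \<eta>} < e"
    unfolding vanishes_iterated_def by blast
  with meas show "\<forall>\<^sub>F m in sequentially. \<forall>\<^sub>F n in sequentially.
      prob {\<omega> \<in> space M. \<bar>E m n \<omega>\<bar> > \<eta>} < e"
  proof eventually_elim
    case (elim m)
    then show ?case
    proof eventually_elim
      case (elim n)
      note [measurable] = elim(1)
      have "prob {\<omega> \<in> space M. \<bar>E m n \<omega>\<bar> > \<eta>} \<le> prob {\<omega> \<in> space M. \<bar>F m n \<omega>\<bar> > \<eta>}"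
        using le by (intro finite_measure_mono) (auto intro: less_le_trans)
      with elim(2) show ?case by linarith
    qed
  qed
qed

text \<open>At fixed \<open>m\<close> the main term settles as \<open>n\<close> grows (\<open>A\<close>), its limit settles as \<open>m\<close> grows
  (\<open>B\<close>), and the rest is small only in the iterated sense (\<open>E\<close>). One large \<open>m\<close> is fixed first, and then \<open>n\<close> is sent to infinity.\<close>

lemma vanishes_by_approximation:
  assumes A: "\<And>m. m > 0 \<Longrightarrow> vanishes (A m)" and E: "vanishes_iterated E" and B: "vanishes B"
    and [measurable]: "\<And>n. Z n \<in> borel_measurable M" "\<And>m n. E m n \<in> borel_measurable M"
    and eq: "\<And>m. m > 0 \<Longrightarrow> \<forall>\<^sub>F n in sequentially. AE \<omega> in M. Z n \<omega> = A m n \<omega> + (E m n \<omega> + B m \<omega>)"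
  shows "vanishes Z"
  unfolding tendsto_zero_in_prob_def
proof (intro conjI allI impI LIMSEQ_I)
  fix \<eta> e :: real assume "0 < \<eta>" "0 < e"
  define p where "p X \<eta> = prob {\<omega> \<in> space M. \<bar>X \<omega>\<bar> > \<eta>}" for X :: "'a \<Rightarrow> real" and \<eta>
  note [measurable] = B[THEN vanishes_measurable]
  have "\<forall>\<^sub>F m in sequentially. p (B m) (\<eta> / 4) < e / 3"
    using vanishesD[OF B, of "\<eta> / 4"] \<open>0 < \<eta>\<close> \<open>0 < e\<close> unfolding p_def by (intro order_tendstoD) auto
  moreover have "\<forall>\<^sub>F m in sequentially. \<forall>\<^sub>F n in sequentially. p (E m n) (\<eta> / 4) < e / 3"
    using E[unfolded vanishes_iterated_def, rule_format, of "\<eta> / 4" "e / 3"] \<open>0 < \<eta>\<close> \<open>0 < e\<close>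
    by (simp add: p_def)
  ultimately have "\<forall>\<^sub>F m in sequentially. m > 0 \<and> p (B m) (\<eta> / 4) < e / 3
      \<and> (\<forall>\<^sub>F n in sequentially. p (E m n) (\<eta> / 4) < e / 3)"
    using eventually_gt_at_top[of 0] by eventually_elim simp
  from eventually_happens'[OF sequentially_bot this] obtain m where m: "m > 0" "p (B m) (\<eta> / 4) < e / 3"
      "\<forall>\<^sub>F n in sequentially. p (E m n) (\<eta> / 4) < e / 3"
    by blast
  note [measurable] = A[OF m(1), THEN vanishes_measurable]
  have "\<forall>\<^sub>F n in sequentially. p (A m n) (\<eta> / 2) < e / 3"
    using vanishesD[OF A[OF m(1)], of "\<eta> / 2"] \<open>0 < \<eta>\<close> \<open>0 < e\<close> unfolding p_def
    by (intro order_tendstoD) auto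
  then have "\<forall>\<^sub>F n in sequentially. p (Z n) \<eta> < e"
    using m(3) eq[OF m(1)]
  proof eventually_elim
    case (elim n)
    have "p (Z n) \<eta> = p (\<lambda>\<omega>. A m n \<omega> + (E m n \<omega> + B m \<omega>)) \<eta>"
      unfolding p_def using elim(3) by (intro measure_eq_AE) auto
    also have "\<dots> \<le> p (A m n) (\<eta> / 2) + p (\<lambda>\<omega>. E m n \<omega> + B m \<omega>) (\<eta> / 2)"
      unfolding p_def by (intro prob_abs_add_gt) measurable
    also have "p (\<lambda>\<omega>. E m n \<omega> + B m \<omega>) (\<eta> / 2) \<le> p (E m n) (\<eta> / 2 / 2) + p (B m) (\<eta> / 2 / 2)"
      unfolding p_def by (intro prob_abs_add_gt) measurable
    finally show ?case using elim m(2) by simp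
  qed
  then show "\<exists>n0. \<forall>n\<ge>n0. norm (prob {\<omega> \<in> space M. \<bar>Z n \<omega>\<bar> > \<eta>} - 0) < e"
    unfolding p_def eventually_sequentially by simp
qed fact

end

section \<open>Sums along uniform partitions\<close>

definition uniform_node :: "real \<Rightarrow> real \<Rightarrow> nat \<Rightarrow> nat \<Rightarrow> real" where
  "uniform_node a b m j = a + (b - a) * real j / real m"

lemma uniform_node_0 [simp]: "uniform_node a b m 0 = a"
  by (simp add: uniform_node_def)

lemma uniform_node_last [simp]: "0 < m \<Longrightarrow> uniform_node a b m m = b"
  by (simp add: uniform_node_def)

lemma uniform_node_diff: "0 < m \<Longrightarrow> uniform_node a b m (Suc j) - uniform_node a b m j = (b - a) / real m"
  by (simp add: uniform_node_def field_simps)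

lemma uniform_node_less: "a < b \<Longrightarrow> 0 < m \<Longrightarrow> uniform_node a b m j < uniform_node a b m (Suc j)"
  using uniform_node_diff[of m a b j] divide_pos_pos[of "b - a" "real m"] by linarith

lemma uniform_node_mono: "a \<le> b \<Longrightarrow> i \<le> j \<Longrightarrow> uniform_node a b m i \<le> uniform_node a b m j"
  unfolding uniform_node_def by (intro add_left_mono divide_right_mono mult_left_mono) auto

lemma uniform_node_bounds:
  assumes "a \<le> b" "0 < m" "j \<le> m"
  shows "a \<le> uniform_node a b m j" "uniform_node a b m j \<le> b"
  using uniform_node_mono[OF assms(1), of 0 j m] uniform_node_mono[OF assms(1,3), of m] assms by simp_all

lemma fine_partition_uniform_node:
  assumes "0 \<le> a" "a < b" "b \<le> 1" "1 \<le> m"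
  shows "fine_partition m (uniform_node a b m)"
  using assms uniform_node_less[of a b m] uniform_node_diff[of m a b]
  by (auto simp: fine_partition_def divide_right_mono)

lemma sum_consecutive_blocks:
  fixes f :: "nat \<Rightarrow> 'a::comm_monoid_add"
  assumes "\<And>j. j < m \<Longrightarrow> p j \<le> p (Suc j)"
  shows "(\<Sum>j<m. \<Sum>k\<in>{p j..<p (Suc j)}. f k) = (\<Sum>k\<in>{p 0..<p m}. f k)"
  using assms
proof (induction m)
  case (Suc m)
  have "p 0 \<le> p m"
    using Suc.prems by (induction m) (auto intro: order_trans)
  then show ?case
    using Suc by (simp add: sum.atLeastLessThan_concat)
qed simp

lemma integral_consecutive:
  fixes f :: "real \<Rightarrow> real"
  assumes "continuous_on {S 0..S m} f" and mono: "\<And>i j. i \<le> j \<Longrightarrow> j \<le> m \<Longrightarrow> S i \<le> S j"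
  shows "(\<Sum>j<m. integral {S j..S (Suc j)} f) = integral {S 0..S m} f"
  using assms
proof (induction m)
  case (Suc m)
  have "continuous_on {S 0..S m} f"
    by (rule continuous_on_subset[OF Suc.prems(1)]) (simp add: Suc.prems(2))
  then show ?case
    using Suc by (simp add: Henstock_Kurzweil_Integration.integral_combine
        integrable_continuous_interval)
qed simp

text \<open>A block of length \<open>(b - a) / m\<close> lies within distance \<open>(b - a) / m\<close> of the diagonal, so uniform
  continuity on the compact triangle allows the fixed left endpoint to be replaced by the
  integration variable.\<close>

lemma diagonal_riemann_sums:
  fixes f :: "real \<Rightarrow> real \<Rightarrow> real"
  assumes ab: "a < b"
    and cont: "continuous_on {(s, u). a \<le> s \<and> s \<le> u \<and> u \<le> b} (\<lambda>(s, u). f s u)"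
  shows "(\<lambda>m. \<Sum>j<m. integral {uniform_node a b m j..uniform_node a b m (Suc j)} (f (uniform_node a b m j)))
    \<longlonglongrightarrow> integral {a..b} (\<lambda>u. f u u)"
proof (rule LIMSEQ_I)
  let ?T = "{(s, u). a \<le> s \<and> s \<le> u \<and> u \<le> b}"
  fix e :: real assume "0 < e"
  have "closed {p :: real \<times> real. a \<le> fst p \<and> fst p \<le> snd p \<and> snd p \<le> b}"
    by (intro closed_Collect_conj closed_Collect_le continuous_intros)
  moreover have "?T = {p. a \<le> fst p \<and> fst p \<le> snd p \<and> snd p \<le> b}" by auto
  ultimately have "closed ?T" by simp
  then have "compact (({a..b} \<times> {a..b}) \<inter> ?T)"
    by (intro compact_Int_closed compact_Times compact_Icc)
  moreover have "({a..b} \<times> {a..b}) \<inter> ?T = ?T" by auto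
  ultimately have "compact ?T" by simp
  from compact_uniformly_continuous[OF cont this]
  have unifc: "uniformly_continuous_on ?T (\<lambda>(s, u). f s u)" .
  define e' where "e' = e / (2 * (b - a))"
  have "0 < e'" using \<open>0 < e\<close> ab by (simp add: e'_def)
  with unifc obtain d where "0 < d" and d: "\<And>p q. p \<in> ?T \<Longrightarrow> q \<in> ?T \<Longrightarrow> dist q p < d \<Longrightarrow>
      dist (case q of (s, u) \<Rightarrow> f s u) (case p of (s, u) \<Rightarrow> f s u) < e'"
    using uniformly_continuous_on_def[of ?T "\<lambda>(s, u). f s u"] by blast
  obtain m0 where m0: "(b - a) / d < real m0" using reals_Archimedean2 by blast
  have "norm ((\<Sum>j<m. integral {uniform_node a b m j..uniform_node a b m (Suc j)} (f (uniform_node a b m j)))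
      - integral {a..b} (\<lambda>u. f u u)) < e" if "m \<ge> Suc m0" for m
  proof -
    have m: "0 < m" using that by simp
    let ?S = "uniform_node a b m"
    have contg: "continuous_on {a..b} (\<lambda>u. f u u)"
      by (rule continuous_on_compose2[OF cont, of _ "\<lambda>u. (u, u)", simplified])
        (auto intro!: continuous_intros)
    have "(b - a) / real m < d"
    proof -
      have "(b - a) / d < real m" using m0 that by linarith
      then show ?thesis using \<open>0 < d\<close> m by (simp add: field_simps)
    qed
    have block: "norm (integral {?S j..?S (Suc j)} (f (?S j)) - integral {?S j..?S (Suc j)} (\<lambda>u. f u u))
        \<le> e' * ((b - a) / real m)" if "j < m" for j
    proof -
      note B = uniform_node_bounds[of a b m] uniform_node_less[OF ab m, of j]
      have le: "a \<le> ?S j" "?S j \<le> ?S (Suc j)" "?S (Suc j) \<le> b"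
        using B(1)[of j] B(2)[of "Suc j"] B(3) ab m that by auto
      have c1: "continuous_on {?S j..?S (Suc j)} (f (?S j))"
        by (rule continuous_on_compose2[OF cont, of _ "\<lambda>u. (?S j, u)", simplified])
          (use le in \<open>auto intro!: continuous_intros\<close>)
      have c2: "continuous_on {?S j..?S (Suc j)} (\<lambda>u. f u u)"
        by (rule continuous_on_subset[OF contg]) (use le in auto)
      have "norm (integral {?S j..?S (Suc j)} (\<lambda>u. f (?S j) u - f u u)) \<le> e' * (?S (Suc j) - ?S j)"
      proof (rule integral_bound[OF le(2)])
        show "continuous_on {?S j..?S (Suc j)} (\<lambda>u. f (?S j) u - f u u)"
          by (intro continuous_on_diff c1 c2)
        fix u assume "u \<in> {?S j..?S (Suc j)}"
        then have "dist (?S j, u) (u, u) < d"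
          using uniform_node_diff[OF m, of a b j] \<open>(b - a) / real m < d\<close>
          by (simp add: dist_Pair_Pair dist_real_def)
        from d[OF _ _ this] show "norm (f (?S j) u - f u u) \<le> e'"
          using le \<open>u \<in> _\<close> by (auto simp: dist_real_def)
      qed
      then show ?thesis
        using uniform_node_diff[OF m, of a b j] c1 c2
        by (subst integral_diff[symmetric]) (auto intro: integrable_continuous_interval)
    qed
    have "integral {a..b} (\<lambda>u. f u u) = (\<Sum>j<m. integral {?S j..?S (Suc j)} (\<lambda>u. f u u))"
      using integral_consecutive[of ?S m "\<lambda>u. f u u"] contg m ab by (simp add: uniform_node_mono)
    then have "norm ((\<Sum>j<m. integral {?S j..?S (Suc j)} (f (?S j))) - integral {a..b} (\<lambda>u. f u u))
        = norm (\<Sum>j<m. integral {?S j..?S (Suc j)} (f (?S j)) - integral {?S j..?S (Suc j)} (\<lambda>u. f u u))"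
      by (simp add: sum_subtractf)
    also have "\<dots> \<le> (\<Sum>j<m. e' * ((b - a) / real m))"
      by (intro sum_norm_le) (use block in auto)
    also have "\<dots> = e / 2" using m ab by (simp add: e'_def divide_simps)
    also have "\<dots> < e" using \<open>0 < e\<close> by simp
    finally show ?thesis .
  qed
  then show "\<exists>m0. \<forall>m\<ge>m0. norm ((\<Sum>j<m. integral {uniform_node a b m j..uniform_node a b m (Suc j)} (f (uniform_node a b m j)))
      - integral {a..b} (\<lambda>u. f u u)) < e" by blast
qed

lemma borel_measurable_integral_continuous:
  fixes f :: "real \<Rightarrow> 'a \<Rightarrow> real"
  assumes meas: "\<And>u. u \<in> {a..b} \<Longrightarrow> f u \<in> borel_measurable M"
    and cont: "\<And>\<omega>. \<omega> \<in> space M \<Longrightarrow> continuous_on {a..b} (\<lambda>u. f u \<omega>)"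
  shows "(\<lambda>\<omega>. integral {a..b} (\<lambda>u. f u \<omega>)) \<in> borel_measurable M"
proof (cases "a < b")
  case True
  show ?thesis
  proof (rule borel_measurable_LIMSEQ_real)
    fix \<omega> assume "\<omega> \<in> space M"
    have "continuous_on {(s, u). a \<le> s \<and> s \<le> u \<and> u \<le> b} (\<lambda>(s, u). f s \<omega>)"
      unfolding case_prod_beta
      by (rule continuous_on_compose2[OF cont[OF \<open>\<omega> \<in> space M\<close>]]) (auto intro!: continuous_intros)
    \<comment> \<open>An integrand that depends on the left endpoint alone gives ordinary Riemann sums.\<close>
    from diagonal_riemann_sums[OF True this]
    show "(\<lambda>m. \<Sum>j<m. integral {uniform_node a b m j..uniform_node a b m (Suc j)} (\<lambda>_. f (uniform_node a b m j) \<omega>))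
        \<longlonglongrightarrow> integral {a..b} (\<lambda>u. f u \<omega>)" .
  next
    fix m
    have "f (uniform_node a b m j) \<in> borel_measurable M" if "j < m" for j
      using that True uniform_node_bounds[of a b m j] by (intro meas) auto
    then show "(\<lambda>\<omega>. \<Sum>j<m. integral {uniform_node a b m j..uniform_node a b m (Suc j)} (\<lambda>_. f (uniform_node a b m j) \<omega>))
        \<in> borel_measurable M"
      using uniform_node_mono[of a b _ _ m] by simp
  qed
next
  case False
  then have "integral {a..b} g = 0" for g :: "real \<Rightarrow> real"
    by (cases "a = b") auto
  then show ?thesis by simp
qed

context prob_space
begin

text \<open>The common core of the limits for \<open>J(x^i; h^n)\<close> and for \<open>J(y; h^n)\<close>. The weights \<open>c n i\<close>
  converge pointwise to \<open>g i\<close>; the increments \<open>\<Psi> n i s t\<close> converge to integrals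
  of \<open>\<kappa> i s\<close>, a kernel that may depend on the starting point \<open>s\<close>. At fixed \<open>m\<close> the double sum is a
  finite sum of products of convergent factors. As the partition is refined, the starting point of
  each block merges with the integration variable, which leaves the kernels on the diagonal.\<close>

lemma weighted_increments_limit:
  fixes g :: "'i \<Rightarrow> real \<Rightarrow> 'a \<Rightarrow> real"
    and \<kappa> :: "'i \<Rightarrow> real \<Rightarrow> real \<Rightarrow> 'a \<Rightarrow> real"
    and \<Psi> :: "nat \<Rightarrow> 'i \<Rightarrow> real \<Rightarrow> real \<Rightarrow> 'a \<Rightarrow> real"
  assumes ab: "a < b"
    and g_meas: "\<And>i s. i \<in> I \<Longrightarrow> s \<in> {a..b} \<Longrightarrow> g i s \<in> borel_measurable M"
    and g_cont: "\<And>i \<omega>. i \<in> I \<Longrightarrow> \<omega> \<in> space M \<Longrightarrow> continuous_on {a..b} (\<lambda>s. g i s \<omega>)"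
    and c_meas: "\<And>n i s. i \<in> I \<Longrightarrow> s \<in> {a..b} \<Longrightarrow> c n i s \<in> borel_measurable M"
    and c_lim: "\<And>i s \<omega>. i \<in> I \<Longrightarrow> s \<in> {a..b} \<Longrightarrow> \<omega> \<in> space M \<Longrightarrow> (\<lambda>n. c n i s \<omega>) \<longlonglongrightarrow> g i s \<omega>"
    and \<kappa>_meas: "\<And>i s u. i \<in> I \<Longrightarrow> a \<le> s \<Longrightarrow> s \<le> u \<Longrightarrow> u \<le> b \<Longrightarrow> \<kappa> i s u \<in> borel_measurable M"
    and \<kappa>_cont: "\<And>i \<omega>. i \<in> I \<Longrightarrow> \<omega> \<in> space M \<Longrightarrow>
      continuous_on {(s, u). a \<le> s \<and> s \<le> u \<and> u \<le> b} (\<lambda>(s, u). \<kappa> i s u \<omega>)"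
    and \<Psi>: "\<And>i s t. i \<in> I \<Longrightarrow> a \<le> s \<Longrightarrow> s < t \<Longrightarrow> t \<le> b \<Longrightarrow>
      vanishes (\<lambda>n \<omega>. \<Psi> n i s t \<omega> - integral {s..t} (\<lambda>u. \<kappa> i s u \<omega>))"
    and Z_meas: "\<And>n. Z n \<in> borel_measurable M"
    and E_meas: "\<And>m n. E m n \<in> borel_measurable M"
    and E: "vanishes_iterated E"
    and Z: "\<And>m. m > 0 \<Longrightarrow> \<forall>\<^sub>F n in sequentially. AE \<omega> in M. Z n \<omega> = (\<Sum>j<m. \<Sum>i\<in>I.
      c n i (uniform_node a b m j) \<omega> * \<Psi> n i (uniform_node a b m j) (uniform_node a b m (Suc j)) \<omega>) + E m n \<omega>"
  shows "vanishes (\<lambda>n \<omega>. Z n \<omega> - integral {a..b} (\<lambda>u. \<Sum>i\<in>I. g i u \<omega> * \<kappa> i u u \<omega>))"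
proof (rule vanishes_by_approximation[OF _ E _ _ E_meas])
  let ?L = "\<lambda>\<omega>. integral {a..b} (\<lambda>u. \<Sum>i\<in>I. g i u \<omega> * \<kappa> i u u \<omega>)"
  let ?J = "\<lambda>i s t \<omega>. integral {s..t} (\<lambda>u. \<kappa> i s u \<omega>)"
  define B where "B m \<omega> = (\<Sum>j<m. \<Sum>i\<in>I. g i (uniform_node a b m j) \<omega> *
      ?J i (uniform_node a b m j) (uniform_node a b m (Suc j)) \<omega>) - ?L \<omega>" for m \<omega>
  define A where "A m n \<omega> = (\<Sum>j<m. \<Sum>i\<in>I.
      c n i (uniform_node a b m j) \<omega> * \<Psi> n i (uniform_node a b m j) (uniform_node a b m (Suc j)) \<omega>
      - g i (uniform_node a b m j) \<omega> * ?J i (uniform_node a b m j) (uniform_node a b m (Suc j)) \<omega>)" for m n \<omega>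
  have diag: "continuous_on {a..b} (\<lambda>u. \<kappa> i u u \<omega>)" if "i \<in> I" "\<omega> \<in> space M" for i \<omega>
    by (rule continuous_on_compose2[OF \<kappa>_cont[OF that], of _ "\<lambda>u. (u, u)", simplified])
      (auto intro!: continuous_intros)
  have slice: "continuous_on {s..t} (\<lambda>u. \<kappa> i s u \<omega>)"
    if "i \<in> I" "\<omega> \<in> space M" "a \<le> s" "t \<le> b" for i \<omega> s t
    by (rule continuous_on_compose2[OF \<kappa>_cont[OF that(1,2)], of _ "\<lambda>u. (s, u)", simplified])
      (use that in \<open>auto intro!: continuous_intros\<close>)
  have L_meas: "?L \<in> borel_measurable M"
    by (intro borel_measurable_integral_continuous borel_measurable_sum borel_measurable_times
        continuous_on_sum continuous_on_mult g_meas g_cont diag \<kappa>_meas) auto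
  have J_meas: "?J i s t \<in> borel_measurable M" if "i \<in> I" "a \<le> s" "t \<le> b" for i s t
    by (intro borel_measurable_integral_continuous \<kappa>_meas slice) (use that in auto)
  have bounds: "a \<le> uniform_node a b m j" "uniform_node a b m j < uniform_node a b m (Suc j)" "uniform_node a b m (Suc j) \<le> b"
      "uniform_node a b m j \<le> b" if "j < m" for m j
    using that ab uniform_node_bounds[of a b m j] uniform_node_bounds[of a b m "Suc j"] uniform_node_less[of a b m j] by auto
  show "(\<lambda>\<omega>. Z n \<omega> - ?L \<omega>) \<in> borel_measurable M" for n
    using Z_meas L_meas by measurable
  show "vanishes (A m)" if "m > 0" for m
    unfolding A_def
  proof (intro vanishes_sum vanishes_product)
    fix i j assume ij: "i \<in> I" "j \<in> {..<m}"
    note b = bounds[of j m]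
    show "g i (uniform_node a b m j) \<in> borel_measurable M"
      using ij b by (intro g_meas) auto
    show "?J i (uniform_node a b m j) (uniform_node a b m (Suc j)) \<in> borel_measurable M"
      using ij b by (intro J_meas) auto
    show "vanishes (\<lambda>n \<omega>. \<Psi> n i (uniform_node a b m j) (uniform_node a b m (Suc j)) \<omega>
        - ?J i (uniform_node a b m j) (uniform_node a b m (Suc j)) \<omega>)"
      using ij b by (intro \<Psi>) auto
    show "vanishes (\<lambda>n \<omega>. c n i (uniform_node a b m j) \<omega> - g i (uniform_node a b m j) \<omega>)"
    proof (rule vanishes_AE_lim)
      show "(\<lambda>\<omega>. c n i (uniform_node a b m j) \<omega> - g i (uniform_node a b m j) \<omega>) \<in> borel_measurable M" for n
        using ij b by (intro borel_measurable_diff c_meas g_meas) auto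
      show "AE \<omega> in M. (\<lambda>n. c n i (uniform_node a b m j) \<omega> - g i (uniform_node a b m j) \<omega>) \<longlonglongrightarrow> 0"
        using ij b by (intro AE_I2 tendsto_diff[OF c_lim tendsto_const, THEN tendsto_eq_rhs]) auto
    qed
  qed
  show "vanishes B"
  proof (rule vanishes_AE_lim)
    show "B m \<in> borel_measurable M" for m
      unfolding B_def
      by (intro borel_measurable_diff L_meas borel_measurable_sum borel_measurable_times g_meas J_meas)
        (use bounds in \<open>auto simp: less_imp_le\<close>)
    show "AE \<omega> in M. (\<lambda>m. B m \<omega>) \<longlonglongrightarrow> 0"
    proof (rule AE_I2)
      fix \<omega> assume \<omega>: "\<omega> \<in> space M"
      have "continuous_on {(s, u). a \<le> s \<and> s \<le> u \<and> u \<le> b}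
          (\<lambda>(s, u). \<Sum>i\<in>I. g i s \<omega> * \<kappa> i s u \<omega>)"
        using \<kappa>_cont[OF _ \<omega>] unfolding case_prod_beta
        by (intro continuous_on_sum continuous_on_mult continuous_on_compose2[OF g_cont[OF _ \<omega>]])
          (auto intro!: continuous_intros)
      from diagonal_riemann_sums[OF ab this]
      have lim: "(\<lambda>m. (\<Sum>j<m. integral {uniform_node a b m j..uniform_node a b m (Suc j)}
          (\<lambda>u. \<Sum>i\<in>I. g i (uniform_node a b m j) \<omega> * \<kappa> i (uniform_node a b m j) u \<omega>)) - ?L \<omega>) \<longlonglongrightarrow> 0"
        by (simp add: LIM_zero)
      have block: "integral {uniform_node a b m j..uniform_node a b m (Suc j)}
          (\<lambda>u. \<Sum>i\<in>I. g i (uniform_node a b m j) \<omega> * \<kappa> i (uniform_node a b m j) u \<omega>)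
        = (\<Sum>i\<in>I. g i (uniform_node a b m j) \<omega> * ?J i (uniform_node a b m j) (uniform_node a b m (Suc j)) \<omega>)"
        if "j < m" for m j
      proof (cases "finite I")
        case True
        then show ?thesis
          using bounds[OF that] slice[OF _ \<omega>]
          by (subst Henstock_Kurzweil_Integration.integral_sum)
            (auto intro!: integrable_continuous_interval continuous_intros)
      qed simp
      have "B m \<omega> = (\<Sum>j<m. integral {uniform_node a b m j..uniform_node a b m (Suc j)}
          (\<lambda>u. \<Sum>i\<in>I. g i (uniform_node a b m j) \<omega> * \<kappa> i (uniform_node a b m j) u \<omega>)) - ?L \<omega>" for m
        unfolding B_def
        by (intro arg_cong2[of _ _ _ _ "(-)"] sum.cong refl block[symmetric]) auto
      with lim show "(\<lambda>m. B m \<omega>) \<longlonglongrightarrow> 0"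
        by presburger
    qed
  qed
  show "\<forall>\<^sub>F n in sequentially. AE \<omega> in M. Z n \<omega> - ?L \<omega> = A m n \<omega> + (E m n \<omega> + B m \<omega>)"
    if "m > 0" for m
    using Z[OF that]
  proof eventually_elim
    case (elim n)
    then show ?case
      by (rule AE_mp) (simp add: A_def B_def sum_subtractf)
  qed
qed

end

section \<open>Words, grid indices and measurability\<close>

lemma finite_words [simp]: "finite (words k :: 'd::finite list set)"
  using finite_lists_length_eq[of "UNIV :: 'd set" k] by (simp add: words_def)

lemma words_0 [simp]: "words 0 = {[]}"
  by (auto simp: words_def)

lemma sum_words_append:
  fixes f :: "'d::finite list \<Rightarrow> 'd list \<Rightarrow> 'a::comm_monoid_add"
  shows "(\<Sum>w\<in>words (q + j). f (take q w) (drop q w)) = (\<Sum>u\<in>words q. \<Sum>v\<in>words j. f u v)"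
proof -
  have "(\<Sum>w\<in>words (q + j). f (take q w) (drop q w)) = (\<Sum>(u, v)\<in>words q \<times> words j. f u v)"
    by (rule sum.reindex_bij_witness[of _ "\<lambda>(u, v). u @ v" "\<lambda>w. (take q w, drop q w)"])
      (auto simp: words_def)
  then show ?thesis by (simp add: sum.cartesian_product)
qed

lemma sum_triangle_swap:
  fixes F :: "nat \<Rightarrow> nat \<Rightarrow> 'a::comm_monoid_add"
  shows "(\<Sum>i<L. \<Sum>j\<le>i. F (i - j) j) = (\<Sum>j<L. \<Sum>q<L-j. F q j)"
proof -
  have "(\<Sum>i<L. \<Sum>j\<le>i. F (i - j) j) = (\<Sum>(i, j)\<in>(SIGMA i:{..<L}. {..i}). F (i - j) j)"
    by (simp add: sum.Sigma)
  also have "\<dots> = (\<Sum>(j, q)\<in>(SIGMA j:{..<L}. {..<L-j}). F q j)"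
    by (rule sum.reindex_bij_witness[of _ "\<lambda>(j, q). (j + q, j)" "\<lambda>(i, j). (j, i - j)"]) auto
  finally show ?thesis by (simp add: sum.Sigma)
qed

text \<open>The index \<open>k\<close> with \<open>\<epsilon>(s) = t_k\<close>. It turns the half-open intervals that index the discrete
  integrals into integer intervals, so that blocks concatenate exactly.\<close>

definition grid_index :: "nat \<Rightarrow> real \<Rightarrow> nat" where
  "grid_index n s = nat \<lceil>real n * s\<rceil>"

lemma grid_index_mono: "s \<le> t \<Longrightarrow> grid_index n s \<le> grid_index n t"
  unfolding grid_index_def by (intro nat_mono ceiling_mono mult_left_mono) auto

lemma grid_index_le: "s \<le> 1 \<Longrightarrow> grid_index n s \<le> n"
  using grid_index_mono[of s 1 n] by (simp add: grid_index_def)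

lemma gpt_mono: "j \<le> k \<Longrightarrow> gpt n j \<le> gpt n k"
  by (simp add: gpt_def divide_right_mono)

lemma gpt_bounds: "0 \<le> gpt n k" "k \<le> n \<Longrightarrow> gpt n k \<le> 1"
  by (auto simp: gpt_def divide_le_eq_1)

lemma gpt_diff: "a \<le> b \<Longrightarrow> gpt n b - gpt n a = real (b - a) / real n"
  by (simp add: gpt_def of_nat_diff diff_divide_distrib)

lemma grid_eps_eq_gpt: "0 \<le> s \<Longrightarrow> grid_eps n s = gpt n (grid_index n s)"
proof -
  assume "0 \<le> s"
  then have "0 \<le> real n * s" by simp
  then have "0 \<le> \<lceil>real n * s\<rceil>" by linarith
  then show ?thesis by (simp add: grid_eps_def gpt_def grid_index_def)
qed

lemma gpt_grid_index_bounds: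
  assumes "0 < n" "0 \<le> s"
  shows "s \<le> gpt n (grid_index n s)" "gpt n (grid_index n s) < s + 1 / real n"
proof -
  have "real n * s \<le> of_int \<lceil>real n * s\<rceil>" "of_int \<lceil>real n * s\<rceil> < real n * s + 1"
    using ceiling_correct[of "real n * s"] by linarith+
  then show "s \<le> gpt n (grid_index n s)" "gpt n (grid_index n s) < s + 1 / real n"
    using assms by (auto simp: grid_eps_eq_gpt[symmetric] grid_eps_def field_simps)
qed

lemma gpt_grid_index_tendsto:
  assumes "0 \<le> s"
  shows "(\<lambda>n. gpt n (grid_index n s)) \<longlonglongrightarrow> s"
proof (rule tendsto_sandwich)
  show "\<forall>\<^sub>F n in sequentially. s \<le> gpt n (grid_index n s)"
    using eventually_gt_at_top[of 0] by eventually_elim (rule gpt_grid_index_bounds(1)[OF _ assms])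
  show "\<forall>\<^sub>F n in sequentially. gpt n (grid_index n s) \<le> s + 1 / real n"
    using eventually_gt_at_top[of 0] 
    by eventually_elim (rule less_imp_le[OF gpt_grid_index_bounds(2)[OF _ assms]])
  show "(\<lambda>n. s + 1 / real n) \<longlonglongrightarrow> s"
    using tendsto_add[OF tendsto_const lim_const_over_n[of 1], of s] by simp
qed simp

lemma cells_eq:
  assumes "0 \<le> s" "t \<le> 1"
  shows "cells n s t = {grid_index n s..<grid_index n t}"
proof (cases "n = 0")
  case True
  then show ?thesis by (simp add: cells_def grid_index_def)
next
  case False
  have "s \<le> gpt n k \<longleftrightarrow> grid_index n s \<le> k" for k
    using False by (simp add: gpt_def grid_index_def nat_le_iff ceiling_le_iff field_simps)
  moreover have "gpt n k < t \<longleftrightarrow> k < grid_index n t" for k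
    using False by (simp add: gpt_def grid_index_def zless_nat_eq_int_zless less_ceiling_iff field_simps)
  ultimately show ?thesis
    using grid_index_le[OF assms(2), of n] by (auto simp: cells_def)
qed

lemma J_rough_measurable:
  fixes h :: "real \<Rightarrow> real \<Rightarrow> 'a \<Rightarrow> 'w::euclidean_space"
  assumes x: "\<And>s t. 0 \<le> s \<Longrightarrow> s \<le> t \<Longrightarrow> t \<le> 1 \<Longrightarrow> (\<lambda>\<omega>. xi s t \<omega> w) \<in> borel_measurable M"
    and h: "\<And>k. k < n \<Longrightarrow> h (gpt n k) (gpt n (Suc k)) \<in> borel_measurable M"
    and st: "0 \<le> s" "t \<le> 1"
  shows "(\<lambda>\<omega>. J_rough n xi h s t \<omega> w) \<in> borel_measurable M"
  unfolding J_rough_def cells_eq[OF st] grid_eps_eq_gpt[OF st(1)]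
  using gpt_bounds gpt_mono grid_index_le[OF st(2), of n]
  by (intro borel_measurable_sum borel_measurable_scaleR x h) auto

lemma remainder_measurable:
  fixes y :: "nat \<Rightarrow> real \<Rightarrow> 'a \<Rightarrow> 'd::finite list \<Rightarrow> 'v::euclidean_space"
  assumes y: "\<And>k w t. k < l \<Longrightarrow> w \<in> words k \<Longrightarrow> t \<in> {0..1} \<Longrightarrow> (\<lambda>\<omega>. y k t \<omega> w) \<in> borel_measurable M"
    and x: "\<And>k w s t. k < l \<Longrightarrow> w \<in> words k \<Longrightarrow> 0 \<le> s \<Longrightarrow> s \<le> t \<Longrightarrow> t \<le> 1 \<Longrightarrow>
      (\<lambda>\<omega>. x k s t \<omega> w) \<in> borel_measurable M"
    and "k < l" "w \<in> words k" "0 \<le> s" "s \<le> t" "t \<le> 1"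
  shows "(\<lambda>\<omega>. remainder l x y k s t \<omega> w) \<in> borel_measurable M"
  unfolding remainder_def delta1_def partial_apply_def
  using assms(3-)
  by (intro borel_measurable_diff borel_measurable_sum borel_measurable_scaleR y x)
    (auto simp: words_def)

section \<open>Limits of the discrete integrals of the rough path\<close>

text \<open>One scalar component of the increments \<open>h^n\<close>. The hypothesis on sums over partitions is recorded
  for partitions of an arbitrary subinterval into equal parts.\<close>

locale rough_sums = prob_space M for M :: "'a measure" +
  fixes l \<tau> :: nat
    and x :: "nat \<Rightarrow> real \<Rightarrow> real \<Rightarrow> 'a \<Rightarrow> 'd::finite list \<Rightarrow> real"
    and h :: "nat \<Rightarrow> real \<Rightarrow> real \<Rightarrow> 'a \<Rightarrow> real"
    and \<rho> :: "'d list \<Rightarrow> real"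
  assumes x_0: "\<omega> \<in> space M \<Longrightarrow> x 0 s t \<omega> [] = 1"
    and x_meas_pos: "0 < k \<Longrightarrow> k < l \<Longrightarrow> w \<in> words k \<Longrightarrow> 0 \<le> s \<Longrightarrow> s \<le> t \<Longrightarrow> t \<le> 1 \<Longrightarrow>
      (\<lambda>\<omega>. x k s t \<omega> w) \<in> borel_measurable M"
    and x_cont_pos: "0 < k \<Longrightarrow> k < l \<Longrightarrow> w \<in> words k \<Longrightarrow> \<omega> \<in> space M \<Longrightarrow>
      continuous_on simplex2 (\<lambda>(s, t). x k s t \<omega> w)"
    and x_chen: "0 < k \<Longrightarrow> k < l \<Longrightarrow> 0 \<le> s \<Longrightarrow> s \<le> u \<Longrightarrow> u \<le> t \<Longrightarrow> t \<le> 1 \<Longrightarrow>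
      AE \<omega> in M. \<forall>w\<in>words k. delta2 (\<lambda>a b. x k a b \<omega> w) s u t =
        (\<Sum>j=1..k-1. tensor_mult (k - j) (x (k - j) s u \<omega>) (x j u t \<omega>) w)"
    and h_meas: "k < n \<Longrightarrow> h n (gpt n k) (gpt n (Suc k)) \<in> borel_measurable M"
    and \<tau>_less: "\<tau> < l"
    and J_\<tau>: "w \<in> words \<tau> \<Longrightarrow> 0 \<le> s \<Longrightarrow> s \<le> t \<Longrightarrow> t \<le> 1 \<Longrightarrow>
      vanishes (\<lambda>n \<omega>. J_rough n (x \<tau>) (h n) s t \<omega> w - (t - s) * \<rho> w)"
    and J_below: "i < \<tau> \<Longrightarrow> w \<in> words i \<Longrightarrow> 0 \<le> s \<Longrightarrow> s \<le> t \<Longrightarrow> t \<le> 1 \<Longrightarrow>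
      vanishes (\<lambda>n \<omega>. J_rough n (x i) (h n) s t \<omega> w)"
    and J_above: "\<tau> < i \<Longrightarrow> i < l \<Longrightarrow> w \<in> words i \<Longrightarrow> 0 \<le> s \<Longrightarrow> s < t \<Longrightarrow> t \<le> 1 \<Longrightarrow>
      vanishes_iterated (\<lambda>m n \<omega>. \<Sum>j<m.
        J_rough n (x i) (h n) (uniform_node s t m j) (uniform_node s t m (Suc j)) \<omega> w)"
begin

lemma x_meas:
  assumes "k < l" "w \<in> words k" "0 \<le> s" "s \<le> t" "t \<le> 1"
  shows "(\<lambda>\<omega>. x k s t \<omega> w) \<in> borel_measurable M"
proof (cases "k = 0")
  case True
  then show ?thesis using assms(2) x_0 by (simp cong: measurable_cong)
qed (use assms x_meas_pos in simp)

lemma x_cont: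
  assumes "k < l" "w \<in> words k" "\<omega> \<in> space M"
  shows "continuous_on simplex2 (\<lambda>(s, t). x k s t \<omega> w)"
proof (cases "k = 0")
  case True
  then show ?thesis using assms x_0 by simp
qed (use assms x_cont_pos in simp)

text \<open>Since \<open>x^0 = 1\<close>, the increment \<open>\<delta>x^k\<close> supplies exactly the terms \<open>q = 0\<close> and \<open>q = k\<close> of the full
  convolution.\<close>

lemma chen:
  assumes "0 \<le> s" "s \<le> u" "u \<le> t" "t \<le> 1"
  shows "AE \<omega> in M. \<forall>k<l. \<forall>w\<in>words k. x k s t \<omega> w =
    (\<Sum>q\<le>k. x (k - q) s u \<omega> (take (k - q) w) * x q u t \<omega> (drop (k - q) w))"
proof -
  have "AE \<omega> in M. \<forall>k\<in>{0<..<l}. \<forall>w\<in>words k. delta2 (\<lambda>a b. x k a b \<omega> w) s u t =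
        (\<Sum>j=1..k-1. tensor_mult (k - j) (x (k - j) s u \<omega>) (x j u t \<omega>) w)"
  proof (rule AE_finite_allI)
    fix k assume "k \<in> {0<..<l}"
    then show "AE \<omega> in M. \<forall>w\<in>words k. delta2 (\<lambda>a b. x k a b \<omega> w) s u t =
        (\<Sum>j=1..k-1. tensor_mult (k - j) (x (k - j) s u \<omega>) (x j u t \<omega>) w)"
      by (intro x_chen assms) auto
  qed simp
  then show ?thesis
    using AE_space
  proof eventually_elim
    case (elim \<omega>)
    show ?case
    proof (intro allI ballI impI)
      fix k and w :: "'d list" assume k: "k < l" "w \<in> words k"
      let ?f = "\<lambda>q. x (k - q) s u \<omega> (take (k - q) w) * x q u t \<omega> (drop (k - q) w)"
      show "x k s t \<omega> w = sum ?f {..k}"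
      proof (cases "k = 0")
        case True
        then show ?thesis using k x_0[OF elim(2)] by simp
      next
        case False
        then have "{..k} = insert 0 (insert k {1..k-1})" by auto
        then have "sum ?f {..k} = ?f 0 + (?f k + sum ?f {1..k-1})"
          using False by simp
        also have "?f 0 = x k s u \<omega> w"
          using k x_0[OF elim(2)] by (auto simp: words_def)
        also have "?f k = x k u t \<omega> w"
          using k x_0[OF elim(2)] by (auto simp: words_def)
        also have "sum ?f {1..k-1} = delta2 (\<lambda>a b. x k a b \<omega> w) s u t"
          using elim(1) k False by (simp add: tensor_mult_def)
        finally show ?thesis by (simp add: delta2_def)
      qed
    qed
  qed
qed

lemma chen_grid:
  "AE \<omega> in M. \<forall>a c b. a \<le> c \<longrightarrow> c \<le> b \<longrightarrow> b \<le> n \<longrightarrow> (\<forall>k<l. \<forall>w\<in>words k.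
    x k (gpt n a) (gpt n b) \<omega> w = (\<Sum>q\<le>k. x (k - q) (gpt n a) (gpt n c) \<omega> (take (k - q) w)
      * x q (gpt n c) (gpt n b) \<omega> (drop (k - q) w)))"
  unfolding AE_all_countable using chen[OF _ gpt_mono gpt_mono] gpt_bounds
  by (intro allI AE_impI) auto

text \<open>At coinciding times Chen's relation reads \<open>x^k_{uu} = 2 x^k_{uu}\<close> plus products of lower levels,
  so \<open>x^k_{uu} = 0\<close> by induction on \<open>k\<close>. The relation holds only almost surely for each choice of
  times, so this is done at the countably many grid points, and continuity of the paths covers the
  other times with a single exceptional event.\<close>

lemma x_diagonal:
  "AE \<omega> in M. \<forall>u\<in>{0..1}. \<forall>k\<in>{0<..<l}. \<forall>w\<in>words k. x k u u \<omega> w = 0"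
proof -
  have "AE \<omega> in M. \<forall>n. \<forall>a\<le>n. (\<forall>k<l. \<forall>w\<in>words k.
    x k (gpt n a) (gpt n a) \<omega> w = (\<Sum>q\<le>k. x (k - q) (gpt n a) (gpt n a) \<omega> (take (k - q) w)
      * x q (gpt n a) (gpt n a) \<omega> (drop (k - q) w)))"
  proof (rule AE_all_countable[THEN iffD2], rule allI)
    fix n show "AE \<omega> in M. \<forall>a\<le>n. (\<forall>k<l. \<forall>w\<in>words k.
    x k (gpt n a) (gpt n a) \<omega> w = (\<Sum>q\<le>k. x (k - q) (gpt n a) (gpt n a) \<omega> (take (k - q) w)
      * x q (gpt n a) (gpt n a) \<omega> (drop (k - q) w)))"
      using chen_grid[of n] by eventually_elim blast
  qed
  then show ?thesis
    using AE_space
  proof eventually_elim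
    case (elim \<omega>)
    have grid0: "x k (gpt n a) (gpt n a) \<omega> w = 0" if "a \<le> n" "0 < k" "k < l" "w \<in> words k" for n a k w
      using that(2-)
    proof (induction k arbitrary: w rule: less_induct)
      case (less k)
      let ?x = "\<lambda>k. x k (gpt n a) (gpt n a) \<omega>"
      let ?f = "\<lambda>q. ?x (k - q) (take (k - q) w) * ?x q (drop (k - q) w)"
      have "{..k} = insert 0 (insert k {1..k-1})" using less.prems by auto
      then have "sum ?f {..k} = ?f 0 + (?f k + sum ?f {1..k-1})"
        using less.prems(1) by simp
      moreover have "?x k w = sum ?f {..k}"
        using elim(1) that(1) less.prems(2,3) by blast
      ultimately have "?x k w = ?f 0 + (?f k + sum ?f {1..k-1})"
        by (rule trans[rotated])
      also have "sum ?f {1..k-1} = 0"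
      proof (rule sum.neutral, rule ballI)
        fix q assume q: "q \<in> {1..k-1}"
        then have "?x q (drop (k - q) w) = 0"
          using less.prems by (intro less.IH) (auto simp: words_def)
        then show "?f q = 0" by simp
      qed
      finally show ?case
        using less.prems x_0[OF elim(2)] by (simp add: words_def)
    qed
    show ?case
    proof (intro ballI)
      fix u :: real and k and w :: "'d list"
      assume u: "u \<in> {0..1}" and k: "k \<in> {0<..<l}" "w \<in> words k"
      have cont: "continuous_on {0..1} (\<lambda>v. x k v v \<omega> w)"
        using k by (intro continuous_on_compose2[OF x_cont[OF _ k(2) elim(2)],
            of _ "\<lambda>u. (u, u)", simplified])
          (auto intro!: continuous_intros simp: simplex2_def)
      have "(\<lambda>n. x k (gpt n (grid_index n u)) (gpt n (grid_index n u)) \<omega> w) \<longlonglongrightarrow> x k u u \<omega> w"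
        using u gpt_bounds grid_index_le
        by (intro continuous_on_tendsto_compose[OF cont gpt_grid_index_tendsto]) auto
      moreover have "x k (gpt n (grid_index n u)) (gpt n (grid_index n u)) \<omega> w = 0" for n
        using u k grid_index_le by (intro grid0) auto
      ultimately show "x k u u \<omega> w = 0"
        by (simp add: LIMSEQ_const_iff)
    qed
  qed
qed

definition dh :: "nat \<Rightarrow> nat \<Rightarrow> 'a \<Rightarrow> real" where
  "dh n k = h n (gpt n k) (gpt n (Suc k))"

definition Jx :: "nat \<Rightarrow> nat \<Rightarrow> nat \<Rightarrow> nat \<Rightarrow> 'a \<Rightarrow> 'd list \<Rightarrow> real" where
  "Jx n i a b \<omega> w = (\<Sum>k\<in>{a..<b}. x i (gpt n a) (gpt n k) \<omega> w * dh n k \<omega>)"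

lemma J_rough_eq_Jx:
  "0 \<le> s \<Longrightarrow> t \<le> 1 \<Longrightarrow>
    J_rough n (x i) (h n) s t \<omega> w = Jx n i (grid_index n s) (grid_index n t) \<omega> w"
  by (simp add: J_rough_def cells_eq grid_eps_eq_gpt Jx_def dh_def)

lemma Jx_meas:
  assumes "i < l" "w \<in> words i" "b \<le> n"
  shows "(\<lambda>\<omega>. Jx n i a b \<omega> w) \<in> borel_measurable M"
  unfolding Jx_def dh_def using assms gpt_bounds gpt_mono
  by (intro borel_measurable_sum borel_measurable_times x_meas h_meas) auto

lemma J_rough_meas:
  assumes "i < l" "w \<in> words i" "0 \<le> s" "t \<le> 1"
  shows "(\<lambda>\<omega>. J_rough n (x i) (h n) s t \<omega> w) \<in> borel_measurable M"
  using assms by (intro J_rough_measurable x_meas h_meas)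

text \<open>Chen's relation, applied at the starting point of each block, moves the base point of \<open>x^i\<close> from
  the start of the interval to the start of the block.\<close>

lemma Jx_blocks:
  assumes "i < l" "w \<in> words i" and mono: "\<And>j. j < m \<Longrightarrow> p j \<le> p (Suc j)" and "p m \<le> n"
  shows "AE \<omega> in M. Jx n i (p 0) (p m) \<omega> w =
    (\<Sum>j<m. \<Sum>q\<le>i. x (i - q) (gpt n (p 0)) (gpt n (p j)) \<omega> (take (i - q) w)
      * Jx n q (p j) (p (Suc j)) \<omega> (drop (i - q) w))"
  using chen_grid[of n]
proof eventually_elim
  case (elim \<omega>)
  have p0: "p 0 \<le> p j" if "j \<le> m" for j
    using that mono by (induction j) (auto intro: order_trans)
  have pm: "p j \<le> p m" if "j \<le> m" for j
    using that mono by (induction rule: inc_induct) (auto intro: order_trans)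
  have "Jx n i (p 0) (p m) \<omega> w =
      (\<Sum>j<m. \<Sum>k\<in>{p j..<p (Suc j)}. x i (gpt n (p 0)) (gpt n k) \<omega> w * dh n k \<omega>)"
    unfolding Jx_def by (rule sum_consecutive_blocks[symmetric]) (rule mono)
  also have "\<dots> = (\<Sum>j<m. \<Sum>k\<in>{p j..<p (Suc j)}. \<Sum>q\<le>i.
      x (i - q) (gpt n (p 0)) (gpt n (p j)) \<omega> (take (i - q) w)
      * (x q (gpt n (p j)) (gpt n k) \<omega> (drop (i - q) w) * dh n k \<omega>))"
  proof (intro sum.cong refl)
    fix j k assume jk: "j \<in> {..<m}" "k \<in> {p j..<p (Suc j)}"
    then have "p 0 \<le> p j" "p j \<le> k" "k \<le> n"
      using p0[of j] pm[of "Suc j"] assms(4) by auto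
    then show "x i (gpt n (p 0)) (gpt n k) \<omega> w * dh n k \<omega> = (\<Sum>q\<le>i.
      x (i - q) (gpt n (p 0)) (gpt n (p j)) \<omega> (take (i - q) w)
      * (x q (gpt n (p j)) (gpt n k) \<omega> (drop (i - q) w) * dh n k \<omega>))"
      using elim assms(1,2) by (simp add: sum_distrib_right mult.assoc)
  qed
  also have "\<dots> = (\<Sum>j<m. \<Sum>q\<le>i. x (i - q) (gpt n (p 0)) (gpt n (p j)) \<omega> (take (i - q) w)
      * Jx n q (p j) (p (Suc j)) \<omega> (drop (i - q) w))"
    unfolding Jx_def sum_distrib_left by (intro sum.cong refl sum.swap)
  finally show ?case .
qed

text \<open>The entry at the word \<open>w\<close> of \<open>x^{i-\<tau>}_{su} \<otimes> \<rho>\<close>, the density in \<open>u\<close> of the limit of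
  \<open>J_s^t(x^i; h^n)\<close>.\<close>

definition kernel :: "nat \<Rightarrow> 'd list \<Rightarrow> real \<Rightarrow> real \<Rightarrow> 'a \<Rightarrow> real" where
  "kernel i w s u \<omega> =
    (if i < \<tau> then 0 else x (i - \<tau>) s u \<omega> (take (i - \<tau>) w) * \<rho> (drop (i - \<tau>) w))"

lemma kernel_meas:
  "i < l \<Longrightarrow> w \<in> words i \<Longrightarrow> 0 \<le> s \<Longrightarrow> s \<le> u \<Longrightarrow> u \<le> 1 \<Longrightarrow> kernel i w s u \<in> borel_measurable M"
  unfolding kernel_def[abs_def] if_distrib[of "\<lambda>f. f _"]
  by (cases "i < \<tau>") (auto intro!: borel_measurable_times x_meas simp: words_def)

lemma kernel_cont:
  assumes "i < l" "w \<in> words i" "0 \<le> a" "b \<le> 1" "\<omega> \<in> space M"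
  shows "continuous_on {(s, u). a \<le> s \<and> s \<le> u \<and> u \<le> b} (\<lambda>(s, u). kernel i w s u \<omega>)"
proof (cases "i < \<tau>")
  case False
  have "continuous_on simplex2 (\<lambda>(s, u). x (i - \<tau>) s u \<omega> (take (i - \<tau>) w))"
    using assms by (intro x_cont) (auto simp: words_def)
  then have "continuous_on {(s, u). a \<le> s \<and> s \<le> u \<and> u \<le> b}
      (\<lambda>(s, u). x (i - \<tau>) s u \<omega> (take (i - \<tau>) w))"
    by (rule continuous_on_subset) (use assms in \<open>auto simp: simplex2_def\<close>)
  then show ?thesis
    using False unfolding kernel_def case_prod_beta by (auto intro!: continuous_intros)
qed (simp add: kernel_def)

lemma kernel_diagonal:
  "AE \<omega> in M. \<forall>u\<in>{0..1}. \<forall>i<l. \<forall>w\<in>words i. kernel i w u u \<omega> = (if i = \<tau> then \<rho> w else 0)"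
  using x_diagonal AE_space
proof eventually_elim
  case (elim \<omega>)
  show ?case
  proof (intro ballI allI impI)
    fix u i and w :: "'d list" assume *: "u \<in> {0..1::real}" "i < l" "w \<in> words i"
    then have "x (i - \<tau>) u u \<omega> (take (i - \<tau>) w) = 0" if "\<tau> < i"
      using elim(1) that by (auto simp: words_def)
    then show "kernel i w u u \<omega> = (if i = \<tau> then \<rho> w else 0)"
      using x_0[OF elim(2)] by (auto simp: kernel_def)
  qed
qed

text \<open>Up to level \<open>\<tau>\<close> this is assumed. Above it, the block decomposition expresses the integral of level
  \<open>i\<close> through those of level \<open>q < i\<close>, with weights \<open>x^{i-q}\<close>; the blocks of level \<open>i\<close> itself form
  the sum that vanishes for \<open>m \<ll> n\<close>.\<close>

lemma J_rough_limit:
  assumes "i < l" "w \<in> words i" "0 \<le> s" "s \<le> t" "t \<le> 1"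
  shows "vanishes (\<lambda>n \<omega>. J_rough n (x i) (h n) s t \<omega> w - integral {s..t} (\<lambda>u. kernel i w s u \<omega>))"
  using assms
proof (induction i arbitrary: w s t rule: less_induct)
  case (less i)
  have int_meas: "(\<lambda>\<omega>. integral {s..t} (\<lambda>u. kernel i w s u \<omega>)) \<in> borel_measurable M"
  proof (intro borel_measurable_integral_continuous kernel_meas)
    fix \<omega> assume "\<omega> \<in> space M"
    show "continuous_on {s..t} (\<lambda>u. kernel i w s u \<omega>)"
      by (rule continuous_on_compose2[OF kernel_cont[of i w s t \<omega>], of _ "\<lambda>u. (s, u)", simplified])
        (use less.prems \<open>\<omega> \<in> space M\<close> in \<open>auto intro!: continuous_intros\<close>)
  qed (use less.prems in auto)
  note meas = borel_measurable_diff[OF J_rough_meas int_meas]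
  consider "i < \<tau>" | "i = \<tau>" | "\<tau> < i" "s = t" | "\<tau> < i" "s < t"
    using less.prems by linarith
  then show ?case
  proof cases
    case 1
    then show ?thesis
      using J_below[of i w s t] less.prems by (simp add: kernel_def)
  next
    case 2
    show ?thesis
    proof (rule vanishes_cong[OF J_\<tau>[of w s t]])
      show "\<forall>\<^sub>F n in sequentially. AE \<omega> in M. J_rough n (x i) (h n) s t \<omega> w
          - integral {s..t} (\<lambda>u. kernel i w s u \<omega>)
        = J_rough n (x \<tau>) (h n) s t \<omega> w - (t - s) * \<rho> w"
        using less.prems x_0 2 by (intro always_eventually allI AE_I2) (simp add: kernel_def)
    qed (use less.prems meas 2 in auto)
  next
    case 3
    then show ?thesis
      using less.prems by (simp add: J_rough_eq_Jx Jx_def vanishes_zero)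
  next
    case 4
    let ?I = "{..<i}"
    let ?w = "\<lambda>q. drop (i - q) w"
    have words: "?w q \<in> words q" "take (i - q) w \<in> words (i - q)" if "q < i" for q
      using that less.prems by (auto simp: words_def)
    have st: "0 \<le> s" "s < t" "t \<le> 1" using less.prems 4 by auto
    let ?E = "\<lambda>m n \<omega>. \<Sum>j<m. J_rough n (x i) (h n) (uniform_node s t m j) (uniform_node s t m (Suc j)) \<omega> w"
    have ub: "0 \<le> uniform_node s t m j" "uniform_node s t m j \<le> 1" if "0 < m" "j \<le> m" for m j
      using uniform_node_bounds[of s t m j] that st by auto
    have gb: "0 \<le> gpt n (grid_index n u)" "gpt n (grid_index n u) \<le> 1" if "u \<le> 1" for u n
      using that gpt_bounds grid_index_le by auto
    have "vanishes (\<lambda>n \<omega>. J_rough n (x i) (h n) s t \<omega> w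
        - integral {s..t} (\<lambda>u. \<Sum>q\<in>?I. x (i - q) s u \<omega> (take (i - q) w) * kernel q (?w q) u u \<omega>))"
    proof (rule weighted_increments_limit[where E = ?E
          and \<Psi> = "\<lambda>n q a b \<omega>. J_rough n (x q) (h n) a b \<omega> (?w q)"
          and \<kappa> = "\<lambda>q. kernel q (?w q)" and g = "\<lambda>q u \<omega>. x (i - q) s u \<omega> (take (i - q) w)"
          and c = "\<lambda>n q u \<omega>. x (i - q) (gpt n (grid_index n s)) (gpt n (grid_index n u)) \<omega> (take (i - q) w)"])
      fix q assume q: "q \<in> ?I"
      then have q': "q < i" "q < l" "i - q < l" using less.prems by auto
      show "(\<lambda>\<omega>. x (i - q) s u \<omega> (take (i - q) w)) \<in> borel_measurable M" if "u \<in> {s..t}" for u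
        using that st q' words by (intro x_meas) auto
      show "(\<lambda>\<omega>. x (i - q) (gpt n (grid_index n s)) (gpt n (grid_index n u)) \<omega> (take (i - q) w))
          \<in> borel_measurable M" if "u \<in> {s..t}" for u n
        using that st q' words gb by (intro x_meas gpt_mono grid_index_mono) auto
      show "kernel q (?w q) a u \<in> borel_measurable M" if "s \<le> a" "a \<le> u" "u \<le> t" for a u
        using that st q' words by (intro kernel_meas) auto
      show "vanishes (\<lambda>n \<omega>. J_rough n (x q) (h n) a b \<omega> (?w q)
          - integral {a..b} (\<lambda>u. kernel q (?w q) a u \<omega>))" if "s \<le> a" "a < b" "b \<le> t" for a b
        using that st q' words by (intro less.IH) auto
      fix \<omega> assume \<omega>: "\<omega> \<in> space M"
      have xc: "continuous_on simplex2 (\<lambda>(a, u). x (i - q) a u \<omega> (take (i - q) w))"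
        using q' words \<omega> by (intro x_cont) auto
      show "continuous_on {s..t} (\<lambda>u. x (i - q) s u \<omega> (take (i - q) w))"
        by (rule continuous_on_compose2[OF xc, of _ "\<lambda>u. (s, u)", simplified])
          (use st in \<open>auto intro!: continuous_intros simp: simplex2_def\<close>)
      show "(\<lambda>n. x (i - q) (gpt n (grid_index n s)) (gpt n (grid_index n u)) \<omega> (take (i - q) w))
          \<longlonglongrightarrow> x (i - q) s u \<omega> (take (i - q) w)" if u: "u \<in> {s..t}" for u
      proof -
        have "gpt n (grid_index n s) \<le> gpt n (grid_index n u)" for n
          using u by (intro gpt_mono grid_index_mono) auto
        moreover have "(\<lambda>n. (gpt n (grid_index n s), gpt n (grid_index n u))) \<longlonglongrightarrow> (s, u)"
          using u st by (intro tendsto_Pair gpt_grid_index_tendsto) auto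
        ultimately show ?thesis
          using continuous_on_tendsto_compose[OF xc,
              of "\<lambda>n. (gpt n (grid_index n s), gpt n (grid_index n u))" "(s, u)" sequentially] u st gb
          by (simp add: simplex2_def)
      qed
      show "continuous_on {(a, u). s \<le> a \<and> a \<le> u \<and> u \<le> t} (\<lambda>(a, u). kernel q (?w q) a u \<omega>)"
        using st q' words \<omega> by (intro kernel_cont) auto
    next
      show "s < t" by fact
      show "(\<lambda>\<omega>. J_rough n (x i) (h n) s t \<omega> w) \<in> borel_measurable M" for n
        using less.prems by (intro J_rough_meas) auto
      show "?E m n \<in> borel_measurable M" for m n
        using less.prems ub by (intro borel_measurable_sum J_rough_meas) auto
      show "vanishes_iterated ?E"
        using less.prems 4 by (intro J_above) auto
    next
      fix m :: nat assume m: "m > 0"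
      show "\<forall>\<^sub>F n in sequentially. AE \<omega> in M. J_rough n (x i) (h n) s t \<omega> w = (\<Sum>j<m. \<Sum>q\<in>?I.
          x (i - q) (gpt n (grid_index n s)) (gpt n (grid_index n (uniform_node s t m j))) \<omega> (take (i - q) w)
          * J_rough n (x q) (h n) (uniform_node s t m j) (uniform_node s t m (Suc j)) \<omega> (?w q)) + ?E m n \<omega>"
      proof (rule always_eventually, rule allI)
        fix n
        let ?p = "\<lambda>j. grid_index n (uniform_node s t m j)"
        have "AE \<omega> in M. Jx n i (?p 0) (?p m) \<omega> w =
          (\<Sum>j<m. \<Sum>q\<le>i. x (i - q) (gpt n (?p 0)) (gpt n (?p j)) \<omega> (take (i - q) w)
            * Jx n q (?p j) (?p (Suc j)) \<omega> (?w q))"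
          using less.prems m by (intro Jx_blocks grid_index_mono uniform_node_mono grid_index_le) auto
        then show "AE \<omega> in M. J_rough n (x i) (h n) s t \<omega> w = (\<Sum>j<m. \<Sum>q\<in>?I.
          x (i - q) (gpt n (grid_index n s)) (gpt n (grid_index n (uniform_node s t m j))) \<omega> (take (i - q) w)
          * J_rough n (x q) (h n) (uniform_node s t m j) (uniform_node s t m (Suc j)) \<omega> (?w q)) + ?E m n \<omega>"
          using AE_space
        proof eventually_elim
          case (elim \<omega>)
          then show ?case
            using m st ub by (simp add: J_rough_eq_Jx lessThan_Suc_atMost[symmetric] sum.distrib x_0)
        qed
      qed
    qed
    then show ?thesis
    proof (rule vanishes_cong)
      show "\<forall>\<^sub>F n in sequentially. AE \<omega> in M. J_rough n (x i) (h n) s t \<omega> w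
          - integral {s..t} (\<lambda>u. kernel i w s u \<omega>)
        = J_rough n (x i) (h n) s t \<omega> w
          - integral {s..t} (\<lambda>u. \<Sum>q\<in>?I. x (i - q) s u \<omega> (take (i - q) w) * kernel q (?w q) u u \<omega>)"
      proof (rule always_eventually, rule allI, rule AE_mp[OF kernel_diagonal], rule AE_I2, rule impI)
        fix n \<omega>
        assume elim: "\<forall>u\<in>{0..1}. \<forall>i<l. \<forall>w\<in>words i. kernel i w u u \<omega> = (if i = \<tau> then \<rho> w else 0)"
        have "(\<Sum>q\<in>?I. x (i - q) s u \<omega> (take (i - q) w) * kernel q (?w q) u u \<omega>) = kernel i w s u \<omega>"
          if "u \<in> {s..t}" for u
        proof -
          have "kernel q (?w q) u u \<omega> = (if q = \<tau> then \<rho> (?w q) else 0)" if "q < i" for q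
            using elim \<open>u \<in> {s..t}\<close> st words[OF that] that less.prems by auto
          then have "(\<Sum>q\<in>?I. x (i - q) s u \<omega> (take (i - q) w) * kernel q (?w q) u u \<omega>)
            = (\<Sum>q\<in>?I. if q = \<tau> then x (i - q) s u \<omega> (take (i - q) w) * \<rho> (?w q) else 0)"
            by (intro sum.cong) auto
          then show ?thesis using 4 by (simp add: kernel_def)
        qed
        then have "integral {s..t} (\<lambda>u. \<Sum>q\<in>?I. x (i - q) s u \<omega> (take (i - q) w) * kernel q (?w q) u u \<omega>)
            = integral {s..t} (\<lambda>u. kernel i w s u \<omega>)"
          by (rule integral_cong)
        then show "J_rough n (x i) (h n) s t \<omega> w - integral {s..t} (\<lambda>u. kernel i w s u \<omega>)
          = J_rough n (x i) (h n) s t \<omega> w - integral {s..t}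
            (\<lambda>u. \<Sum>q\<in>?I. x (i - q) s u \<omega> (take (i - q) w) * kernel q (?w q) u u \<omega>)"
          by simp
      qed
    qed (use meas less.prems in auto)
  qed
qed

end

section \<open>Discrete sewing and products of square-integrable variables\<close>

text \<open>Splitting \<open>d \<ge> 2\<close> cells in the middle leaves parts \<open>p + q = d\<close> of at most \<open>2d/3\<close> cells each, the
  worst case being \<open>d = 3\<close>. Hence \<open>p^\<mu> + q^\<mu> \<le> (2/3)^{\<mu>-1} d^\<mu>\<close>, and because \<open>\<mu> > 1\<close> the factor is
  less than one: it leaves room for the defect \<open>C d^\<mu>\<close> in an induction over \<open>d\<close>.\<close>

lemma midpoint_sewing:
  fixes N :: "nat \<Rightarrow> nat \<Rightarrow> real"
  assumes \<mu>: "1 < \<mu>" and C: "0 \<le> C"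
    and unit: "\<And>a. a < n \<Longrightarrow> N a (Suc a) \<le> 0"
    and split: "\<And>a c b. a < c \<Longrightarrow> c < b \<Longrightarrow> b \<le> n \<Longrightarrow>
      N a b \<le> N a c + N c b + C * real (b - a) powr \<mu>"
    and "a < b" "b \<le> n"
  shows "N a b \<le> C / (1 - (2/3) powr (\<mu> - 1)) * real (b - a) powr \<mu>"
  using assms(5,6)
proof (induction "b - a" arbitrary: a b rule: less_induct)
  case less
  define \<theta> :: real where "\<theta> = (2/3) powr (\<mu> - 1)"
  define L where "L = C / (1 - \<theta>)"
  have \<theta>: "\<theta> < 1" "0 \<le> \<theta>"
    using powr_less_mono2[of "\<mu> - 1" "2/3" 1] \<mu> by (auto simp: \<theta>_def)
  then have L: "0 \<le> L" "L * \<theta> + C = L" using C by (auto simp: L_def field_simps)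
  let ?d = "b - a"
  show ?case
  proof (cases "?d = 1")
    case True
    then have "b = Suc a" using less.prems by auto
    then show ?thesis
      using unit[of a] less.prems L(1) by (simp add: L_def \<theta>_def)
  next
    case False
    define c where "c = a + ?d div 2"
    have c: "a < c" "c < b" using False less.prems by (auto simp: c_def)
    have piece: "real k powr \<mu> \<le> real k * (\<theta> * real ?d powr (\<mu> - 1))" if "3 * k \<le> 2 * ?d" "0 < k" for k
    proof -
      have "real k powr \<mu> = real k powr (1 + (\<mu> - 1))" by simp
      also have "\<dots> = real k * real k powr (\<mu> - 1)"
        using that by (simp add: powr_mult_base)
      also have "real k powr (\<mu> - 1) \<le> (2/3 * real ?d) powr (\<mu> - 1)"
      proof (rule powr_mono2)
        have "real (3 * k) \<le> real (2 * ?d)" using that(1) of_nat_le_iff by blast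
        then show "real k \<le> 2/3 * real ?d" by simp
      qed (use \<mu> in auto)
      also have "\<dots> = \<theta> * real ?d powr (\<mu> - 1)"
        unfolding \<theta>_def by (rule powr_mult)
      finally show ?thesis by (simp add: mult_left_mono)
    qed
    have "3 * (c - a) \<le> 2 * ?d" "3 * (b - c) \<le> 2 * ?d"
      using less.prems False by (auto simp: c_def)
    note p = piece[OF this(1)] piece[OF this(2)]
    have "real (c - a) powr \<mu> + real (b - c) powr \<mu>
        \<le> (real (c - a) + real (b - c)) * (\<theta> * real ?d powr (\<mu> - 1))"
      unfolding distrib_right using p c by (intro add_mono) auto
    also have "real (c - a) + real (b - c) = real ?d" using c by (simp add: of_nat_diff)
    also have "real ?d * (\<theta> * real ?d powr (\<mu> - 1)) = \<theta> * (real ?d powr 1 * real ?d powr (\<mu> - 1))"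
      by simp
    also have "\<dots> = \<theta> * real ?d powr \<mu>"
      by (simp only: powr_add[symmetric]) simp
    finally have sum: "real (c - a) powr \<mu> + real (b - c) powr \<mu> \<le> \<theta> * real ?d powr \<mu>" .
    have "N a b \<le> N a c + N c b + C * real ?d powr \<mu>"
      using c less.prems by (intro split) auto
    also have "N a c \<le> L * real (c - a) powr \<mu>"
      using less.hyps[of c a] c less.prems by (simp add: L_def \<theta>_def)
    also have "N c b \<le> L * real (b - c) powr \<mu>"
      using less.hyps[of b c] c less.prems by (simp add: L_def \<theta>_def)
    also have "L * real (c - a) powr \<mu> + L * real (b - c) powr \<mu> + C * real ?d powr \<mu>
        \<le> L * (\<theta> * real ?d powr \<mu>) + C * real ?d powr \<mu>"
      using mult_left_mono[OF sum L(1)] by (simp add: distrib_left)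
    also have "\<dots> = (L * \<theta> + C) * real ?d powr \<mu>" by (simp add: algebra_simps)
    finally show ?thesis by (simp only: L(2)) (simp add: L_def \<theta>_def)
  qed
qed

lemma integrable_mult_of_squares:
  fixes X Y :: "'a \<Rightarrow> real"
  assumes [measurable]: "X \<in> borel_measurable M" "Y \<in> borel_measurable M"
    and "integrable M (\<lambda>\<omega>. (X \<omega>)\<^sup>2)" "integrable M (\<lambda>\<omega>. (Y \<omega>)\<^sup>2)"
  shows "integrable M (\<lambda>\<omega>. X \<omega> * Y \<omega>)"
proof (rule Bochner_Integration.integrable_bound)
  show "integrable M (\<lambda>\<omega>. (X \<omega>)\<^sup>2 + (Y \<omega>)\<^sup>2)" using assms by simp
  have "\<bar>a * b\<bar> \<le> a\<^sup>2 + b\<^sup>2" for a b :: real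
  proof -
    have "2 * (\<bar>a\<bar> * \<bar>b\<bar>) \<le> a\<^sup>2 + b\<^sup>2"
      using sum_squares_bound[of "\<bar>a\<bar>" "\<bar>b\<bar>"] by simp
    moreover have "0 \<le> \<bar>a\<bar> * \<bar>b\<bar>" by simp
    ultimately show ?thesis unfolding abs_mult by linarith
  qed
  then show "AE \<omega> in M. norm (X \<omega> * Y \<omega>) \<le> norm ((X \<omega>)\<^sup>2 + (Y \<omega>)\<^sup>2)" by simp
qed measurable

lemma integral_abs_mult_le:
  fixes X Y :: "'a \<Rightarrow> real"
  assumes meas: "X \<in> borel_measurable M" "Y \<in> borel_measurable M"
    and X: "integrable M (\<lambda>\<omega>. (X \<omega>)\<^sup>2)" "(\<integral>\<omega>. (X \<omega>)\<^sup>2 \<partial>M) \<le> A\<^sup>2"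
    and Y: "integrable M (\<lambda>\<omega>. (Y \<omega>)\<^sup>2)" "(\<integral>\<omega>. (Y \<omega>)\<^sup>2 \<partial>M) \<le> B\<^sup>2"
    and pos: "0 < A" "0 < B"
  shows "(\<integral>\<omega>. \<bar>X \<omega> * Y \<omega>\<bar> \<partial>M) \<le> A * B"
proof -
  have *: "\<bar>a * b\<bar> \<le> B / (2 * A) * a\<^sup>2 + A / (2 * B) * b\<^sup>2" for a b :: real
  proof -
    \<comment> \<open>Young's inequality, weighted so that both squares contribute equally.\<close>
    have "2 * (\<bar>a\<bar> / A) * (\<bar>b\<bar> / B) \<le> (\<bar>a\<bar> / A)\<^sup>2 + (\<bar>b\<bar> / B)\<^sup>2"
      by (rule sum_squares_bound)
    from mult_left_mono[OF this, of "A * B / 2"] pos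
    have "A * B / 2 * (2 * (\<bar>a\<bar> / A) * (\<bar>b\<bar> / B)) \<le> A * B / 2 * ((\<bar>a\<bar> / A)\<^sup>2 + (\<bar>b\<bar> / B)\<^sup>2)"
      by simp
    also have "A * B / 2 * (2 * (\<bar>a\<bar> / A) * (\<bar>b\<bar> / B)) = \<bar>a * b\<bar>"
      using pos by (simp add: abs_mult)
    also have "A * B / 2 * ((\<bar>a\<bar> / A)\<^sup>2 + (\<bar>b\<bar> / B)\<^sup>2) = B / (2 * A) * a\<^sup>2 + A / (2 * B) * b\<^sup>2"
      using pos by (simp add: power_divide distrib_left) (simp add: power2_eq_square)
    finally show ?thesis .
  qed
  have "(\<integral>\<omega>. \<bar>X \<omega> * Y \<omega>\<bar> \<partial>M) \<le> (\<integral>\<omega>. B / (2 * A) * (X \<omega>)\<^sup>2 + A / (2 * B) * (Y \<omega>)\<^sup>2 \<partial>M)"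
    using integrable_mult_of_squares[OF meas X(1) Y(1)] X Y *
    by (intro integral_mono) auto
  also have "\<dots> = B / (2 * A) * (\<integral>\<omega>. (X \<omega>)\<^sup>2 \<partial>M) + A / (2 * B) * (\<integral>\<omega>. (Y \<omega>)\<^sup>2 \<partial>M)"
    using X Y by simp
  also have "\<dots> \<le> B / (2 * A) * A\<^sup>2 + A / (2 * B) * B\<^sup>2"
    using X Y pos by (intro add_mono mult_left_mono) auto
  also have "\<dots> = A * B" using pos by (simp add: field_simps power2_eq_square)
  finally show ?thesis .
qed

section \<open>Controlled weights\<close>

text \<open>One scalar component of the weight as well. The remainders are bounded in mean square on events
  of probability close to one; this covers control in \<open>L_2\<close> and almost sure control alike.\<close>

locale controlled_sums = rough_sums M l \<tau> x h \<rho>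
  for M :: "'a measure" and l \<tau> and x :: "nat \<Rightarrow> real \<Rightarrow> real \<Rightarrow> 'a \<Rightarrow> 'd::finite list \<Rightarrow> real"
    and h \<rho> +
  fixes \<nu> \<alpha> K :: real and y :: "nat \<Rightarrow> real \<Rightarrow> 'a \<Rightarrow> 'd list \<Rightarrow> real"
  assumes \<nu>: "0 < \<nu>" and \<alpha>: "0 < \<alpha>" and K: "0 < K"
    and exponent: "1 < \<nu> * real l + \<alpha>"
    and y_meas: "k < l \<Longrightarrow> w \<in> words k \<Longrightarrow> t \<in> {0..1} \<Longrightarrow> (\<lambda>\<omega>. y k t \<omega> w) \<in> borel_measurable M"
    and y_cont: "k < l \<Longrightarrow> w \<in> words k \<Longrightarrow> \<omega> \<in> space M \<Longrightarrow> continuous_on {0..1} (\<lambda>t. y k t \<omega> w)"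
    and J_bound: "i < l \<Longrightarrow> w \<in> words i \<Longrightarrow> a < b \<Longrightarrow> b \<le> n \<Longrightarrow>
      integrable M (\<lambda>\<omega>. (J_rough n (x i) (h n) (gpt n a) (gpt n b) \<omega> w)\<^sup>2) \<and>
      (\<integral>\<omega>. (J_rough n (x i) (h n) (gpt n a) (gpt n b) \<omega> w)\<^sup>2 \<partial>M)
        \<le> (K * (real (b - a) / real n) powr (\<alpha> + \<nu> * real i))\<^sup>2"
    and remainder_bound: "0 < e \<Longrightarrow> \<exists>A\<in>events. \<exists>G>0. prob (space M - A) < e \<and>
      (\<forall>s t k. \<forall>w\<in>words k. 0 \<le> s \<longrightarrow> s \<le> t \<longrightarrow> t \<le> 1 \<longrightarrow> k < l \<longrightarrow>
        integrable M (\<lambda>\<omega>. (indicator A \<omega> * remainder l x y k s t \<omega> w)\<^sup>2) \<and>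
        (\<integral>\<omega>. (indicator A \<omega> * remainder l x y k s t \<omega> w)\<^sup>2 \<partial>M)
          \<le> (G * (t - s) powr (real (l - k) * \<nu>))\<^sup>2)"
begin

lemma Jx_bound:
  assumes "i < l" "w \<in> words i" "a < b" "b \<le> n"
  shows "integrable M (\<lambda>\<omega>. (Jx n i a b \<omega> w)\<^sup>2)"
    "(\<integral>\<omega>. (Jx n i a b \<omega> w)\<^sup>2 \<partial>M) \<le> (K * (real (b - a) / real n) powr (\<alpha> + \<nu> * real i))\<^sup>2"
proof -
  have "grid_index n (gpt n k) = k" for k
    using assms by (simp add: grid_index_def gpt_def)
  then have "J_rough n (x i) (h n) (gpt n a) (gpt n b) \<omega> w = Jx n i a b \<omega> w" for \<omega>
    using assms gpt_bounds by (simp add: J_rough_eq_Jx)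
  then show "integrable M (\<lambda>\<omega>. (Jx n i a b \<omega> w)\<^sup>2)"
    "(\<integral>\<omega>. (Jx n i a b \<omega> w)\<^sup>2 \<partial>M) \<le> (K * (real (b - a) / real n) powr (\<alpha> + \<nu> * real i))\<^sup>2"
    using J_bound[OF assms] by simp_all
qed

lemma dh_meas: "k < n \<Longrightarrow> dh n k \<in> borel_measurable M"
  using h_meas by (simp add: dh_def)

lemma dh_square_integrable:
  assumes "k < n"
  shows "integrable M (\<lambda>\<omega>. (dh n k \<omega>)\<^sup>2)"
proof -
  have "integrable M (\<lambda>\<omega>. (Jx n 0 k (Suc k) \<omega> [])\<^sup>2)"
    using assms \<tau>_less by (intro Jx_bound) auto
  then show ?thesis
    by (rule Bochner_Integration.integrable_cong[THEN iffD1, rotated 2]) (auto simp: Jx_def x_0)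
qed

abbreviation r :: "nat \<Rightarrow> real \<Rightarrow> real \<Rightarrow> 'a \<Rightarrow> 'd list \<Rightarrow> real" where
  "r \<equiv> remainder l x y"

lemma remainder_meas:
  assumes "k < l" "w \<in> words k" "0 \<le> s" "s \<le> t" "t \<le> 1"
  shows "(\<lambda>\<omega>. r k s t \<omega> w) \<in> borel_measurable M"
  using assms by (intro remainder_measurable[OF y_meas x_meas]) auto

lemma y_expansion:
  assumes "\<omega> \<in> space M" "j < l"
  shows "y j t \<omega> v = (\<Sum>q<l-j. \<Sum>u\<in>words q. x q s t \<omega> u * y (j + q) s \<omega> (u @ v)) + r j s t \<omega> v"
proof -
  have "{..<l-j} = insert 0 {1..l-1-j}" using assms(2) by auto
  then show ?thesis
    using assms by (simp add: remainder_def delta1_def partial_apply_def x_0)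
qed

text \<open>Expand \<open>y_t\<close> around \<open>s\<close> and around \<open>u\<close>. In the expansion around \<open>s\<close>, Chen's relation factors \<open>x_{st}\<close>
  through \<open>u\<close>; the coefficient of \<open>x^j_{ut}\<close> is then the expansion of \<open>y^{(j)}_u\<close> around \<open>s\<close> without
  its remainder. The two expansions therefore differ by the remainders \<open>r^{(j)}_{su}\<close> times \<open>x^j_{ut}\<close>.\<close>

lemma remainder_defect:
  assumes \<omega>: "\<omega> \<in> space M"
    and chen: "\<forall>k<l. \<forall>w\<in>words k. x k s t \<omega> w =
      (\<Sum>q\<le>k. x (k - q) s u \<omega> (take (k - q) w) * x q u t \<omega> (drop (k - q) w))"
  shows "r 0 s t \<omega> [] = r 0 u t \<omega> [] + (\<Sum>j<l. \<Sum>v\<in>words j. r j s u \<omega> v * x j u t \<omega> v)"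
proof -
  let ?F = "\<lambda>q j. \<Sum>a\<in>words q. \<Sum>v\<in>words j. x q s u \<omega> a * x j u t \<omega> v * y (j + q) s \<omega> (a @ v)"
  have "(\<Sum>w\<in>words i. x i s t \<omega> w * y i s \<omega> w) = (\<Sum>j\<le>i. ?F (i - j) j)" if "i < l" for i
  proof -
    have "(\<Sum>w\<in>words i. x i s t \<omega> w * y i s \<omega> w) = (\<Sum>w\<in>words i. \<Sum>j\<le>i.
        x (i - j) s u \<omega> (take (i - j) w) * x j u t \<omega> (drop (i - j) w) * y i s \<omega> w)"
      using chen that by (intro sum.cong refl) (simp add: sum_distrib_right)
    also have "\<dots> = (\<Sum>j\<le>i. \<Sum>w\<in>words i.
        x (i - j) s u \<omega> (take (i - j) w) * x j u t \<omega> (drop (i - j) w) * y i s \<omega> w)"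
      by (rule sum.swap)
    also have "\<dots> = (\<Sum>j\<le>i. ?F (i - j) j)"
    proof (rule sum.cong[OF refl])
      fix j assume "j \<in> {..i}"
      then show "(\<Sum>w\<in>words i. x (i - j) s u \<omega> (take (i - j) w) * x j u t \<omega> (drop (i - j) w) * y i s \<omega> w)
          = ?F (i - j) j"
        using sum_words_append[of "\<lambda>a v. x (i - j) s u \<omega> a * x j u t \<omega> v * y i s \<omega> (a @ v)" "i - j" j]
        by simp
    qed
    finally show ?thesis .
  qed
  then have "(\<Sum>i<l. \<Sum>w\<in>words i. x i s t \<omega> w * y i s \<omega> w) = (\<Sum>i<l. \<Sum>j\<le>i. ?F (i - j) j)"
    by simp
  also have "\<dots> = (\<Sum>j<l. \<Sum>q<l-j. ?F q j)"
    by (rule sum_triangle_swap)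
  also have "\<dots> = (\<Sum>j<l. \<Sum>v\<in>words j. x j u t \<omega> v *
      (\<Sum>q<l-j. \<Sum>a\<in>words q. x q s u \<omega> a * y (j + q) s \<omega> (a @ v)))"
  proof (intro sum.cong refl)
    fix j
    have "(\<Sum>q<l-j. ?F q j) = (\<Sum>q<l-j. \<Sum>v\<in>words j. \<Sum>a\<in>words q.
        x q s u \<omega> a * x j u t \<omega> v * y (j + q) s \<omega> (a @ v))"
      by (intro sum.cong refl sum.swap)
    also have "\<dots> = (\<Sum>v\<in>words j. \<Sum>q<l-j. \<Sum>a\<in>words q.
        x q s u \<omega> a * x j u t \<omega> v * y (j + q) s \<omega> (a @ v))"
      by (rule sum.swap)
    also have "\<dots> = (\<Sum>v\<in>words j. x j u t \<omega> v *
      (\<Sum>q<l-j. \<Sum>a\<in>words q. x q s u \<omega> a * y (j + q) s \<omega> (a @ v)))"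
      by (simp add: sum_distrib_left mult_ac)
    finally show "(\<Sum>q<l-j. ?F q j) = (\<Sum>v\<in>words j. x j u t \<omega> v *
      (\<Sum>q<l-j. \<Sum>a\<in>words q. x q s u \<omega> a * y (j + q) s \<omega> (a @ v)))" .
  qed
  also have "\<dots> = (\<Sum>j<l. \<Sum>v\<in>words j. x j u t \<omega> v * (y j u \<omega> v - r j s u \<omega> v))"
  proof (intro sum.cong refl)
    fix j and v :: "'d list" assume "j \<in> {..<l}"
    then have "(\<Sum>q<l-j. \<Sum>a\<in>words q. x q s u \<omega> a * y (j + q) s \<omega> (a @ v)) = y j u \<omega> v - r j s u \<omega> v"
      using y_expansion[OF \<omega>, of j u v s] by simp
    then show "x j u t \<omega> v * (\<Sum>q<l-j. \<Sum>a\<in>words q. x q s u \<omega> a * y (j + q) s \<omega> (a @ v))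
        = x j u t \<omega> v * (y j u \<omega> v - r j s u \<omega> v)" by simp
  qed
  finally have "(\<Sum>i<l. \<Sum>w\<in>words i. x i s t \<omega> w * y i s \<omega> w)
      = (\<Sum>j<l. \<Sum>v\<in>words j. x j u t \<omega> v * y j u \<omega> v) - (\<Sum>j<l. \<Sum>v\<in>words j. r j s u \<omega> v * x j u t \<omega> v)"
    by (simp add: right_diff_distrib sum_subtractf mult.commute)
  then show ?thesis
    using y_expansion[OF \<omega>, of 0 t "[]" s] y_expansion[OF \<omega>, of 0 t "[]" u] \<tau>_less by simp
qed

text \<open>The remainder integral \<open>J(r^{(0)}; h^n)\<close> over the cells from \<open>a\<close> to \<open>b\<close>.\<close>

definition R :: "nat \<Rightarrow> nat \<Rightarrow> nat \<Rightarrow> 'a \<Rightarrow> real" where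
  "R n a b \<omega> = (\<Sum>k\<in>{a..<b}. r 0 (gpt n a) (gpt n k) \<omega> [] * dh n k \<omega>)"

lemma R_meas: "b \<le> n \<Longrightarrow> R n a b \<in> borel_measurable M"
  unfolding R_def using gpt_bounds gpt_mono \<tau>_less
  by (auto intro!: borel_measurable_sum borel_measurable_times remainder_meas dh_meas)

lemma R_defect:
  assumes "b \<le> n"
  shows "AE \<omega> in M. \<forall>a c. a \<le> c \<longrightarrow> c \<le> b \<longrightarrow> R n a b \<omega> = R n a c \<omega> + R n c b \<omega>
    + (\<Sum>j<l. \<Sum>v\<in>words j. r j (gpt n a) (gpt n c) \<omega> v * Jx n j c b \<omega> v)"
  using chen_grid[of n] AE_space
proof eventually_elim
  case (elim \<omega>)
  show ?case
  proof (intro allI impI)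
    fix a c assume ac: "a \<le> c" "c \<le> b"
    have "R n a b \<omega> = R n a c \<omega> + (\<Sum>k\<in>{c..<b}. r 0 (gpt n a) (gpt n k) \<omega> [] * dh n k \<omega>)"
      unfolding R_def using ac by (simp add: sum.atLeastLessThan_concat)
    also have "(\<Sum>k\<in>{c..<b}. r 0 (gpt n a) (gpt n k) \<omega> [] * dh n k \<omega>)
      = (\<Sum>k\<in>{c..<b}. r 0 (gpt n c) (gpt n k) \<omega> [] * dh n k \<omega> + (\<Sum>j<l. \<Sum>v\<in>words j.
          r j (gpt n a) (gpt n c) \<omega> v * (x j (gpt n c) (gpt n k) \<omega> v * dh n k \<omega>)))"
    proof (rule sum.cong[OF refl])
      fix k assume "k \<in> {c..<b}"
      then have "r 0 (gpt n a) (gpt n k) \<omega> [] = r 0 (gpt n c) (gpt n k) \<omega> []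
          + (\<Sum>j<l. \<Sum>v\<in>words j. r j (gpt n a) (gpt n c) \<omega> v * x j (gpt n c) (gpt n k) \<omega> v)"
        using elim ac assms by (intro remainder_defect) auto
      then show "r 0 (gpt n a) (gpt n k) \<omega> [] * dh n k \<omega> = r 0 (gpt n c) (gpt n k) \<omega> [] * dh n k \<omega>
        + (\<Sum>j<l. \<Sum>v\<in>words j. r j (gpt n a) (gpt n c) \<omega> v * (x j (gpt n c) (gpt n k) \<omega> v * dh n k \<omega>))"
        by (simp add: distrib_right sum_distrib_right mult.assoc)
    qed
    also have "\<dots> = R n c b \<omega> + (\<Sum>k\<in>{c..<b}. \<Sum>j<l. \<Sum>v\<in>words j.
          r j (gpt n a) (gpt n c) \<omega> v * (x j (gpt n c) (gpt n k) \<omega> v * dh n k \<omega>))"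
      by (simp add: sum.distrib R_def)
    also have "(\<Sum>k\<in>{c..<b}. \<Sum>j<l. \<Sum>v\<in>words j.
          r j (gpt n a) (gpt n c) \<omega> v * (x j (gpt n c) (gpt n k) \<omega> v * dh n k \<omega>))
      = (\<Sum>j<l. \<Sum>k\<in>{c..<b}. \<Sum>v\<in>words j.
          r j (gpt n a) (gpt n c) \<omega> v * (x j (gpt n c) (gpt n k) \<omega> v * dh n k \<omega>))"
      by (rule sum.swap)
    also have "\<dots> = (\<Sum>j<l. \<Sum>v\<in>words j. r j (gpt n a) (gpt n c) \<omega> v * Jx n j c b \<omega> v)"
      unfolding Jx_def sum_distrib_left by (intro sum.cong refl sum.swap)
    finally show "R n a b \<omega> = R n a c \<omega> + R n c b \<omega>
      + (\<Sum>j<l. \<Sum>v\<in>words j. r j (gpt n a) (gpt n c) \<omega> v * Jx n j c b \<omega> v)"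
      by simp
  qed
qed

text \<open>In each term of the defect, the orders \<open>(l - j)\<nu>\<close> of \<open>r^{(j)}\<close> and \<open>\<alpha> + \<nu>j\<close> of \<open>J(x^j; h^n)\<close> add up
  to the same exponent \<open>\<mu> = \<nu>l + \<alpha> > 1\<close>, so sewing applies to the mean of \<open>\<bar>R\<bar>\<close> on the event \<open>A\<close>.\<close>

lemma R_bound:
  assumes [measurable]: "A \<in> events" and "0 < G"
    and bound: "\<forall>s t k. \<forall>w\<in>words k. 0 \<le> s \<longrightarrow> s \<le> t \<longrightarrow> t \<le> 1 \<longrightarrow> k < l \<longrightarrow>
        integrable M (\<lambda>\<omega>. (indicator A \<omega> * r k s t \<omega> w)\<^sup>2) \<and>
        (\<integral>\<omega>. (indicator A \<omega> * r k s t \<omega> w)\<^sup>2 \<partial>M) \<le> (G * (t - s) powr (real (l - k) * \<nu>))\<^sup>2"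
  obtains L where "0 \<le> L"
    "\<And>n a b. a \<le> b \<Longrightarrow> b \<le> n \<Longrightarrow> integrable M (\<lambda>\<omega>. indicator A \<omega> * R n a b \<omega>)"
    "\<And>n a b. a \<le> b \<Longrightarrow> b \<le> n \<Longrightarrow> (\<integral>\<omega>. \<bar>indicator A \<omega> * R n a b \<omega>\<bar> \<partial>M)
      \<le> L * (real (b - a) / real n) powr (\<nu> * real l + \<alpha>)"
proof -
  define \<mu> where "\<mu> = \<nu> * real l + \<alpha>"
  define C where "C = (\<Sum>j<l. \<Sum>v\<in>(words j :: 'd list set). G * K)"
  define L where "L = C / (1 - (2/3) powr (\<mu> - 1))"
  have \<mu>: "1 < \<mu>" using exponent by (simp add: \<mu>_def)
  have C: "0 \<le> C" unfolding C_def using \<open>0 < G\<close> K by (intro sum_nonneg) auto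
  have "(2/3) powr (\<mu> - 1) < (1::real)"
    using powr_less_mono2[of "\<mu> - 1" "2/3" 1] \<mu> by simp
  then have L: "0 \<le> L" using C by (simp add: L_def)
  have r_meas [measurable]: "(\<lambda>\<omega>. indicator A \<omega> * r k (gpt n a) (gpt n c) \<omega> w) \<in> borel_measurable M"
    if "k < l" "w \<in> words k" "a \<le> c" "c \<le> n" for k n a c w
    using that gpt_bounds gpt_mono by (intro borel_measurable_times remainder_meas) auto
  have r_int: "integrable M (\<lambda>\<omega>. (indicator A \<omega> * r k (gpt n a) (gpt n c) \<omega> w)\<^sup>2)"
    "(\<integral>\<omega>. (indicator A \<omega> * r k (gpt n a) (gpt n c) \<omega> w)\<^sup>2 \<partial>M)
      \<le> (G * (real (c - a) / real n) powr (real (l - k) * \<nu>))\<^sup>2"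
    if "k < l" "w \<in> words k" "a \<le> c" "c \<le> n" for k n a c w
    using bound[rule_format, OF that(2), of "gpt n a" "gpt n c"] that gpt_bounds gpt_mono gpt_diff
    by simp_all
  have int: "integrable M (\<lambda>\<omega>. indicator A \<omega> * R n a b \<omega>)" if "a \<le> b" "b \<le> n" for n a b
  proof -
    have "integrable M (\<lambda>\<omega>. \<Sum>k\<in>{a..<b}. indicator A \<omega> * r 0 (gpt n a) (gpt n k) \<omega> [] * dh n k \<omega>)"
      using that \<tau>_less
      by (intro Bochner_Integration.integrable_sum integrable_mult_of_squares r_meas r_int
          dh_meas dh_square_integrable) auto
    then show ?thesis by (simp add: R_def sum_distrib_left mult.assoc)
  qed
  have "(\<integral>\<omega>. \<bar>indicator A \<omega> * R n a b \<omega>\<bar> \<partial>M) \<le> L * (real (b - a) / real n) powr \<mu>"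
    if "a \<le> b" "b \<le> n" for n a b
  proof (cases "a = b")
    case True
    then show ?thesis using L by (simp add: R_def)
  next
    case False
    define N where "N a b = (\<integral>\<omega>. \<bar>indicator A \<omega> * R n a b \<omega>\<bar> \<partial>M)" for a b
    have n: "0 < n" using that False by simp
    have "N a b \<le> C * (1 / real n) powr \<mu> / (1 - (2/3) powr (\<mu> - 1)) * real (b - a) powr \<mu>"
    proof (rule midpoint_sewing[where n = n])
      show "1 < \<mu>" "0 \<le> C * (1 / real n) powr \<mu>" "a < b" "b \<le> n"
        using \<mu> C that False by auto
    next
      \<comment> \<open>Over a single cell only \<open>r^{(0)}\<close> at coinciding times occurs, which is almost surely zero.\<close>
      fix a assume "a < n"
      have "(\<integral>\<omega>. (indicator A \<omega> * r 0 (gpt n a) (gpt n a) \<omega> [])\<^sup>2 \<partial>M) \<le> 0"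
        using r_int(2)[of 0 "[]" a a n] \<tau>_less \<open>a < n\<close> by simp
      then have "(\<integral>\<omega>. (indicator A \<omega> * r 0 (gpt n a) (gpt n a) \<omega> [])\<^sup>2 \<partial>M) = 0"
        by (intro antisym integral_nonneg) auto
      then have "AE \<omega> in M. (indicator A \<omega> * r 0 (gpt n a) (gpt n a) \<omega> [])\<^sup>2 = 0"
        using r_int(1)[of 0 "[]" a a n] \<tau>_less \<open>a < n\<close>
        by (subst (asm) integral_nonneg_eq_0_iff_AE) auto
      then have "AE \<omega> in M. \<bar>indicator A \<omega> * R n a (Suc a) \<omega>\<bar> = 0"
        by eventually_elim (auto simp: R_def)
      then have "N a (Suc a) = 0"
        unfolding N_def by (rule integral_eq_zero_AE)
      then show "N a (Suc a) \<le> 0" by simp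
    next
      fix a c b assume acb: "a < c" "c < b" "b \<le> n"
      define D where "D = (\<lambda>\<omega>. \<Sum>j<l. \<Sum>v\<in>words j.
        \<bar>indicator A \<omega> * r j (gpt n a) (gpt n c) \<omega> v * Jx n j c b \<omega> v\<bar>)"
      have D_int: "integrable M (\<lambda>\<omega>. \<bar>indicator A \<omega> * r j (gpt n a) (gpt n c) \<omega> v * Jx n j c b \<omega> v\<bar>)"
        if "j < l" "v \<in> words j" for j v
        using acb that
        by (intro integrable_abs integrable_mult_of_squares r_meas r_int Jx_meas Jx_bound) auto
      have "(\<integral>\<omega>. D \<omega> \<partial>M) = (\<Sum>j<l. \<Sum>v\<in>words j.
          \<integral>\<omega>. \<bar>indicator A \<omega> * r j (gpt n a) (gpt n c) \<omega> v * Jx n j c b \<omega> v\<bar> \<partial>M)"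
        unfolding D_def
        by (subst Bochner_Integration.integral_sum)
          (auto intro!: Bochner_Integration.integrable_sum Bochner_Integration.integral_sum sum.cong D_int
            simp: lessThan_iff)
      also have "\<dots> \<le> (\<Sum>j<l. \<Sum>v\<in>(words j :: 'd list set). G * K * (real (b - a) / real n) powr \<mu>)"
      proof (intro sum_mono)
        fix j and v :: "'d list" assume jv: "j \<in> {..<l}" "v \<in> words j"
        let ?p = "real (l - j) * \<nu>" and ?q = "\<alpha> + \<nu> * real j"
        have "(\<integral>\<omega>. \<bar>indicator A \<omega> * r j (gpt n a) (gpt n c) \<omega> v * Jx n j c b \<omega> v\<bar> \<partial>M)
          \<le> (G * (real (c - a) / real n) powr ?p) * (K * (real (b - c) / real n) powr ?q)"
          using acb jv \<open>0 < G\<close> K n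
          by (intro integral_abs_mult_le r_meas r_int Jx_meas Jx_bound) auto
        also have "\<dots> \<le> (G * (real (b - a) / real n) powr ?p) * (K * (real (b - a) / real n) powr ?q)"
          using acb \<open>0 < G\<close> K \<nu> \<alpha>
          by (intro mult_mono mult_left_mono powr_mono2 divide_right_mono) auto
        also have "\<dots> = G * K * ((real (b - a) / real n) powr (?p + ?q))"
          by (simp add: powr_add)
        also have "?p + ?q = \<mu>"
          using jv by (simp add: \<mu>_def of_nat_diff algebra_simps)
        finally show "(\<integral>\<omega>. \<bar>indicator A \<omega> * r j (gpt n a) (gpt n c) \<omega> v * Jx n j c b \<omega> v\<bar> \<partial>M)
          \<le> G * K * (real (b - a) / real n) powr \<mu>" .
      qed
      also have "\<dots> = C * (1 / real n) powr \<mu> * real (b - a) powr \<mu>"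
      proof -
        have "(real (b - a) / real n) powr \<mu> = (1 / real n) powr \<mu> * real (b - a) powr \<mu>"
          by (simp add: powr_divide)
        then show ?thesis by (simp only: C_def sum_distrib_right mult.assoc)
      qed
      finally have D: "(\<integral>\<omega>. D \<omega> \<partial>M) \<le> C * (1 / real n) powr \<mu> * real (b - a) powr \<mu>" .
      have "integrable M D"
        unfolding D_def using D_int by (intro Bochner_Integration.integrable_sum) auto
      have "N a b \<le> (\<integral>\<omega>. \<bar>indicator A \<omega> * R n a c \<omega>\<bar> + \<bar>indicator A \<omega> * R n c b \<omega>\<bar> + D \<omega> \<partial>M)"
        unfolding N_def
      proof (rule integral_mono_AE)
        show "integrable M (\<lambda>\<omega>. \<bar>indicator A \<omega> * R n a b \<omega>\<bar>)"
          using int acb by (intro integrable_abs) auto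
        show "integrable M (\<lambda>\<omega>. \<bar>indicator A \<omega> * R n a c \<omega>\<bar> + \<bar>indicator A \<omega> * R n c b \<omega>\<bar> + D \<omega>)"
          using int acb \<open>integrable M D\<close> by (intro Bochner_Integration.integrable_add integrable_abs) auto
        show "AE \<omega> in M. \<bar>indicator A \<omega> * R n a b \<omega>\<bar>
            \<le> \<bar>indicator A \<omega> * R n a c \<omega>\<bar> + \<bar>indicator A \<omega> * R n c b \<omega>\<bar> + D \<omega>"
          using R_defect[OF acb(3)]
        proof eventually_elim
          case (elim \<omega>)
          have "indicator A \<omega> * R n a b \<omega> = indicator A \<omega> * R n a c \<omega> + indicator A \<omega> * R n c b \<omega>
            + (\<Sum>j<l. \<Sum>v\<in>words j. indicator A \<omega> * r j (gpt n a) (gpt n c) \<omega> v * Jx n j c b \<omega> v)"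
          proof -
            have "R n a b \<omega> = R n a c \<omega> + R n c b \<omega>
                + (\<Sum>j<l. \<Sum>v\<in>words j. r j (gpt n a) (gpt n c) \<omega> v * Jx n j c b \<omega> v)"
              using elim acb by simp
            then show ?thesis by (simp only: distrib_left sum_distrib_left mult.assoc)
          qed
          moreover have "\<bar>\<Sum>j<l. \<Sum>v\<in>words j. indicator A \<omega> * r j (gpt n a) (gpt n c) \<omega> v * Jx n j c b \<omega> v\<bar> \<le> D \<omega>"
            unfolding D_def by (intro order_trans[OF sum_abs] sum_mono sum_abs)
          ultimately show ?case by linarith
        qed
      qed
      also have "\<dots> = N a c + N c b + (\<integral>\<omega>. D \<omega> \<partial>M)"
        unfolding N_def using int acb \<open>integrable M D\<close> by simp
      finally show "N a b \<le> N a c + N c b + C * (1 / real n) powr \<mu> * real (b - a) powr \<mu>"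
        using D by simp
    qed
    then show ?thesis
      by (simp add: N_def L_def powr_divide mult_ac)
  qed
  with L int show ?thesis
    by (intro that[of L]) (auto simp: \<mu>_def)
qed

text \<open>There are \<open>m\<close> blocks, each of mean at most of order \<open>(1/m + 1/n)^\<mu>\<close>, and \<open>m m^{-\<mu>}\<close> tends to
  zero. The term \<open>1/n\<close> comes from rounding the endpoints of a block to the grid.\<close>

lemma R_blocks_vanish:
  assumes st: "0 \<le> s" "s < t" "t \<le> 1"
  shows "vanishes_iterated (\<lambda>m n \<omega>. \<Sum>j<m.
    R n (grid_index n (uniform_node s t m j)) (grid_index n (uniform_node s t m (Suc j))) \<omega>)"
  unfolding vanishes_iterated_def
proof (intro allI impI)
  fix \<eta> e :: real assume "0 < \<eta>" "0 < e"
  let ?p = "\<lambda>m n j. grid_index n (uniform_node s t m j)"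
  let ?E = "\<lambda>m n \<omega>. \<Sum>j<m. R n (?p m n j) (?p m n (Suc j)) \<omega>"
  define \<mu> where "\<mu> = \<nu> * real l + \<alpha>"
  have \<mu>: "1 < \<mu>" using exponent by (simp add: \<mu>_def)
  from remainder_bound[OF half_gt_zero[OF \<open>0 < e\<close>]] obtain A G where
    A [measurable]: "A \<in> events" and "0 < G" and A_prob: "prob (space M - A) < e / 2"
    and A_bound: "\<forall>s t k. \<forall>w\<in>words k. 0 \<le> s \<longrightarrow> s \<le> t \<longrightarrow> t \<le> 1 \<longrightarrow> k < l \<longrightarrow>
        integrable M (\<lambda>\<omega>. (indicator A \<omega> * r k s t \<omega> w)\<^sup>2) \<and>
        (\<integral>\<omega>. (indicator A \<omega> * r k s t \<omega> w)\<^sup>2 \<partial>M) \<le> (G * (t - s) powr (real (l - k) * \<nu>))\<^sup>2"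
    by blast
  from R_bound[OF A \<open>0 < G\<close> A_bound] obtain L where L: "0 \<le> L"
    and int: "\<And>n a b. a \<le> b \<Longrightarrow> b \<le> n \<Longrightarrow> integrable M (\<lambda>\<omega>. indicator A \<omega> * R n a b \<omega>)"
    and bound: "\<And>n a b. a \<le> b \<Longrightarrow> b \<le> n \<Longrightarrow> (\<integral>\<omega>. \<bar>indicator A \<omega> * R n a b \<omega>\<bar> \<partial>M)
      \<le> L * (real (b - a) / real n) powr \<mu>"
    unfolding \<mu>_def by blast
  have p: "?p m n j \<le> ?p m n (Suc j)" "?p m n (Suc j) \<le> n" if "j < m" for m n j
    using that st uniform_node_bounds[of s t m "Suc j"]
    by (auto intro!: grid_index_mono uniform_node_mono grid_index_le)
  have "(\<lambda>m. L * 2 powr \<mu> * real m powr (1 - \<mu>)) \<longlonglongrightarrow> 0"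
  proof -
    have "((\<lambda>m. real m powr (1 - \<mu>)) \<longlongrightarrow> 0) sequentially"
      using \<mu> by (intro tendsto_neg_powr filterlim_real_sequentially) auto
    from tendsto_mult_right_zero[OF this] show ?thesis .
  qed
  then have "\<forall>\<^sub>F m in sequentially. L * 2 powr \<mu> * real m powr (1 - \<mu>) < \<eta> * (e / 2)"
    using \<open>0 < \<eta>\<close> \<open>0 < e\<close> by (intro order_tendstoD) auto
  then show "\<forall>\<^sub>F m in sequentially. \<forall>\<^sub>F n in sequentially. prob {\<omega> \<in> space M. \<bar>?E m n \<omega>\<bar> > \<eta>} < e"
    using eventually_gt_at_top[of 0]
  proof eventually_elim
    case (elim m)
    show ?case
      \<comment> \<open>For \<open>n \<ge> m\<close> the rounded blocks have length at most \<open>2/m\<close>.\<close>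
      using eventually_ge_at_top[of m]
    proof eventually_elim
      fix n assume "m \<le> n"
      then have n: "0 < n" using elim by simp
      have meas [measurable]: "?E m n \<in> borel_measurable M"
        using p by (intro borel_measurable_sum R_meas) auto
      have gap: "real (?p m n (Suc j) - ?p m n j) / real n \<le> 2 / real m" if "j < m" for j
      proof -
        have "0 \<le> uniform_node s t m j" "0 \<le> uniform_node s t m (Suc j)"
          using uniform_node_bounds[of s t m j] uniform_node_bounds[of s t m "Suc j"] that st by auto
        then have "gpt n (?p m n (Suc j)) - gpt n (?p m n j) \<le> uniform_node s t m (Suc j) - uniform_node s t m j + 1 / real n"
          using gpt_grid_index_bounds[OF n, of "uniform_node s t m j"]
            gpt_grid_index_bounds[OF n, of "uniform_node s t m (Suc j)"] by linarith
        also have "uniform_node s t m (Suc j) - uniform_node s t m j \<le> 1 / real m"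
          using uniform_node_diff[of m s t j] st elim by (simp add: divide_right_mono)
        also have "1 / real n \<le> 1 / real m"
          using \<open>m \<le> n\<close> elim by (simp add: frac_le)
        finally show ?thesis
          using p[OF that, of n] by (simp add: gpt_diff)
      qed
      have "(\<integral>\<omega>. \<bar>indicator A \<omega> * ?E m n \<omega>\<bar> \<partial>M)
          \<le> (\<integral>\<omega>. (\<Sum>j<m. \<bar>indicator A \<omega> * R n (?p m n j) (?p m n (Suc j)) \<omega>\<bar>) \<partial>M)"
        unfolding sum_distrib_left using int p
        by (intro integral_mono integrable_abs Bochner_Integration.integrable_sum sum_abs) auto
      also have "\<dots> = (\<Sum>j<m. \<integral>\<omega>. \<bar>indicator A \<omega> * R n (?p m n j) (?p m n (Suc j)) \<omega>\<bar> \<partial>M)"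
        using int p by (intro Bochner_Integration.integral_sum integrable_abs) auto
      also have "\<dots> \<le> (\<Sum>j<m. L * (2 / real m) powr \<mu>)"
      proof (rule sum_mono)
        fix j assume j: "j \<in> {..<m}"
        then have "(\<integral>\<omega>. \<bar>indicator A \<omega> * R n (?p m n j) (?p m n (Suc j)) \<omega>\<bar> \<partial>M)
          \<le> L * (real (?p m n (Suc j) - ?p m n j) / real n) powr \<mu>"
          using p by (intro bound) auto
        also have "\<dots> \<le> L * (2 / real m) powr \<mu>"
          using gap[of j] j \<mu> L by (intro mult_left_mono powr_mono2) auto
        finally show "(\<integral>\<omega>. \<bar>indicator A \<omega> * R n (?p m n j) (?p m n (Suc j)) \<omega>\<bar> \<partial>M)
          \<le> L * (2 / real m) powr \<mu>" .
      qed
      also have "\<dots> = L * 2 powr \<mu> * real m powr (1 - \<mu>)"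
        using elim by (simp add: powr_divide powr_diff)
      also have "\<dots> < \<eta> * (e / 2)" using elim by simp
      finally have small: "(\<integral>\<omega>. \<bar>indicator A \<omega> * ?E m n \<omega>\<bar> \<partial>M) / \<eta> < e / 2"
        using \<open>0 < \<eta>\<close> by (simp add: field_simps)
      have intE: "integrable M (\<lambda>\<omega>. \<bar>indicator A \<omega> * ?E m n \<omega>\<bar>)"
        unfolding sum_distrib_left using int p
        by (intro integrable_abs Bochner_Integration.integrable_sum) auto
      have "prob {\<omega> \<in> space M. \<bar>?E m n \<omega>\<bar> > \<eta>}
          \<le> prob ((space M - A) \<union> {\<omega> \<in> space M. \<bar>indicator A \<omega> * ?E m n \<omega>\<bar> \<ge> \<eta>})"
        by (intro finite_measure_mono) (auto simp: indicator_def)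
      also have "\<dots> \<le> prob (space M - A) + prob {\<omega> \<in> space M. \<bar>indicator A \<omega> * ?E m n \<omega>\<bar> \<ge> \<eta>}"
        by (rule measure_Un_le) measurable
      also have "prob {\<omega> \<in> space M. \<bar>indicator A \<omega> * ?E m n \<omega>\<bar> \<ge> \<eta>}
          \<le> (\<integral>\<omega>. \<bar>indicator A \<omega> * ?E m n \<omega>\<bar> \<partial>M) / \<eta>"
        using intE \<open>0 < \<eta>\<close> by (intro integral_Markov_inequality_measure[where A = "space M"]) auto
      finally show "prob {\<omega> \<in> space M. \<bar>?E m n \<omega>\<bar> > \<eta>} < e"
        using small A_prob by linarith
    qed
  qed
qed

definition Jy :: "nat \<Rightarrow> real \<Rightarrow> real \<Rightarrow> 'a \<Rightarrow> real" where
  "Jy n s t \<omega> = (\<Sum>k\<in>cells n s t. y 0 (gpt n k) \<omega> [] * h n (gpt n k) (gpt n (Suc k)) \<omega>)"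

lemma Jy_eq: "0 \<le> s \<Longrightarrow> t \<le> 1 \<Longrightarrow>
    Jy n s t \<omega> = (\<Sum>k\<in>{grid_index n s..<grid_index n t}. y 0 (gpt n k) \<omega> [] * dh n k \<omega>)"
  by (simp add: Jy_def dh_def cells_eq)

lemma y_block:
  assumes "\<omega> \<in> space M"
  shows "(\<Sum>k\<in>{a..<b}. y 0 (gpt n k) \<omega> [] * dh n k \<omega>) =
    (\<Sum>q<l. \<Sum>u\<in>words q. y q (gpt n a) \<omega> u * Jx n q a b \<omega> u) + R n a b \<omega>"
proof -
  have "(\<Sum>k\<in>{a..<b}. y 0 (gpt n k) \<omega> [] * dh n k \<omega>) = (\<Sum>k\<in>{a..<b}. (\<Sum>q<l. \<Sum>u\<in>words q.
      y q (gpt n a) \<omega> u * (x q (gpt n a) (gpt n k) \<omega> u * dh n k \<omega>)) + r 0 (gpt n a) (gpt n k) \<omega> [] * dh n k \<omega>)"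
  proof (rule sum.cong[OF refl])
    fix k
    show "y 0 (gpt n k) \<omega> [] * dh n k \<omega> = (\<Sum>q<l. \<Sum>u\<in>words q.
      y q (gpt n a) \<omega> u * (x q (gpt n a) (gpt n k) \<omega> u * dh n k \<omega>)) + r 0 (gpt n a) (gpt n k) \<omega> [] * dh n k \<omega>"
    proof -
      have "y 0 (gpt n k) \<omega> [] = (\<Sum>q<l. \<Sum>u\<in>words q. y q (gpt n a) \<omega> u * x q (gpt n a) (gpt n k) \<omega> u)
          + r 0 (gpt n a) (gpt n k) \<omega> []"
        using y_expansion[OF assms, of 0 "gpt n k" "[]" "gpt n a"] \<tau>_less by (simp add: mult.commute)
      then show ?thesis by (simp add: distrib_right sum_distrib_right mult.assoc)
    qed
  qed
  also have "\<dots> = (\<Sum>k\<in>{a..<b}. \<Sum>q<l. \<Sum>u\<in>words q.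
      y q (gpt n a) \<omega> u * (x q (gpt n a) (gpt n k) \<omega> u * dh n k \<omega>)) + R n a b \<omega>"
    by (simp add: sum.distrib R_def)
  also have "(\<Sum>k\<in>{a..<b}. \<Sum>q<l. \<Sum>u\<in>words q.
      y q (gpt n a) \<omega> u * (x q (gpt n a) (gpt n k) \<omega> u * dh n k \<omega>))
    = (\<Sum>q<l. \<Sum>k\<in>{a..<b}. \<Sum>u\<in>words q.
      y q (gpt n a) \<omega> u * (x q (gpt n a) (gpt n k) \<omega> u * dh n k \<omega>))"
    by (rule sum.swap)
  also have "\<dots> = (\<Sum>q<l. \<Sum>u\<in>words q. y q (gpt n a) \<omega> u * Jx n q a b \<omega> u)"
    unfolding Jx_def sum_distrib_left by (intro sum.cong refl sum.swap)
  finally show ?thesis .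
qed

text \<open>As for \<open>J_rough_limit\<close>, with the controlled expansion of \<open>y\<close> in place of Chen's relation and sewing in
  place of the hypothesis on sums over partitions.\<close>

lemma Jy_limit:
  assumes "0 \<le> s" "s \<le> t" "t \<le> 1"
  shows "vanishes (\<lambda>n \<omega>. Jy n s t \<omega> - (\<Sum>v\<in>words \<tau>. integral {s..t} (\<lambda>u. y \<tau> u \<omega> v) * \<rho> v))"
proof (cases "s = t")
  case True
  then show ?thesis using assms by (simp add: Jy_eq vanishes_zero)
next
  case False
  then have st: "0 \<le> s" "s < t" "t \<le> 1" using assms by auto
  let ?I = "SIGMA q:{..<l}. (words q :: 'd list set)"
  let ?E = "\<lambda>m n \<omega>. \<Sum>j<m. R n (grid_index n (uniform_node s t m j)) (grid_index n (uniform_node s t m (Suc j))) \<omega>"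
  have p: "grid_index n (uniform_node s t m (Suc j)) \<le> n" if "j < m" for m n j
    using that st uniform_node_bounds[of s t m "Suc j"] by (intro grid_index_le) auto
  have gb: "gpt n (grid_index n u) \<in> {0..1}" if "u \<le> 1" for u n
    using that gpt_bounds grid_index_le by auto
  have ub: "0 \<le> uniform_node s t m j" "uniform_node s t m j \<le> 1" if "0 < m" "j \<le> m" for m j
    using uniform_node_bounds[of s t m j] that st by auto
  have Jy_meas: "Jy n s t \<in> borel_measurable M" for n
    using grid_index_le[OF st(3), of n] \<tau>_less gpt_bounds st
    by (subst measurable_cong[OF Jy_eq]) (auto intro!: borel_measurable_sum borel_measurable_times y_meas dh_meas)
  have "vanishes (\<lambda>n \<omega>. Jy n s t \<omega> - integral {s..t} (\<lambda>u. \<Sum>i\<in>?I.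
      y (fst i) u \<omega> (snd i) * kernel (fst i) (snd i) u u \<omega>))"
  proof (rule weighted_increments_limit[where E = ?E
        and \<Psi> = "\<lambda>n i a b \<omega>. J_rough n (x (fst i)) (h n) a b \<omega> (snd i)"
        and \<kappa> = "\<lambda>i. kernel (fst i) (snd i)" and g = "\<lambda>i u \<omega>. y (fst i) u \<omega> (snd i)"
        and c = "\<lambda>n i u \<omega>. y (fst i) (gpt n (grid_index n u)) \<omega> (snd i)"])
    fix i assume "i \<in> ?I"
    then have i: "fst i < l" "snd i \<in> words (fst i)" by auto
    show "(\<lambda>\<omega>. y (fst i) u \<omega> (snd i)) \<in> borel_measurable M" if "u \<in> {s..t}" for u
      using i that st by (intro y_meas) auto
    show "(\<lambda>\<omega>. y (fst i) (gpt n (grid_index n u)) \<omega> (snd i)) \<in> borel_measurable M"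
      if "u \<in> {s..t}" for u n
      using i that st by (intro y_meas gb) auto
    show "kernel (fst i) (snd i) a u \<in> borel_measurable M" if "s \<le> a" "a \<le> u" "u \<le> t" for a u
      using i that st by (intro kernel_meas) auto
    show "vanishes (\<lambda>n \<omega>. J_rough n (x (fst i)) (h n) a b \<omega> (snd i)
        - integral {a..b} (\<lambda>u. kernel (fst i) (snd i) a u \<omega>))" if "s \<le> a" "a < b" "b \<le> t" for a b
      using i that st by (intro J_rough_limit) auto
    fix \<omega> assume \<omega>: "\<omega> \<in> space M"
    note yc = y_cont[OF i \<omega>]
    show "continuous_on {s..t} (\<lambda>u. y (fst i) u \<omega> (snd i))"
      by (rule continuous_on_subset[OF yc]) (use st in auto)
    show "(\<lambda>n. y (fst i) (gpt n (grid_index n u)) \<omega> (snd i)) \<longlonglongrightarrow> y (fst i) u \<omega> (snd i)"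
      if "u \<in> {s..t}" for u
      using that st gb by (intro continuous_on_tendsto_compose[OF yc gpt_grid_index_tendsto]) auto
    show "continuous_on {(a, u). s \<le> a \<and> a \<le> u \<and> u \<le> t} (\<lambda>(a, u). kernel (fst i) (snd i) a u \<omega>)"
      using st i \<omega> by (intro kernel_cont) auto
  next
    show "s < t" by fact
    show "Jy n s t \<in> borel_measurable M" for n by fact
    show "?E m n \<in> borel_measurable M" for m n
      using p by (intro borel_measurable_sum R_meas) auto
    show "vanishes_iterated ?E" by (rule R_blocks_vanish[OF st])
  next
    fix m :: nat assume m: "m > 0"
    show "\<forall>\<^sub>F n in sequentially. AE \<omega> in M. Jy n s t \<omega> = (\<Sum>j<m. \<Sum>i\<in>?I.
        y (fst i) (gpt n (grid_index n (uniform_node s t m j))) \<omega> (snd i)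
        * J_rough n (x (fst i)) (h n) (uniform_node s t m j) (uniform_node s t m (Suc j)) \<omega> (snd i)) + ?E m n \<omega>"
    proof (rule always_eventually, rule allI, rule AE_I2)
      fix n \<omega> assume \<omega>: "\<omega> \<in> space M"
      let ?p = "\<lambda>j. grid_index n (uniform_node s t m j)"
      have "Jy n s t \<omega> = (\<Sum>k\<in>{?p 0..<?p m}. y 0 (gpt n k) \<omega> [] * dh n k \<omega>)"
        using st m by (simp add: Jy_eq)
      also have "\<dots> = (\<Sum>j<m. \<Sum>k\<in>{?p j..<?p (Suc j)}. y 0 (gpt n k) \<omega> [] * dh n k \<omega>)"
        using st by (intro sum_consecutive_blocks[symmetric] grid_index_mono uniform_node_mono) auto
      also have "\<dots> = (\<Sum>j<m. \<Sum>q<l. \<Sum>u\<in>words q. y q (gpt n (?p j)) \<omega> u * Jx n q (?p j) (?p (Suc j)) \<omega> u)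
          + ?E m n \<omega>"
        by (simp add: y_block[OF \<omega>] sum.distrib)
      also have "(\<Sum>j<m. \<Sum>q<l. \<Sum>u\<in>words q. y q (gpt n (?p j)) \<omega> u * Jx n q (?p j) (?p (Suc j)) \<omega> u)
        = (\<Sum>j<m. \<Sum>i\<in>?I. y (fst i) (gpt n (?p j)) \<omega> (snd i)
          * J_rough n (x (fst i)) (h n) (uniform_node s t m j) (uniform_node s t m (Suc j)) \<omega> (snd i))"
        using ub by (intro sum.cong refl) (simp add: J_rough_eq_Jx sum.Sigma case_prod_beta)
      finally show "Jy n s t \<omega> = (\<Sum>j<m. \<Sum>i\<in>?I.
        y (fst i) (gpt n (grid_index n (uniform_node s t m j))) \<omega> (snd i)
        * J_rough n (x (fst i)) (h n) (uniform_node s t m j) (uniform_node s t m (Suc j)) \<omega> (snd i)) + ?E m n \<omega>" .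
    qed
  qed
  then show ?thesis
  proof (rule vanishes_cong)
    show "\<forall>\<^sub>F n in sequentially. AE \<omega> in M.
        Jy n s t \<omega> - (\<Sum>v\<in>words \<tau>. integral {s..t} (\<lambda>u. y \<tau> u \<omega> v) * \<rho> v)
      = Jy n s t \<omega> - integral {s..t} (\<lambda>u. \<Sum>i\<in>?I. y (fst i) u \<omega> (snd i) * kernel (fst i) (snd i) u u \<omega>)"
    proof (rule always_eventually, rule allI, rule AE_mp[OF kernel_diagonal], rule AE_I2, rule impI)
      fix n \<omega> assume \<omega>: "\<omega> \<in> space M"
        and diag: "\<forall>u\<in>{0..1}. \<forall>i<l. \<forall>w\<in>words i. kernel i w u u \<omega> = (if i = \<tau> then \<rho> w else 0)"
      have "(\<Sum>i\<in>?I. y (fst i) u \<omega> (snd i) * kernel (fst i) (snd i) u u \<omega>) = (\<Sum>v\<in>words \<tau>. y \<tau> u \<omega> v * \<rho> v)"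
        if u: "u \<in> {s..t}" for u
      proof -
        have "(\<Sum>i\<in>?I. y (fst i) u \<omega> (snd i) * kernel (fst i) (snd i) u u \<omega>)
            = (\<Sum>q<l. \<Sum>v\<in>words q. y q u \<omega> v * kernel q v u u \<omega>)"
          by (simp add: sum.Sigma case_prod_beta)
        also have "\<dots> = (\<Sum>q<l. if q = \<tau> then \<Sum>v\<in>words \<tau>. y \<tau> u \<omega> v * \<rho> v else 0)"
          using u st diag by (intro sum.cong refl) auto
        also have "\<dots> = (\<Sum>v\<in>words \<tau>. y \<tau> u \<omega> v * \<rho> v)"
          using \<tau>_less by simp
        finally show ?thesis .
      qed
      then have "integral {s..t} (\<lambda>u. \<Sum>i\<in>?I. y (fst i) u \<omega> (snd i) * kernel (fst i) (snd i) u u \<omega>)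
          = integral {s..t} (\<lambda>u. \<Sum>v\<in>words \<tau>. y \<tau> u \<omega> v * \<rho> v)"
        by (rule integral_cong)
      also have "\<dots> = (\<Sum>v\<in>words \<tau>. integral {s..t} (\<lambda>u. y \<tau> u \<omega> v * \<rho> v))"
        using st \<omega> \<tau>_less
        by (intro Henstock_Kurzweil_Integration.integral_sum integrable_continuous_interval
            continuous_on_mult continuous_on_const continuous_on_subset[OF y_cont]) auto
      finally show "Jy n s t \<omega> - (\<Sum>v\<in>words \<tau>. integral {s..t} (\<lambda>u. y \<tau> u \<omega> v) * \<rho> v)
        = Jy n s t \<omega> - integral {s..t} (\<lambda>u. \<Sum>i\<in>?I. y (fst i) u \<omega> (snd i) * kernel (fst i) (snd i) u u \<omega>)"
        by simp
    qed
    show "(\<lambda>\<omega>. Jy n s t \<omega> - (\<Sum>v\<in>words \<tau>. integral {s..t} (\<lambda>u. y \<tau> u \<omega> v) * \<rho> v))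
        \<in> borel_measurable M" for n
      using st \<tau>_less
      by (intro borel_measurable_diff Jy_meas borel_measurable_sum borel_measurable_times
          borel_measurable_integral_continuous y_meas continuous_on_subset[OF y_cont]) auto
  qed
qed

end

section \<open>Reduction to scalar components\<close>

lemma J_rough_component:
  "J_rough n xi (\<lambda>s t \<omega>. h s t \<omega> \<bullet> c) s t \<omega> w = J_rough n xi h s t \<omega> w \<bullet> c"
  by (simp add: J_rough_def inner_sum_left)

lemma remainder_component:
  "remainder l x (\<lambda>k t \<omega> w. y k t \<omega> w \<bullet> b) k s t \<omega> w = remainder l x y k s t \<omega> w \<bullet> b"
  by (simp add: remainder_def delta1_def partial_apply_def inner_diff_left inner_sum_left)

lemma component_le_tensor_norm:
  fixes A :: "'d::finite list \<Rightarrow> 'a::euclidean_space"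
  assumes "w \<in> words k" "b \<in> Basis"
  shows "\<bar>A w \<bullet> b\<bar> \<le> tensor_norm k A"
proof -
  have "\<bar>A w \<bullet> b\<bar> \<le> norm (A w)" using assms(2) by (rule Basis_le_norm)
  also have "\<dots> \<le> tensor_norm k A"
    unfolding tensor_norm_def using assms(1) by (intro member_le_L2_set) auto
  finally show ?thesis .
qed

lemma tensor_norm_nonneg [simp]: "0 \<le> tensor_norm k A"
  by (simp add: tensor_norm_def)

lemma tensor_norm_measurable:
  fixes A :: "'a \<Rightarrow> 'd::finite list \<Rightarrow> 'b::euclidean_space"
  assumes "\<And>w. w \<in> words k \<Longrightarrow> (\<lambda>\<omega>. A \<omega> w) \<in> borel_measurable M"
  shows "(\<lambda>\<omega>. tensor_norm k (A \<omega>)) \<in> borel_measurable M"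
  unfolding tensor_norm_def L2_set_def using assms by measurable

lemma square_integral_le_Lp_norm:
  assumes X [measurable]: "X \<in> borel_measurable M" and Z: "in_Lp M 2 Z" "Lp_norm M 2 Z \<le> B"
    and le: "AE \<omega> in M. \<bar>X \<omega>\<bar> \<le> \<bar>Z \<omega>\<bar>"
  shows "integrable M (\<lambda>\<omega>. (X \<omega>)\<^sup>2)" "(\<integral>\<omega>. (X \<omega>)\<^sup>2 \<partial>M) \<le> B\<^sup>2"
proof -
  have [simp]: "\<bar>Z \<omega>\<bar> powr 2 = (Z \<omega>)\<^sup>2" for \<omega>
    by (simp add: powr_numeral)
  have int: "integrable M (\<lambda>\<omega>. (Z \<omega>)\<^sup>2)" using Z(1) by (simp add: in_Lp_def)
  have sq: "AE \<omega> in M. (X \<omega>)\<^sup>2 \<le> (Z \<omega>)\<^sup>2"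
    using le by eventually_elim (rule abs_le_square_iff[THEN iffD1])
  show X2: "integrable M (\<lambda>\<omega>. (X \<omega>)\<^sup>2)"
    by (rule Bochner_Integration.integrable_bound[OF int]) (use sq in auto)
  have "(\<integral>\<omega>. (X \<omega>)\<^sup>2 \<partial>M) \<le> (\<integral>\<omega>. (Z \<omega>)\<^sup>2 \<partial>M)"
    by (rule integral_mono_AE[OF X2 int sq])
  also have "\<dots> = (Lp_norm M 2 Z)\<^sup>2"
    by (simp add: Lp_norm_def powr_half_sqrt)
  also have "\<dots> \<le> B\<^sup>2"
    using Z(2) by (intro power_mono) (auto simp: Lp_norm_def)
  finally show "(\<integral>\<omega>. (X \<omega>)\<^sup>2 \<partial>M) \<le> B\<^sup>2" .
qed

text \<open>Whether an operator norm exceeds \<open>c\<close> is witnessed by a vector of a countable dense set, so the norm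
  is measurable as soon as the values at fixed vectors are.\<close>

lemma borel_measurable_norm_blinfun:
  fixes D :: "'a \<Rightarrow> 'v::euclidean_space \<Rightarrow>\<^sub>L 'w::euclidean_space"
  assumes "\<And>v. (\<lambda>\<omega>. blinfun_apply (D \<omega>) v) \<in> borel_measurable M"
  shows "(\<lambda>\<omega>. norm (D \<omega>)) \<in> borel_measurable M"
proof (rule borel_measurable_iff_greater[THEN iffD2], rule allI)
  fix c :: real
  obtain X :: "'v set" where X: "countable X" "\<And>U. open U \<Longrightarrow> U \<noteq> {} \<Longrightarrow> \<exists>d\<in>X. d \<in> U"
    using countable_dense_exists by blast
  show "{\<omega> \<in> space M. c < norm (D \<omega>)} \<in> sets M"
  proof (cases "c < 0")
    case True
    then have "{\<omega> \<in> space M. c < norm (D \<omega>)} = space M" by (auto intro: less_le_trans)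
    then show ?thesis by simp
  next
    case False
    have "c < norm (D \<omega>) \<longleftrightarrow> (\<exists>v\<in>X. c * norm v < norm (blinfun_apply (D \<omega>) v))" for \<omega>
    proof
      assume "\<exists>v\<in>X. c * norm v < norm (blinfun_apply (D \<omega>) v)"
      then obtain v where "c * norm v < norm (blinfun_apply (D \<omega>) v)" by blast
      also have "\<dots> \<le> norm (D \<omega>) * norm v" by (rule norm_blinfun)
      finally show "c < norm (D \<omega>)" by (simp add: mult_less_cancel_right)
    next
      assume c: "c < norm (D \<omega>)"
      have "open {v. c * norm v < norm (blinfun_apply (D \<omega>) v)}"
        by (intro open_Collect_less continuous_intros)
      moreover have "{v. c * norm v < norm (blinfun_apply (D \<omega>) v)} \<noteq> {}"
        using c norm_blinfun_bound[of c "D \<omega>"] False by (force simp: not_less)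
      ultimately show "\<exists>v\<in>X. c * norm v < norm (blinfun_apply (D \<omega>) v)"
        using X(2) by blast
    qed
    then have "{\<omega> \<in> space M. c < norm (D \<omega>)} =
        (\<Union>v\<in>X. {\<omega> \<in> space M. c * norm v < norm (blinfun_apply (D \<omega>) v)})" by auto
    also have "\<dots> \<in> sets M"
      using X(1) assms by (intro sets.countable_UN') (auto intro!: borel_measurable_less)
    finally show ?thesis .
  qed
qed

text \<open>Control in \<open>L_2\<close> gives the bound on the whole space. Under almost sure control the random constant is
  bounded on an event of probability close to one, where the remainders are then bounded by a
  deterministic multiple of the power of \<open>t - s\<close>.\<close>

lemma (in prob_space) controlled_remainder_bound:
  fixes x :: "nat \<Rightarrow> real \<Rightarrow> real \<Rightarrow> 'a \<Rightarrow> 'd::finite list \<Rightarrow> real"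
    and y :: "nat \<Rightarrow> real \<Rightarrow> 'a \<Rightarrow> 'd list \<Rightarrow> 'v::euclidean_space"
  assumes controlled: "controlled_Lp M 2 \<nu> l x y \<or> controlled_AE M \<nu> l x y"
    and x_meas: "\<And>k w s t. k < l \<Longrightarrow> w \<in> words k \<Longrightarrow> 0 \<le> s \<Longrightarrow> s \<le> t \<Longrightarrow> t \<le> 1 \<Longrightarrow>
      (\<lambda>\<omega>. x k s t \<omega> w) \<in> borel_measurable M"
    and b: "b \<in> Basis" and e: "0 < e"
  defines "r \<equiv> remainder l x (\<lambda>k t \<omega> w. y k t \<omega> w \<bullet> b)"
  shows "\<exists>A\<in>events. \<exists>G>0. prob (space M - A) < e \<and>
      (\<forall>s t k. \<forall>w\<in>words k. 0 \<le> s \<longrightarrow> s \<le> t \<longrightarrow> t \<le> 1 \<longrightarrow> k < l \<longrightarrow>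
        integrable M (\<lambda>\<omega>. (indicator A \<omega> * r k s t \<omega> w)\<^sup>2) \<and>
        (\<integral>\<omega>. (indicator A \<omega> * r k s t \<omega> w)\<^sup>2 \<partial>M)
          \<le> (G * (t - s) powr (real (l - k) * \<nu>))\<^sup>2)"
proof -
  have "continuous_processes M l y"
    using controlled by (auto simp: controlled_Lp_def controlled_AE_def)
  then have r_meas: "(\<lambda>\<omega>. r k s t \<omega> w) \<in> borel_measurable M"
    if "k < l" "w \<in> words k" "0 \<le> s" "s \<le> t" "t \<le> 1" for k w s t
    unfolding r_def using that x_meas
    by (intro remainder_measurable borel_measurable_inner borel_measurable_const)
      (auto simp: continuous_processes_def)
  have r_le: "\<bar>r k s t \<omega> w\<bar> \<le> tensor_norm k (remainder l x y k s t \<omega>)" if "w \<in> words k" for k s t \<omega> w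
    unfolding r_def remainder_component using that b by (rule component_le_tensor_norm)
  from controlled show ?thesis
  proof
    assume "controlled_Lp M 2 \<nu> l x y"
    then obtain K where K: "\<And>s t k. (s, t) \<in> simplex2 \<Longrightarrow> k < l \<Longrightarrow>
        in_Lp M 2 (\<lambda>\<omega>. tensor_norm k (remainder l x y k s t \<omega>)) \<and>
        Lp_norm M 2 (\<lambda>\<omega>. tensor_norm k (remainder l x y k s t \<omega>)) \<le> K * (t - s) powr (real (l - k) * \<nu>)"
      unfolding controlled_Lp_def by blast
    have "integrable M (\<lambda>\<omega>. (indicator (space M) \<omega> * r k s t \<omega> w)\<^sup>2) \<and>
        (\<integral>\<omega>. (indicator (space M) \<omega> * r k s t \<omega> w)\<^sup>2 \<partial>M)
          \<le> (max K 1 * (t - s) powr (real (l - k) * \<nu>))\<^sup>2"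
      if "w \<in> words k" "0 \<le> s" "s \<le> t" "t \<le> 1" "k < l" for s t k w
    proof -
      note * = K[of s t k]
      have "K * (t - s) powr (real (l - k) * \<nu>) \<le> max K 1 * (t - s) powr (real (l - k) * \<nu>)"
        by (intro mult_right_mono) auto
      then have "Lp_norm M 2 (\<lambda>\<omega>. tensor_norm k (remainder l x y k s t \<omega>))
          \<le> max K 1 * (t - s) powr (real (l - k) * \<nu>)"
        using * that by (auto simp: simplex2_def)
      moreover have "in_Lp M 2 (\<lambda>\<omega>. tensor_norm k (remainder l x y k s t \<omega>))"
        using * that by (auto simp: simplex2_def)
      moreover have "(\<lambda>\<omega>. indicator (space M) \<omega> * r k s t \<omega> w) \<in> borel_measurable M"
        using that by (intro borel_measurable_times r_meas) auto
      moreover have "AE \<omega> in M. \<bar>indicator (space M) \<omega> * r k s t \<omega> w\<bar>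
          \<le> \<bar>tensor_norm k (remainder l x y k s t \<omega>)\<bar>"
        using r_le[OF that(1)] by (auto simp: indicator_def)
      ultimately show ?thesis
        using square_integral_le_Lp_norm by blast
    qed
    then show ?thesis
      using e by (intro bexI[of _ "space M"] exI[of _ "max K 1"]) auto
  next
    assume "controlled_AE M \<nu> l x y"
    then obtain G :: "'a \<Rightarrow> real" where G [measurable]: "G \<in> borel_measurable M"
      and bound: "AE \<omega> in M. \<forall>(s, t)\<in>simplex2. \<forall>k<l.
        tensor_norm k (remainder l x y k s t \<omega>) \<le> G \<omega> * (t - s) powr (real (l - k) * \<nu>)"
      unfolding controlled_AE_def by blast
    from random_variable_tight[OF G e] obtain B where
      B: "0 < B" "prob {\<omega> \<in> space M. \<bar>G \<omega>\<bar> > B} < e" .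
    let ?A = "{\<omega> \<in> space M. \<bar>G \<omega>\<bar> \<le> B}"
    have "space M - ?A = {\<omega> \<in> space M. \<bar>G \<omega>\<bar> > B}" by auto
    with B have "prob (space M - ?A) < e" by simp
    moreover have "integrable M (\<lambda>\<omega>. (indicator ?A \<omega> * r k s t \<omega> w)\<^sup>2) \<and>
        (\<integral>\<omega>. (indicator ?A \<omega> * r k s t \<omega> w)\<^sup>2 \<partial>M) \<le> (B * (t - s) powr (real (l - k) * \<nu>))\<^sup>2"
      if "w \<in> words k" "0 \<le> s" "s \<le> t" "t \<le> 1" "k < l" for s t k w
    proof -
      let ?c = "B * (t - s) powr (real (l - k) * \<nu>)"
      have meas: "(\<lambda>\<omega>. (indicator ?A \<omega> * r k s t \<omega> w)\<^sup>2) \<in> borel_measurable M"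
        using that by (intro borel_measurable_power borel_measurable_times r_meas) auto
      have le: "AE \<omega> in M. (indicator ?A \<omega> * r k s t \<omega> w)\<^sup>2 \<le> ?c\<^sup>2"
        using bound
      proof eventually_elim
        case (elim \<omega>)
        show ?case
        proof (cases "\<omega> \<in> ?A")
          case True
          have "\<bar>r k s t \<omega> w\<bar> \<le> G \<omega> * (t - s) powr (real (l - k) * \<nu>)"
            using order_trans[OF r_le[OF that(1)]] elim that by (auto simp: simplex2_def)
          also have "\<dots> \<le> ?c"
            using True by (intro mult_right_mono) auto
          finally have "\<bar>r k s t \<omega> w\<bar> \<le> ?c" .
          then have "\<bar>r k s t \<omega> w\<bar>\<^sup>2 \<le> ?c\<^sup>2" by (rule power_mono) simp
          then show ?thesis using True by simp
        qed simp
      qed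
      have int: "integrable M (\<lambda>\<omega>. (indicator ?A \<omega> * r k s t \<omega> w)\<^sup>2)"
        by (rule integrable_const_bound[OF _ meas, of "?c\<^sup>2"]) (use le in auto)
      moreover have "(\<integral>\<omega>. (indicator ?A \<omega> * r k s t \<omega> w)\<^sup>2 \<partial>M) \<le> (\<integral>\<omega>. ?c\<^sup>2 \<partial>M)"
        by (rule integral_mono_AE[OF int _ le]) simp
      ultimately show ?thesis by (simp add: prob_space)
    qed
    ultimately show ?thesis
      using B(1) by (intro bexI[of _ ?A] exI[of _ B] conjI allI ballI impI) auto
  qed
qed

theorem theorem1p3:
  fixes M :: "'o measure"
    and \<nu> \<alpha> :: real and l \<tau> :: nat
    and x :: "nat \<Rightarrow> real \<Rightarrow> real \<Rightarrow> 'o \<Rightarrow> 'd::finite list \<Rightarrow> real"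
    and y :: "nat \<Rightarrow> real \<Rightarrow> 'o \<Rightarrow> 'd list \<Rightarrow> 'v::euclidean_space"
    and h :: "nat \<Rightarrow> real \<Rightarrow> real \<Rightarrow> 'o \<Rightarrow> 'w::euclidean_space"
    and \<rho> :: "'d list \<Rightarrow> 'w"
  assumes "prob_space M"
    and "0 < \<nu>" "\<nu> < 1" "0 < \<alpha>"
    and "l = (LEAST j. 1 \<le> j \<and> \<nu> * real j + \<alpha> > 1)"
    and "rough_path M 4 \<nu> l x"
    and "controlled_Lp M 2 \<nu> l x y \<or> controlled_AE M \<nu> l x y"
    and "\<forall>n\<ge>1. one_increment M n (h n)"
    and "\<exists>K. \<forall>n\<ge>1. \<forall>i<l. \<forall>s\<in>grid n. \<forall>t\<in>grid n. s < t \<longrightarrow>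
           in_Lp M 2 (\<lambda>\<omega>. tensor_norm i (J_rough n (x i) (h n) s t \<omega>)) \<and>
           Lp_norm M 2 (\<lambda>\<omega>. tensor_norm i (J_rough n (x i) (h n) s t \<omega>))
             \<le> K * (t - s) powr (\<alpha> + \<nu> * real i)"
    and "\<tau> < l"
    and "\<forall>(s, t)\<in>simplex2. tendsto_zero_in_prob M
           (\<lambda>n \<omega>. tensor_norm \<tau> (\<lambda>w. J_rough n (x \<tau>) (h n) s t \<omega> w - (t - s) *\<^sub>R \<rho> w))"
    and "\<forall>i<\<tau>. \<forall>(s, t)\<in>simplex2. tendsto_zero_in_prob M
           (\<lambda>n \<omega>. tensor_norm i (J_rough n (x i) (h n) s t \<omega>))"
    and "\<forall>i. \<tau> < i \<and> i < l \<longrightarrow> (\<forall>S. (\<forall>m\<ge>1. fine_partition m (S m)) \<longrightarrow>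
           lim_limsup_zero_in_prob M (\<lambda>m n \<omega>. tensor_norm i
             (\<lambda>w. \<Sum>j<m. J_rough n (x i) (h n) (S m j) (S m (Suc j)) \<omega> w)))"
  shows "\<forall>(s, t)\<in>simplex2. tendsto_zero_in_prob M
           (\<lambda>n \<omega>. norm (J_weight n (\<lambda>t \<omega>. y 0 t \<omega> []) (h n) s t \<omega>
                    - contract \<tau> (\<lambda>w. integral {s..t} (\<lambda>u. y \<tau> u \<omega> w)) \<rho>))"
proof (intro ballI, clarify)
  fix s t assume "(s, t) \<in> simplex2"
  then have st: "0 \<le> s" "s \<le> t" "t \<le> 1" by (auto simp: simplex2_def)
  interpret prob_space M by fact

  \<comment> \<open>The least number is attained because \<open>\<nu> j + \<alpha>\<close> is unbounded in \<open>j\<close>.\<close>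
  obtain j :: nat where "(1 - \<alpha>) / \<nu> < real j" using reals_Archimedean2 by blast
  then have "1 \<le> Suc j \<and> \<nu> * real (Suc j) + \<alpha> > 1"
    using assms(2) by (simp add: field_simps)
  from LeastI[of "\<lambda>j. 1 \<le> j \<and> \<nu> * real j + \<alpha> > 1", OF this]
  have exponent: "1 < \<nu> * real l + \<alpha>" using assms(5) by simp

  have rough: "\<And>s t \<omega>. \<omega> \<in> space M \<Longrightarrow> x 0 s t \<omega> [] = 1"
    "\<And>k w s t. 0 < k \<Longrightarrow> k < l \<Longrightarrow> w \<in> words k \<Longrightarrow> 0 \<le> s \<Longrightarrow> s \<le> t \<Longrightarrow> t \<le> 1 \<Longrightarrow>
      (\<lambda>\<omega>. x k s t \<omega> w) \<in> borel_measurable M"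
    "\<And>k w \<omega>. 0 < k \<Longrightarrow> k < l \<Longrightarrow> w \<in> words k \<Longrightarrow> \<omega> \<in> space M \<Longrightarrow>
      continuous_on simplex2 (\<lambda>(s, t). x k s t \<omega> w)"
    "\<And>k s u t. 0 < k \<Longrightarrow> k < l \<Longrightarrow> 0 \<le> s \<Longrightarrow> s \<le> u \<Longrightarrow> u \<le> t \<Longrightarrow> t \<le> 1 \<Longrightarrow>
      AE \<omega> in M. \<forall>w\<in>words k. delta2 (\<lambda>a b. x k a b \<omega> w) s u t =
        (\<Sum>j=1..k-1. tensor_mult (k - j) (x (k - j) s u \<omega>) (x j u t \<omega>) w)"
    using assms(6) unfolding rough_path_def by (simp_all add: simplex2_def)
  have x_meas: "(\<lambda>\<omega>. x k s t \<omega> w) \<in> borel_measurable M"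
    if "k < l" "w \<in> words k" "0 \<le> s" "s \<le> t" "t \<le> 1" for k w s t
  proof (cases "k = 0")
    case True
    then show ?thesis using that(2) rough(1) by (simp cong: measurable_cong)
  qed (use that rough(2) in simp)
  have y_meas: "(\<lambda>\<omega>. y k t \<omega> w) \<in> borel_measurable M" if "k < l" "w \<in> words k" "t \<in> {0..1}" for k w t
    using assms(7) that by (auto simp: controlled_Lp_def controlled_AE_def continuous_processes_def)
  have y_cont: "continuous_on {0..1} (\<lambda>t. y k t \<omega> w)"
    if "k < l" "w \<in> words k" "\<omega> \<in> space M" for k w \<omega>
    using assms(7) that by (auto simp: controlled_Lp_def controlled_AE_def continuous_processes_def)
  have h_meas: "h n (gpt n k) (gpt n (Suc k)) \<in> borel_measurable M" if "k < n" for n k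
    using assms(8)[rule_format, of n] that gpt_mono[of k "Suc k" n]
    by (auto simp: one_increment_def grid_def)
  have J_meas: "(\<lambda>\<omega>. J_rough n (x i) (h n) a b \<omega> w) \<in> borel_measurable M"
    if "i < l" "w \<in> words i" "0 \<le> a" "b \<le> 1" for n i a b w
    using that by (intro J_rough_measurable x_meas h_meas)
  obtain K where K: "\<And>n i s t. n \<ge> 1 \<Longrightarrow> i < l \<Longrightarrow> s \<in> grid n \<Longrightarrow> t \<in> grid n \<Longrightarrow> s < t \<Longrightarrow>
           in_Lp M 2 (\<lambda>\<omega>. tensor_norm i (J_rough n (x i) (h n) s t \<omega>)) \<and>
           Lp_norm M 2 (\<lambda>\<omega>. tensor_norm i (J_rough n (x i) (h n) s t \<omega>))
             \<le> K * (t - s) powr (\<alpha> + \<nu> * real i)"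
    using assms(9) by blast

  let ?D = "\<lambda>n \<omega>. J_weight n (\<lambda>t \<omega>. y 0 t \<omega> []) (h n) s t \<omega>
      - contract \<tau> (\<lambda>w. integral {s..t} (\<lambda>u. y \<tau> u \<omega> w)) \<rho>"
  have y\<tau>_cont: "continuous_on {s..t} (\<lambda>u. y \<tau> u \<omega> w)" if "\<omega> \<in> space M" "w \<in> words \<tau>" for \<omega> w
    by (rule continuous_on_subset[OF y_cont[OF assms(10) that(2,1)]]) (use st in auto)
  have y_int: "integral {s..t} (\<lambda>u. y \<tau> u \<omega> w) \<bullet> v = integral {s..t} (\<lambda>u. y \<tau> u \<omega> w \<bullet> v)"
    if "\<omega> \<in> space M" "w \<in> words \<tau>" for \<omega> w v
  proof -
    have "(\<lambda>u. y \<tau> u \<omega> w) integrable_on {s..t}"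
      by (intro integrable_continuous_interval y\<tau>_cont that)
    from integral_linear[OF this bounded_linear_inner_left[of v]] show ?thesis
      by (simp add: o_def)
  qed
  have D_apply: "blinfun_apply (?D n \<omega>) v =
      (\<Sum>k\<in>cells n s t. (y 0 (gpt n k) \<omega> [] \<bullet> v) *\<^sub>R h n (gpt n k) (gpt n (Suc k)) \<omega>)
      - (\<Sum>w\<in>words \<tau>. integral {s..t} (\<lambda>u. y \<tau> u \<omega> w \<bullet> v) *\<^sub>R \<rho> w)" if "\<omega> \<in> space M" for n \<omega> v
    using y_int[OF that]
    by (simp add: J_weight_def contract_def blinfun.diff_left blinfun.sum_left blinfun_apply_vtensor)
  have D_meas: "(\<lambda>\<omega>. blinfun_apply (?D n \<omega>) v) \<in> borel_measurable M" for n v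
    using st y_meas h_meas assms(10) gpt_bounds grid_index_le[OF st(3), of n] y\<tau>_cont
    by (subst measurable_cong[OF D_apply])
      (auto simp: cells_eq intro!: borel_measurable_diff borel_measurable_sum borel_measurable_scaleR
        borel_measurable_inner borel_measurable_integral_continuous continuous_intros)

  have component: "vanishes (\<lambda>n \<omega>. blinfun_apply (?D n \<omega>) b \<bullet> c)" if b: "b \<in> Basis" and c: "c \<in> Basis" for b c
  proof -
    let ?h = "\<lambda>n s t \<omega>. h n s t \<omega> \<bullet> c" and ?\<rho> = "\<lambda>w. \<rho> w \<bullet> c" and ?y = "\<lambda>k t \<omega> w. y k t \<omega> w \<bullet> b"
    have Jc_meas: "(\<lambda>\<omega>. J_rough n (x i) (h n) u v \<omega> w \<bullet> c) \<in> borel_measurable M"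
      if "i < l" "w \<in> words i" "0 \<le> u" "v \<le> 1" for n i u v w
      using J_meas[OF that] by measurable
    interpret controlled_sums M l \<tau> x ?h ?\<rho> \<nu> \<alpha> "max K 1" ?y
    proof
      fix w :: "'d list" and u v :: real
      assume "w \<in> words \<tau>" and uv: "0 \<le> u" "u \<le> v" "v \<le> 1"
      show "vanishes (\<lambda>n \<omega>. J_rough n (x \<tau>) (?h n) u v \<omega> w - (v - u) * ?\<rho> w)"
        unfolding J_rough_component
      proof (rule vanishes_dominated)
        show "vanishes (\<lambda>n \<omega>. tensor_norm \<tau> (\<lambda>w. J_rough n (x \<tau>) (h n) u v \<omega> w - (v - u) *\<^sub>R \<rho> w))"
          using assms(11) uv by (auto simp: simplex2_def)
        show "\<forall>\<^sub>F n in sequentially. AE \<omega> in M. \<bar>J_rough n (x \<tau>) (h n) u v \<omega> w \<bullet> c - (v - u) * ?\<rho> w\<bar>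
            \<le> \<bar>tensor_norm \<tau> (\<lambda>w. J_rough n (x \<tau>) (h n) u v \<omega> w - (v - u) *\<^sub>R \<rho> w)\<bar>"
        proof (rule always_eventually, rule allI, rule AE_I2)
          fix n \<omega>
          show "\<bar>J_rough n (x \<tau>) (h n) u v \<omega> w \<bullet> c - (v - u) * ?\<rho> w\<bar>
            \<le> \<bar>tensor_norm \<tau> (\<lambda>w. J_rough n (x \<tau>) (h n) u v \<omega> w - (v - u) *\<^sub>R \<rho> w)\<bar>"
            using component_le_tensor_norm[OF \<open>w \<in> words \<tau>\<close> c,
                of "\<lambda>w. J_rough n (x \<tau>) (h n) u v \<omega> w - (v - u) *\<^sub>R \<rho> w"]
            by (simp add: inner_diff_left)
        qed
        show "(\<lambda>\<omega>. J_rough n (x \<tau>) (h n) u v \<omega> w \<bullet> c - (v - u) * ?\<rho> w) \<in> borel_measurable M" for n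
          using Jc_meas[OF assms(10) \<open>w \<in> words \<tau>\<close> uv(1,3)] by measurable
      qed
    next
      fix i and w :: "'d list" and u v :: real
      assume i: "i < \<tau>" "w \<in> words i" and uv: "0 \<le> u" "u \<le> v" "v \<le> 1"
      show "vanishes (\<lambda>n \<omega>. J_rough n (x i) (?h n) u v \<omega> w)"
        unfolding J_rough_component
      proof (rule vanishes_dominated)
        show "vanishes (\<lambda>n \<omega>. tensor_norm i (J_rough n (x i) (h n) u v \<omega>))"
          using assms(12) i uv by (auto simp: simplex2_def)
        show "\<forall>\<^sub>F n in sequentially. AE \<omega> in M. \<bar>J_rough n (x i) (h n) u v \<omega> w \<bullet> c\<bar>
            \<le> \<bar>tensor_norm i (J_rough n (x i) (h n) u v \<omega>)\<bar>"
          using component_le_tensor_norm[OF i(2) c] by simp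
        show "(\<lambda>\<omega>. J_rough n (x i) (h n) u v \<omega> w \<bullet> c) \<in> borel_measurable M" for n
          using i uv assms(10) by (intro Jc_meas) auto
      qed
    next
      fix i and w :: "'d list" and u v :: real
      assume i: "\<tau> < i" "i < l" "w \<in> words i" and uv: "0 \<le> u" "u < v" "v \<le> 1"
      let ?F = "\<lambda>m n \<omega>. tensor_norm i
        (\<lambda>w. \<Sum>j<m. J_rough n (x i) (h n) (uniform_node u v m j) (uniform_node u v m (Suc j)) \<omega> w)"
      \<comment> \<open>The partition of \<open>[u, v]\<close> into \<open>m\<close> equal parts is admissible since \<open>v - u \<le> 1\<close>.\<close>
      show "vanishes_iterated (\<lambda>m n \<omega>. \<Sum>j<m.
          J_rough n (x i) (?h n) (uniform_node u v m j) (uniform_node u v m (Suc j)) \<omega> w)"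
        unfolding J_rough_component inner_sum_left[symmetric]
      proof (rule vanishes_iterated_dominated[where F = ?F])
        have "\<forall>m\<ge>1. fine_partition m (uniform_node u v m)"
          using fine_partition_uniform_node[OF uv] by simp
        then have "lim_limsup_zero_in_prob M ?F"
          using assms(13) i by blast
        then show "vanishes_iterated ?F"
          by (rule vanishes_iterated_lim_limsup)
        have F_meas: "?F m n \<in> borel_measurable M" if "m > 0" for m n
        proof (intro tensor_norm_measurable borel_measurable_sum J_meas)
          fix w' :: "'d list" and j assume "w' \<in> words i" "j \<in> {..<m}"
          then show "0 \<le> uniform_node u v m j" "uniform_node u v m (Suc j) \<le> 1" "w' \<in> words i"
            using uniform_node_bounds[of u v m j] uniform_node_bounds[of u v m "Suc j"] uv by auto
        qed (use i in auto)
        show "\<forall>\<^sub>F m in sequentially. \<forall>\<^sub>F n in sequentially. ?F m n \<in> borel_measurable M"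
          using eventually_gt_at_top[of "0::nat"]
          by eventually_elim (intro always_eventually allI F_meas)
        show "\<bar>(\<Sum>j<m. J_rough n (x i) (h n) (uniform_node u v m j) (uniform_node u v m (Suc j)) \<omega> w) \<bullet> c\<bar> \<le> \<bar>?F m n \<omega>\<bar>"
          for m n \<omega>
          using component_le_tensor_norm[OF i(3) c,
              of "\<lambda>w. \<Sum>j<m. J_rough n (x i) (h n) (uniform_node u v m j) (uniform_node u v m (Suc j)) \<omega> w"]
          by simp
      qed
    next
      fix i a b' n :: nat and w :: "'d list"
      assume *: "i < l" "w \<in> words i" "a < b'" "b' \<le> n"
      let ?Z = "\<lambda>\<omega>. tensor_norm i (J_rough n (x i) (h n) (gpt n a) (gpt n b') \<omega>)"
      have grid: "gpt n a \<in> grid n" "gpt n b' \<in> grid n" "gpt n a < gpt n b'"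
        using * by (auto simp: grid_def gpt_def divide_strict_right_mono)
      have len: "gpt n b' - gpt n a = real (b' - a) / real n"
        using * by (simp add: gpt_diff)
      have Z: "in_Lp M 2 ?Z" "Lp_norm M 2 ?Z \<le> K * (real (b' - a) / real n) powr (\<alpha> + \<nu> * real i)"
        using K[OF _ *(1) grid] * by (auto simp: len)
      have "K * (real (b' - a) / real n) powr (\<alpha> + \<nu> * real i)
          \<le> max K 1 * (real (b' - a) / real n) powr (\<alpha> + \<nu> * real i)"
        by (intro mult_right_mono) auto
      with Z(2) have Z2: "Lp_norm M 2 ?Z \<le> max K 1 * (real (b' - a) / real n) powr (\<alpha> + \<nu> * real i)"
        by linarith
      have meas: "(\<lambda>\<omega>. J_rough n (x i) (h n) (gpt n a) (gpt n b') \<omega> w \<bullet> c) \<in> borel_measurable M"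
        using * gpt_bounds by (intro Jc_meas) auto
      have le: "AE \<omega> in M. \<bar>J_rough n (x i) (h n) (gpt n a) (gpt n b') \<omega> w \<bullet> c\<bar> \<le> \<bar>?Z \<omega>\<bar>"
        using component_le_tensor_norm[OF *(2) c] by simp
      show "integrable M (\<lambda>\<omega>. (J_rough n (x i) (?h n) (gpt n a) (gpt n b') \<omega> w)\<^sup>2) \<and>
        (\<integral>\<omega>. (J_rough n (x i) (?h n) (gpt n a) (gpt n b') \<omega> w)\<^sup>2 \<partial>M)
          \<le> (max K 1 * (real (b' - a) / real n) powr (\<alpha> + \<nu> * real i))\<^sup>2"
        unfolding J_rough_component
        using square_integral_le_Lp_norm[OF meas Z(1) Z2 le] by blast
    next
      fix e :: real assume "0 < e"
      show "\<exists>A\<in>events. \<exists>G>0. prob (space M - A) < e \<and>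
        (\<forall>s t k. \<forall>w\<in>words k. 0 \<le> s \<longrightarrow> s \<le> t \<longrightarrow> t \<le> 1 \<longrightarrow> k < l \<longrightarrow>
          integrable M (\<lambda>\<omega>. (indicator A \<omega> * remainder l x ?y k s t \<omega> w)\<^sup>2) \<and>
          (\<integral>\<omega>. (indicator A \<omega> * remainder l x ?y k s t \<omega> w)\<^sup>2 \<partial>M)
            \<le> (G * (t - s) powr (real (l - k) * \<nu>))\<^sup>2)"
        by (rule controlled_remainder_bound[OF assms(7) x_meas b \<open>0 < e\<close>])
    next
      fix k n :: nat assume "k < n"
      then show "(\<lambda>\<omega>. h n (gpt n k) (gpt n (Suc k)) \<omega> \<bullet> c) \<in> borel_measurable M"
        using h_meas[of k n] by measurable
    next
      fix k :: nat and w :: "'d list" and u :: real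
      assume "k < l" "w \<in> words k" "u \<in> {0..1}"
      from y_meas[OF this] show "(\<lambda>\<omega>. y k u \<omega> w \<bullet> b) \<in> borel_measurable M" by measurable
    next
      fix k :: nat and w :: "'d list" and \<omega>
      assume "k < l" "w \<in> words k" "\<omega> \<in> space M"
      then show "continuous_on {0..1} (\<lambda>u. y k u \<omega> w \<bullet> b)"
        using y_cont[of k w \<omega>] by (intro continuous_intros) auto
    qed (use rough assms exponent in auto)
    show ?thesis
    proof (rule vanishes_cong[OF Jy_limit[OF st]])
      show "(\<lambda>\<omega>. blinfun_apply (?D n \<omega>) b \<bullet> c) \<in> borel_measurable M" for n
        using D_meas[of n b] by measurable
      show "\<forall>\<^sub>F n in sequentially. AE \<omega> in M. blinfun_apply (?D n \<omega>) b \<bullet> c =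
          Jy n s t \<omega> - (\<Sum>v\<in>words \<tau>. integral {s..t} (\<lambda>u. ?y \<tau> u \<omega> v) * ?\<rho> v)"
      proof (rule always_eventually, rule allI, rule AE_I2)
        fix n \<omega> assume "\<omega> \<in> space M"
        then show "blinfun_apply (?D n \<omega>) b \<bullet> c =
          Jy n s t \<omega> - (\<Sum>v\<in>words \<tau>. integral {s..t} (\<lambda>u. ?y \<tau> u \<omega> v) * ?\<rho> v)"
          by (simp only: D_apply) (simp add: Jy_def inner_diff_left inner_sum_left)
      qed
    qed
  qed

  show "tendsto_zero_in_prob M (\<lambda>n \<omega>. norm (?D n \<omega>))"
  proof (rule vanishes_dominated)
    show "vanishes (\<lambda>n \<omega>. \<Sum>b\<in>Basis. \<Sum>c\<in>Basis. \<bar>blinfun_apply (?D n \<omega>) b \<bullet> c\<bar>)"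
      by (intro vanishes_sum vanishes_abs component)
    show "(\<lambda>\<omega>. norm (?D n \<omega>)) \<in> borel_measurable M" for n
      by (rule borel_measurable_norm_blinfun[OF D_meas])
    show "\<forall>\<^sub>F n in sequentially. AE \<omega> in M. \<bar>norm (?D n \<omega>)\<bar>
        \<le> \<bar>\<Sum>b\<in>Basis. \<Sum>c\<in>Basis. \<bar>blinfun_apply (?D n \<omega>) b \<bullet> c\<bar>\<bar>"
    proof (rule always_eventually, rule allI, rule AE_I2)
      fix n \<omega>
      have "norm (?D n \<omega>) \<le> (\<Sum>b\<in>Basis. norm (blinfun_apply (?D n \<omega>) b))"
        by (rule norm_blinfun_euclidean_le)
      also have "\<dots> \<le> (\<Sum>b\<in>Basis. \<Sum>c\<in>Basis. \<bar>blinfun_apply (?D n \<omega>) b \<bullet> c\<bar>)"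
        by (intro sum_mono norm_le_l1)
      finally show "\<bar>norm (?D n \<omega>)\<bar> \<le> \<bar>\<Sum>b\<in>Basis. \<Sum>c\<in>Basis. \<bar>blinfun_apply (?D n \<omega>) b \<bullet> c\<bar>\<bar>"
        by simp
    qed
  qed
qed

end
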